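(* Let $g,h$ be non-negative integers and let $S=R\cup B$ be a set of $3g+h$ red points and $3h+g$ blue points in the plane in convex position, with $n=|S|$. Then deciding whether $S$ admits a $K_{1,3}$-covering (of all its points) can be done in $O(n^5)$ time and $O(n^2)$ space. Moreover, a $K_{1,3}$-covering of a subset of $S$ of at least $4(g+h)-4$ points can be computed in linear time.
   Context: Convex position: every point is a vertex of the convex hull (no three collinear). A $K_{1,3}$-covering of a set $X$ of red and blue points is a partition of $X$ into subsets of size $4$, each consisting of one point (the center) of one color and three points of the other color, such that the straight-line segments joining each center to the three other points of its subset are pairwise non-crossing (no two intersect except at a common endpoint).
   Formalization: The linear-time claim is stated for S listed in counterclockwise hull order; for arbitrarily listed points it fails on a real RAM, since with the two colours on separate arcs a covering sorts the points up to constant-size groups, forcing Ω(n log n) time. *)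

theory Defs
  imports "HOL-Analysis.Analysis" "HOL-Library.Disjoint_Sets" "HOL-Library.Landau_Symbols"
begin

section \<open>Coverings by non-crossing stars\<close>

type_synonym point = "real \<times> real"

definition convex_position :: "point set \<Rightarrow> bool" where
  "convex_position S \<longleftrightarrow> (\<forall>p\<in>S. p extreme_point_of (convex hull S))"

fun noncrossing :: "point \<times> point \<Rightarrow> point \<times> point \<Rightarrow> bool" where
  "noncrossing (a, b) (c, d) \<longleftrightarrow> closed_segment a b \<inter> closed_segment c d \<subseteq> {a, b} \<inter> {c, d}"

definition is_center :: "point set \<Rightarrow> point set \<Rightarrow> point set \<Rightarrow> point \<Rightarrow> bool" where
  "is_center R B Q c \<longleftrightarrow>
     c \<in> Q \<and> card Q = 4 \<and> (c \<in> R \<and> Q - {c} \<subseteq> B \<or> c \<in> B \<and> Q - {c} \<subseteq> R)"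

definition star_edges :: "point set \<Rightarrow> point set \<Rightarrow> point set set \<Rightarrow> (point \<times> point) set" where
  "star_edges R B P = {(c, x) | c x. \<exists>Q\<in>P. is_center R B Q c \<and> x \<in> Q - {c}}"

definition K13_covering :: "point set \<Rightarrow> point set \<Rightarrow> point set \<Rightarrow> point set set \<Rightarrow> bool" where
  "K13_covering R B X P \<longleftrightarrow>
     partition_on X P \<and>
     (\<forall>Q\<in>P. \<exists>c. is_center R B Q c) \<and>
     pairwise noncrossing (star_edges R B P)"

definition orient :: "point \<Rightarrow> point \<Rightarrow> point \<Rightarrow> real" where
  "orient a b c =
     (fst b - fst a) * (snd c - snd a) - (snd b - snd a) * (fst c - fst a)"

text \<open>
  The points are listed in counterclockwise order along the boundary of their convex hull. Every
  finite set in convex position has such a listing (\<open>exists_ccw_order\<close> below). A linear-time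
  algorithm has to receive the points in this order: for linearly separated colour classes a
  covering reveals the order of the points along the hull, so computing one from an arbitrary
  listing is as hard as sorting.
\<close>

definition ccw_order :: "point list \<Rightarrow> bool" where
  "ccw_order ps \<longleftrightarrow>
     (\<forall>i j k. i < j \<longrightarrow> j < k \<longrightarrow> k < length ps \<longrightarrow> orient (ps ! i) (ps ! j) (ps ! k) > 0)"

lemma convex_position_notin_hull:
  assumes "convex_position S" "p \<in> S" "T \<subseteq> S - {p}"
  shows "p \<notin> convex hull T"
proof
  assume "p \<in> convex hull T"
  moreover have "convex hull T \<subseteq> convex hull (S - {p})"
    using assms(3) by (rule hull_mono)
  moreover have "p extreme_point_of (convex hull S)"
    using assms(1,2) by (simp add: convex_position_def)
  ultimately show False
  proof -
    assume ext: "p extreme_point_of (convex hull S)"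
      and "p \<in> convex hull T" "convex hull T \<subseteq> convex hull (S - {p})"
    then have "p \<in> convex hull (S - {p})" by blast
    moreover have "convex (convex hull S - {p})"
      using ext extreme_point_of_stillconvex[of "convex hull S" p] by simp
    moreover have "S - {p} \<subseteq> convex hull S - {p}"
      using hull_subset[of S convex] by blast
    ultimately have "p \<in> convex hull S - {p}"
      using hull_minimal[of "S - {p}" "convex hull S - {p}" convex] by blast
    then show False by simp
  qed
qed

lemma exists_ccw_order:
  assumes fin: "finite S" and cp: "convex_position S"
  shows "\<exists>ps. distinct ps \<and> set ps = S \<and> ccw_order ps"
proof (cases "S = {}")
  case True
  then show ?thesis by (intro exI[of _ "[]"]) (simp add: ccw_order_def)
next
  case False
  then obtain p where p: "p \<in> S" by blast
  define S' where "S' = S - {p}"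
  have finS': "finite S'" using fin by (simp add: S'_def)
  have "p \<notin> convex hull S'"
    using convex_position_notin_hull[OF cp p] by (simp add: S'_def)
  moreover have "closed (convex hull S')"
    using finS' by (simp add: finite_imp_compact_convex_hull compact_imp_closed)
  ultimately obtain u b where u: "inner u p < b" "\<forall>x\<in>convex hull S'. inner u x > b"
    using separating_hyperplane_closed_point[of "convex hull S'" p] convex_convex_hull by blast
  define f where "f x = inner u (x - p)" for x
  define g where "g x = fst u * snd (x - p) - snd u * fst (x - p)" for x
  have f: "f x > 0" if "x \<in> S'" for x
  proof -
    have "inner u x > b" using u(2) hull_inc[OF that] by blast
    then show ?thesis using u(1) by (simp add: f_def inner_diff_right)
  qed
  define key where "key x = g x / f x" for x
  have lag: "orient p x y * inner u u = f x * g y - g x * f y" for x y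
    by (simp add: orient_def f_def g_def inner_prod_def algebra_simps)
  have or_pos: "orient p x y > 0 \<longleftrightarrow> key x < key y" and or_zero: "orient p x y = 0 \<longleftrightarrow> key x = key y"
    if "x \<in> S'" "y \<in> S'" for x y
  proof -
    have "u \<noteq> 0" using f[OF that(1)] by (auto simp: f_def)
    then have uu: "inner u u > 0" by simp
    have "orient p x y > 0 \<longleftrightarrow> orient p x y * inner u u > 0"
      using uu zero_less_mult_pos2 mult_pos_pos by metis
    also have "\<dots> \<longleftrightarrow> key x < key y"
      using f[OF that(1)] f[OF that(2)] unfolding lag key_def by (simp add: field_simps)
    finally show "orient p x y > 0 \<longleftrightarrow> key x < key y" .
    have "orient p x y = 0 \<longleftrightarrow> orient p x y * inner u u = 0"
      using uu by simp
    also have "\<dots> \<longleftrightarrow> key x = key y"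
      using f[OF that(1)] f[OF that(2)] unfolding lag key_def by (auto simp: field_simps)
    finally show "orient p x y = 0 \<longleftrightarrow> key x = key y" .
  qed
  have comb: "(f y) *\<^sub>R (x - p) = (f x) *\<^sub>R (y - p)" if "orient p x y = 0" for x y
  proof -
    have "(f y) *\<^sub>R (x - p) - (f x) *\<^sub>R (y - p) = orient p x y *\<^sub>R (snd u, - fst u)"
      by (simp add: prod_eq_iff orient_def f_def inner_prod_def algebra_simps)
    then show ?thesis using that by (simp flip: zero_prod_def)
  qed
  have seg: False if xy: "x \<in> S'" "y \<in> S'" "x \<noteq> y" "orient p x y = 0" "f x \<le> f y" for x y
  proof -
    define t where "t = f x / f y"
    have t: "0 \<le> t" "t \<le> 1" using f[OF xy(1)] f[OF xy(2)] xy(5) by (simp_all add: t_def)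
    have "x - p = (inverse (f y) * f y) *\<^sub>R (x - p)" using f[OF xy(2)] by simp
    also have "\<dots> = inverse (f y) *\<^sub>R ((f x) *\<^sub>R (y - p))" using comb[OF xy(4)] by (simp flip: scaleR_scaleR)
    also have "\<dots> = t *\<^sub>R (y - p)" by (simp add: t_def field_simps)
    finally have "x = (1 - t) *\<^sub>R p + t *\<^sub>R y" by (simp add: algebra_simps)
    then have "x \<in> convex hull {p, y}"
      using t by (auto simp: in_segment simp flip: segment_convex_hull)
    then show False
      using convex_position_notin_hull[OF cp, of x "{p, y}"] xy p by (auto simp: S'_def)
  qed
  have inj: "inj_on key S'"
  proof (rule inj_onI)
    fix x y assume xy: "x \<in> S'" "y \<in> S'" "key x = key y"
    then have o: "orient p x y = 0" "orient p y x = 0" using or_zero by auto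
    show "x = y" using seg[OF xy(1,2) _ o(1)] seg[OF xy(2,1) _ o(2)] by fastforce
  qed
  obtain xs where xs: "set xs = S'" "distinct xs"
    using finite_distinct_list[OF finS'] by blast
  define qs where "qs = sort_key key xs"
  have qs: "set qs = S'" "distinct qs" "sorted (map key qs)" "distinct (map key qs)"
    using xs inj by (auto simp: qs_def distinct_map)
  have key_less: "key (qs ! i) < key (qs ! j)" if "i < j" "j < length qs" for i j
    using that qs(3,4) sorted_nth_mono[of "map key qs" i j] nth_eq_iff_index_eq[of "map key qs" i j] 
    by (fastforce simp: less_le)
  have tri: "orient a b c > 0"
    if "a \<in> S'" "b \<in> S'" "c \<in> S'" "key a < key b" "key b < key c" for a b c
  proof (rule ccontr)
    assume neg: "\<not> orient a b c > 0"
    define \<alpha> \<beta> \<gamma> where "\<alpha> = orient p a b" "\<beta> = orient p b c" "\<gamma> = orient p a c"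
    note d = this
    have pos: "\<alpha> > 0" "\<beta> > 0" "\<gamma> > 0"
      using that or_pos[of a b] or_pos[of b c] or_pos[of a c] by (auto simp: d)
    have "orient a b c = \<alpha> + \<beta> - \<gamma>" by (simp add: d orient_def algebra_simps)
    with neg have le: "\<alpha> + \<beta> \<le> \<gamma>" by simp
    have "\<gamma> *\<^sub>R b = (\<gamma> - \<alpha> - \<beta>) *\<^sub>R p + \<beta> *\<^sub>R a + \<alpha> *\<^sub>R c"
      by (simp add: prod_eq_iff d orient_def algebra_simps)
    then have "inverse \<gamma> *\<^sub>R (\<gamma> *\<^sub>R b) = inverse \<gamma> *\<^sub>R ((\<gamma> - \<alpha> - \<beta>) *\<^sub>R p + \<beta> *\<^sub>R a + \<alpha> *\<^sub>R c)" by simp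
    then have "b = ((\<gamma> - \<alpha> - \<beta>) / \<gamma>) *\<^sub>R p + (\<beta> / \<gamma>) *\<^sub>R a + (\<alpha> / \<gamma>) *\<^sub>R c"
      using pos by (simp add: scaleR_add_right divide_inverse_commute)
    moreover have "(\<gamma> - \<alpha> - \<beta>) / \<gamma> + \<beta> / \<gamma> + \<alpha> / \<gamma> = 1"
      using pos by (simp add: field_simps)
    moreover have "(\<gamma> - \<alpha> - \<beta>) / \<gamma> \<ge> 0" "\<beta> / \<gamma> \<ge> 0" "\<alpha> / \<gamma> \<ge> 0"
      using pos le by simp_all
    ultimately have "b \<in> convex hull {p, a, c}"
      unfolding convex_hull_3 by blast
    then show False
      using convex_position_notin_hull[OF cp, of b "{p, a, c}"] that p by (auto simp: S'_def)
  qed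
  have "ccw_order (p # qs)"
    unfolding ccw_order_def
  proof (intro allI impI)
    fix i j k assume ijk: "i < j" "j < k" "k < length (p # qs)"
    obtain j' k' where jk: "j = Suc j'" "k = Suc k'" using ijk by (cases j; cases k) auto
    have mem: "qs ! j' \<in> S'" "qs ! k' \<in> S'" using ijk jk qs(1) by auto
    have l: "key (qs ! j') < key (qs ! k')" using key_less ijk jk by simp
    show "orient ((p # qs) ! i) ((p # qs) ! j) ((p # qs) ! k) > 0"
    proof (cases i)
      case 0
      then show ?thesis using or_pos[OF mem] l jk by simp
    next
      case (Suc i')
      then have "qs ! i' \<in> S'" "key (qs ! i') < key (qs ! j')"
        using ijk jk qs(1) key_less by auto
      then show ?thesis using tri mem l jk Suc by simp
    qed
  qed
  then show ?thesis
    using qs p by (intro exI[of _ "p # qs"]) (auto simp: S'_def)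
qed


section \<open>A real RAM\<close>

text \<open>
  Programs of a real RAM, written as structured programs. The machine has finitely many word
  registers per program, a memory of words and a memory of reals, both addressed by words.
  There is no conversion from reals to words (in particular no floor function); real numbers
  influence the control flow through comparisons only.
\<close>

record mstate =
  regs :: "nat \<Rightarrow> nat"
  wmem :: "nat \<Rightarrow> nat"
  rmem :: "nat \<Rightarrow> real"

datatype wexp =
    WConst nat | Reg nat | WLoad wexp
  | WAdd wexp wexp | WSub wexp wexp | WMul wexp wexp | WDiv wexp wexp | WMod wexp wexp

datatype rexp =
    RConst int | RLoad wexp
  | RAdd rexp rexp | RSub rexp rexp | RMul rexp rexp | RDiv rexp rexp

datatype bexp = WLess wexp wexp | WEq wexp wexp | RLess rexp rexp | BNot bexp | BAnd bexp bexp

datatype com =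
    Skip
  | Assign nat wexp
  | WStore wexp wexp
  | RStore wexp rexp
  | Seq com com
  | Cond bexp com com
  | While bexp com

primrec wval :: "wexp \<Rightarrow> mstate \<Rightarrow> nat" where
  "wval (WConst k) s = k"
| "wval (Reg x) s = regs s x"
| "wval (WLoad a) s = wmem s (wval a s)"
| "wval (WAdd a b) s = wval a s + wval b s"
| "wval (WSub a b) s = wval a s - wval b s"
| "wval (WMul a b) s = wval a s * wval b s"
| "wval (WDiv a b) s = wval a s div wval b s"
| "wval (WMod a b) s = wval a s mod wval b s"

primrec rval :: "rexp \<Rightarrow> mstate \<Rightarrow> real" where
  "rval (RConst k) s = of_int k"
| "rval (RLoad a) s = rmem s (wval a s)"
| "rval (RAdd a b) s = rval a s + rval b s"
| "rval (RSub a b) s = rval a s - rval b s"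
| "rval (RMul a b) s = rval a s * rval b s"
| "rval (RDiv a b) s = rval a s / rval b s"

primrec bval :: "bexp \<Rightarrow> mstate \<Rightarrow> bool" where
  "bval (WLess a b) s \<longleftrightarrow> wval a s < wval b s"
| "bval (WEq a b) s \<longleftrightarrow> wval a s = wval b s"
| "bval (RLess a b) s \<longleftrightarrow> rval a s < rval b s"
| "bval (BNot b) s \<longleftrightarrow> \<not> bval b s"
| "bval (BAnd b c) s \<longleftrightarrow> bval b s \<and> bval c s"

text \<open>
  \<open>exec M W c s t s'\<close>: started in \<open>s\<close>, the program \<open>c\<close> terminates in \<open>s'\<close> after \<open>t\<close> steps, writes
  only to memory addresses below \<open>M\<close>, and writes only words below \<open>W\<close>. A violation of either limit
  leaves the machine stuck.

  Each elementary command and each test costs one step. Since the expressions occurring in a fixed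
  program have bounded size, this differs from charging every arithmetic operation and memory
  access by a constant factor only. Cells that are never written hold the input or zero, so a run
  occupies at most \<open>2 * M\<close> cells in addition to the input and the registers mentioned in \<open>c\<close>.
\<close>

inductive exec :: "nat \<Rightarrow> nat \<Rightarrow> com \<Rightarrow> mstate \<Rightarrow> nat \<Rightarrow> mstate \<Rightarrow> bool" for M W :: nat where
  Skip: "exec M W Skip s 1 s"
| Assign: "wval e s < W \<Longrightarrow>
    exec M W (Assign x e) s 1 (s\<lparr>regs := (regs s)(x := wval e s)\<rparr>)"
| WStore: "wval a s < M \<Longrightarrow> wval e s < W \<Longrightarrow>
    exec M W (WStore a e) s 1 (s\<lparr>wmem := (wmem s)(wval a s := wval e s)\<rparr>)"
| RStore: "wval a s < M \<Longrightarrow>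
    exec M W (RStore a e) s 1 (s\<lparr>rmem := (rmem s)(wval a s := rval e s)\<rparr>)"
| Seq: "exec M W c1 s t1 s1 \<Longrightarrow> exec M W c2 s1 t2 s2 \<Longrightarrow>
    exec M W (Seq c1 c2) s (t1 + t2) s2"
| CondTrue: "bval b s \<Longrightarrow> exec M W c1 s t s' \<Longrightarrow> exec M W (Cond b c1 c2) s (Suc t) s'"
| CondFalse: "\<not> bval b s \<Longrightarrow> exec M W c2 s t s' \<Longrightarrow> exec M W (Cond b c1 c2) s (Suc t) s'"
| WhileFalse: "\<not> bval b s \<Longrightarrow> exec M W (While b c) s 1 s"
| WhileTrue: "bval b s \<Longrightarrow> exec M W c s t1 s1 \<Longrightarrow> exec M W (While b c) s1 t2 s2 \<Longrightarrow>
    exec M W (While b c) s (Suc (t1 + t2)) s2"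

definition halts_within ::
    "nat \<Rightarrow> nat \<Rightarrow> nat \<Rightarrow> com \<Rightarrow> mstate \<Rightarrow> (mstate \<Rightarrow> bool) \<Rightarrow> bool" where
  "halts_within T M W c s Q \<longleftrightarrow> (\<exists>t s'. exec M W c s t s' \<and> t \<le> T \<and> Q s')"

text \<open>Words of \<open>O(log n)\<close> bits, that is, of polynomially bounded value.\<close>

definition logarithmic_words :: "(nat \<Rightarrow> nat) \<Rightarrow> bool" where
  "logarithmic_words W \<longleftrightarrow> (\<exists>k. (\<lambda>n. real (W n)) \<in> O(\<lambda>n. real n ^ k))"


section \<open>Input and output conventions\<close>

text \<open>
  Register 0 holds the number of points, word cell \<open>i\<close> the colour of the \<open>i\<close>-th point (0 for red,
  1 for blue), and the real cells \<open>2 * i\<close> and \<open>2 * i + 1\<close> its coordinates.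
\<close>

definition input :: "point set \<Rightarrow> point list \<Rightarrow> mstate" where
  "input B ps =
     \<lparr>regs = (\<lambda>_. 0)(0 := length ps),
      wmem = (\<lambda>i. if i < length ps \<and> ps ! i \<in> B then 1 else 0),
      rmem = (\<lambda>i. if i < 2 * length ps
                   then if even i then fst (ps ! (i div 2)) else snd (ps ! (i div 2))
                   else 0)\<rparr>"

text \<open>
  A family of stars is output as a table of input indices in the word memory: register 0 holds the
  number of stars, register 1 the base address, and each star takes four consecutive cells, its
  center first.
\<close>

definition output_cell :: "point list \<Rightarrow> mstate \<Rightarrow> nat \<Rightarrow> nat \<Rightarrow> point" where
  "output_cell ps s j i = ps ! wmem s (regs s 1 + 4 * j + i)"

definition outputs_covering ::
    "point set \<Rightarrow> point set \<Rightarrow> point list \<Rightarrow> mstate \<Rightarrow> point set set \<Rightarrow> bool" where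
  "outputs_covering R B ps s P \<longleftrightarrow>
     (\<forall>j < regs s 0. \<forall>i < 4. wmem s (regs s 1 + 4 * j + i) < length ps) \<and>
     bij_betw (\<lambda>j. output_cell ps s j ` {..<4}) {..<regs s 0} P \<and>
     (\<forall>j < regs s 0. is_center R B (output_cell ps s j ` {..<4}) (output_cell ps s j 0))"

end

theory Submission
  imports Defs
begin

text \<open>
  For points in convex position, a family of stars is non-crossing iff its vertex sets, as sets of
  indices along the hull, form a non-crossing partition; which vertex is the center is irrelevant.

  Decision: rank the points by angle around the first one and decide for every interval \<open>{i..<j}\<close>
  whether it is a union of pairwise non-crossing stars. The star of \<open>i\<close> consists of \<open>i < a < b < c\<close>,
  and the four gaps have to be coverable themselves. All choices of \<open>i, j, a, b, c\<close> are enumerated by a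
  single counter of five digits in base \<open>n + 1\<close>.

  Approximation: push the points on a stack and pop the four topmost ones whenever they form a star of
  a type (red or blue majority) that is still needed. On an irreducible stack the number of blue points in
  a window of four consecutive points changes by at most one from one window to the next, skips 1 and 3,
  and averages a value between 1 and 3. So the stack ends empty, or every window is balanced and
  the stack has period 4. In the latter case one point is dropped and the rest is covered up to three
  points by nested stars taken from both ends.
\<close>

section \<open>Program logic for the real RAM\<close>

text \<open>Once crossings of segments are turned into alternations of indices, a star is any four
  indices with an odd number of blue points: one of the four is alone in its colour and serves as
  center. The programs thus work on 0/1 words, and a center is located only when a star is written
  out. A window of content 1 or 3 stays on the stack only if the counter of its type has run out,
  and the counters always fit the points that remain. This turns a failed reduction into an exact
  statement about averages. The obstacle is a residue with two blue points in every window, where no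
  four consecutive points form a star. Stars that use both ends evade it: two of their vertices fall
  into the same class modulo 4, so the parity is decided by the other two, which lie in adjacent
  classes of different colours. Dropping one point fixes the phase; it and the three points left in
  the middle are the loss of four.\<close>

lemma halts_within_mono:
  assumes "halts_within T M W c s Q" "T \<le> T'" "\<And>s'. Q s' \<Longrightarrow> Q' s'"
  shows "halts_within T' M W c s Q'"
  using assms unfolding halts_within_def by (meson order_trans)

lemma halts_within_Seq:
  assumes "halts_within T1 M W c1 s Q1" "\<And>s1. Q1 s1 \<Longrightarrow> halts_within T2 M W c2 s1 Q"
  shows "halts_within (T1 + T2) M W (Seq c1 c2) s Q"
  using assms unfolding halts_within_def by (meson add_mono exec.Seq)

text \<open>Meant for loop-free code: a loop has no weakest precondition here and is treated by
  \<open>halts_within_While\<close> instead.\<close>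

primrec wp :: "nat \<Rightarrow> nat \<Rightarrow> com \<Rightarrow> (mstate \<Rightarrow> bool) \<Rightarrow> mstate \<Rightarrow> bool" where
  "wp M W Skip Q s \<longleftrightarrow> Q s"
| "wp M W (Assign x e) Q s \<longleftrightarrow> wval e s < W \<and> Q (s\<lparr>regs := (regs s)(x := wval e s)\<rparr>)"
| "wp M W (WStore a e) Q s \<longleftrightarrow>
     wval a s < M \<and> wval e s < W \<and> Q (s\<lparr>wmem := (wmem s)(wval a s := wval e s)\<rparr>)"
| "wp M W (RStore a e) Q s \<longleftrightarrow> wval a s < M \<and> Q (s\<lparr>rmem := (rmem s)(wval a s := rval e s)\<rparr>)"
| "wp M W (Seq c1 c2) Q s \<longleftrightarrow> wp M W c1 (wp M W c2 Q) s"
| "wp M W (Cond b c1 c2) Q s \<longleftrightarrow> (if bval b s then wp M W c1 Q s else wp M W c2 Q s)"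
| "wp M W (While b c) Q s \<longleftrightarrow> False"

text \<open>Both branches of a conditional are charged, which bounds the time without tracking the
  branch taken. The value for loops is immaterial because \<open>wp\<close> rejects them.\<close>

primrec cost :: "com \<Rightarrow> nat" where
  "cost Skip = 1"
| "cost (Assign x e) = 1"
| "cost (WStore a e) = 1"
| "cost (RStore a e) = 1"
| "cost (Seq c1 c2) = cost c1 + cost c2"
| "cost (Cond b c1 c2) = Suc (cost c1 + cost c2)"
| "cost (While b c) = 0"

lemma wp_sound: "wp M W c Q s \<Longrightarrow> halts_within (cost c) M W c s Q"
proof (induction c arbitrary: s Q)
  case (Seq c1 c2)
  have "halts_within (cost c1) M W c1 s (wp M W c2 Q)"
    using Seq.prems by (intro Seq.IH) simp
  then show ?case
    unfolding cost.simps by (rule halts_within_Seq) (rule Seq.IH)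
next
  case (Cond b c1 c2)
  show ?case
  proof (cases "bval b s")
    case True
    then have "halts_within (cost c1) M W c1 s Q" using Cond by simp
    then show ?thesis using True
      by (fastforce simp: halts_within_def intro: exec.CondTrue)
  next
    case False
    then have "halts_within (cost c2) M W c2 s Q" using Cond by simp
    then show ?thesis using False
      by (fastforce simp: halts_within_def intro: exec.CondFalse)
  qed
next
  case Skip
  then show ?case unfolding halts_within_def wp.simps cost.simps
    using exec.Skip by blast
next
  case (Assign x e)
  then show ?case unfolding halts_within_def wp.simps cost.simps
    using exec.Assign by blast
next
  case (WStore a e)
  then show ?case unfolding halts_within_def wp.simps cost.simps
    using exec.WStore by blast
next
  case (RStore a e)
  then show ?case unfolding halts_within_def wp.simps cost.simps
    using exec.RStore by blast
qed simp_all

lemma halts_within_wp: "wp M W c Q s \<Longrightarrow> cost c \<le> T \<Longrightarrow> halts_within T M W c s Q"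
  using wp_sound halts_within_mono by blast

text \<open>The invariant is indexed by the number of completed rounds, and the total
  \<open>m\<close> is known in advance, so termination and the time bound come together. The
  additional steps pay for the \<open>m + 1\<close> tests.\<close>

lemma halts_within_While:
  assumes step: "\<And>k s. I k s \<Longrightarrow> k < m \<Longrightarrow> bval b s \<and> halts_within T M W c s (I (Suc k))"
    and final: "\<And>s. I m s \<Longrightarrow> \<not> bval b s"
    and init: "I 0 s"
  shows "halts_within (Suc (m * Suc T)) M W (While b c) s (I m)"
proof -
  have "halts_within (Suc ((m - k) * Suc T)) M W (While b c) s (I m)" if "k \<le> m" "I k s" for k s
    using that
  proof (induction k arbitrary: s rule: inc_induct)
    case base
    then show ?case using final exec.WhileFalse unfolding halts_within_def by fastforce
  next
    case (step k)
    from assms(1)[OF step.prems step.hyps(2)] obtain t s1 where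
      b: "bval b s" and e: "exec M W c s t s1" "t \<le> T" "I (Suc k) s1"
      unfolding halts_within_def by blast
    from step.IH[OF e(3)] obtain t2 s2 where
      e2: "exec M W (While b c) s1 t2 s2" "t2 \<le> Suc ((m - Suc k) * Suc T)" "I m s2"
      unfolding halts_within_def by blast
    have "Suc (t + t2) \<le> Suc ((m - k) * Suc T)"
      using e(2) e2(2) step.hyps(2) by (simp add: Suc_diff_Suc[symmetric] del: mult_Suc_right)
    then show ?case
      using exec.WhileTrue[OF b e(1) e2(1)] e2(3) unfolding halts_within_def by blast
  qed
  from this[of 0 s] init show ?thesis by simp
qed

text \<open>From n = 1 on, n + 1 is at most 2 n; hence the factor \<open>2 ^ k\<close>.\<close>

lemma poly_bigo: "(\<lambda>n. real (a * (n + 1) ^ k)) \<in> O(\<lambda>n. real n ^ k)"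
proof (rule bigoI[where c = "real a * 2 ^ k"])
  show "\<forall>\<^sub>F n in sequentially. norm (real (a * (n + 1) ^ k)) \<le> real a * 2 ^ k * norm (real n ^ k)"
    using eventually_ge_at_top[of 1]
  proof eventually_elim
    case (elim n)
    have "(real n + 1) ^ k \<le> (2 * real n) ^ k" using elim by (intro power_mono) auto
    then have "real a * (real n + 1) ^ k \<le> real a * (2 * real n) ^ k" by (intro mult_left_mono) auto
    then show ?case by (simp add: power_mult_distrib ac_simps)
  qed
qed

section \<open>Stars on points in convex position\<close>

text \<open>No alternation around the circle. Cut open before index 0, an alternation shows up as
  one of the two linear patterns XYXY and YXYX.\<close>

definition crossfree :: "nat set \<Rightarrow> nat set \<Rightarrow> bool" where
  "crossfree X Y \<longleftrightarrow> (\<forall>a\<in>X. \<forall>c\<in>X. \<forall>b\<in>Y. \<forall>d\<in>Y.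
     \<not> (a < b \<and> b < c \<and> c < d) \<and> \<not> (b < a \<and> a < d \<and> d < c))"

lemma crossfree_sym: "crossfree X Y \<Longrightarrow> crossfree Y X"
  unfolding crossfree_def by blast

lemma crossfree_mono: "crossfree X Y \<Longrightarrow> X' \<subseteq> X \<Longrightarrow> Y' \<subseteq> Y \<Longrightarrow> crossfree X' Y'"
  unfolding crossfree_def by blast

text \<open>Either alternating pattern puts a point of X strictly between two points of Y.\<close>

lemma crossfree_arcI:
  assumes "\<And>x. x \<in> X \<Longrightarrow> (\<forall>y\<in>Y. x < y) \<or> (\<forall>y\<in>Y. y < x)"
  shows "crossfree X Y"
  unfolding crossfree_def using assms by (meson order.asym)

text \<open>For colours 0 and 1 the sum over four points is odd iff one point differs in colour from
  the other three. Parity thus expresses the star condition without naming the center or its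
  colour.\<close>

definition good :: "(nat \<Rightarrow> nat) \<Rightarrow> nat set \<Rightarrow> bool" where
  "good col Q \<longleftrightarrow> card Q = 4 \<and> odd (sum col Q)"

section \<open>Orientation and intersection of segments\<close>

lemma orient_cycle: "orient b c a = orient a b c"
  by (simp add: orient_def algebra_simps)

lemma orient_swap: "orient a c b = - orient a b c"
  by (simp add: orient_def algebra_simps)

lemma orient_affine:
  "orient a b ((1 - t) *\<^sub>R x + t *\<^sub>R y) = (1 - t) * orient a b x + t * orient a b y"
  by (simp add: orient_def algebra_simps)

lemma orient_segment_zero: "z \<in> closed_segment a b \<Longrightarrow> orient a b z = 0"
  by (auto simp: in_segment orient_affine) (simp add: orient_def)

text \<open>\<open>orient a b\<close> is affine in its last argument: it vanishes on the first
  segment and keeps a nonzero sign on the second.\<close>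

lemma segments_disjoint_same_side:
  assumes "orient a b c * orient a b d > 0"
  shows "closed_segment a b \<inter> closed_segment c d = {}"
proof (rule ccontr)
  assume "\<not> ?thesis"
  then obtain z where z: "z \<in> closed_segment a b" "z \<in> closed_segment c d" by blast
  then obtain t where t: "0 \<le> t" "t \<le> 1" "z = (1 - t) *\<^sub>R c + t *\<^sub>R d"
    by (auto simp: in_segment)
  have zero: "(1 - t) * orient a b c + t * orient a b d = 0"
    using orient_segment_zero[OF z(1)] by (simp add: t orient_affine)
  \<comment> \<open>Multiplication by \<open>orient a b c\<close> makes both summands nonnegative,
    whichever side c and d are on.\<close>
  have "((1 - t) * orient a b c + t * orient a b d) * orient a b c
      = (1 - t) * (orient a b c)\<^sup>2 + t * (orient a b c * orient a b d)"
    by (simp add: algebra_simps power2_eq_square)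
  moreover have "orient a b c \<noteq> 0" using assms by auto
  then have "(orient a b c)\<^sup>2 > 0" by simp
  then have "(1 - t) * (orient a b c)\<^sup>2 + t * (orient a b c * orient a b d) > 0"
    using t assms by (cases "t = 0") (auto intro: add_nonneg_pos)
  ultimately show False using zero by simp
qed

lemma segments_common_endpoint:
  assumes "orient c x y \<noteq> 0"
  shows "closed_segment c x \<inter> closed_segment c y \<subseteq> {c}"
proof
  fix z assume z: "z \<in> closed_segment c x \<inter> closed_segment c y"
  then obtain t where t: "z = (1 - t) *\<^sub>R c + t *\<^sub>R y" by (auto simp: in_segment)
  have "orient c x c = 0" by (simp add: orient_def)
  moreover have "orient c x z = 0" using z orient_segment_zero by blast
  ultimately have "t * orient c x y = 0" unfolding t orient_affine by simp
  then show "z \<in> {c}" using assms t by simp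
qed

text \<open>Four points of the plane satisfy an affine dependence whose coefficients are signed
  triangle areas. For a convex quadrilateral the signs alternate, and normalising the two sides of
  \<open>eq\<close> yields the intersection point of the diagonals.\<close>

lemma segments_intersect:
  assumes "orient a b c > 0" "orient a b d > 0" "orient a c d > 0" "orient b c d > 0"
  shows "closed_segment a c \<inter> closed_segment b d \<noteq> {}"
proof -
  define \<alpha> \<beta> \<gamma> \<delta> where "\<alpha> = orient b c d" "\<beta> = orient a c d" "\<gamma> = orient a b d" "\<delta> = orient a b c"
  note d = this
  have pos: "\<alpha> > 0" "\<beta> > 0" "\<gamma> > 0" "\<delta> > 0" using assms by (simp_all add: d)
  have sum: "\<alpha> + \<gamma> = \<beta> + \<delta>" by (simp add: d orient_def algebra_simps)
  have eq: "\<alpha> *\<^sub>R a + \<gamma> *\<^sub>R c = \<beta> *\<^sub>R b + \<delta> *\<^sub>R d"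
    by (simp add: prod_eq_iff d orient_def algebra_simps)
  define z where "z = inverse (\<alpha> + \<gamma>) *\<^sub>R (\<alpha> *\<^sub>R a + \<gamma> *\<^sub>R c)"
  have w: "1 - y / (x + y) = x / (x + y)" if "x > 0" "y > 0" for x y :: real
    using that by (simp add: field_simps)
  have z1: "z = (1 - \<gamma> / (\<alpha> + \<gamma>)) *\<^sub>R a + (\<gamma> / (\<alpha> + \<gamma>)) *\<^sub>R c"
    using pos w[of \<alpha> \<gamma>] by (simp add: z_def scaleR_add_right divide_inverse_commute)
  have z2: "z = (1 - \<delta> / (\<beta> + \<delta>)) *\<^sub>R b + (\<delta> / (\<beta> + \<delta>)) *\<^sub>R d"
    unfolding z_def eq sum using pos w[of \<beta> \<delta>]
    by (simp add: scaleR_add_right divide_inverse_commute)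
  have "z \<in> closed_segment a c" unfolding in_segment
    using pos by (intro exI[of _ "\<gamma> / (\<alpha> + \<gamma>)"]) (use z1 in auto)
  moreover have "z \<in> closed_segment b d" unfolding in_segment
    using pos by (intro exI[of _ "\<delta> / (\<beta> + \<delta>)"]) (use z2 in auto)
  ultimately show ?thesis by blast
qed

text \<open>Two different centers would have opposite colours, and a third point of Q would need
  both colours.\<close>

lemma is_center_unique:
  assumes "R \<inter> B = {}" "is_center R B Q c" "is_center R B Q c'"
  shows "c = c'"
proof (rule ccontr)
  assume ne: "c \<noteq> c'"
  have card: "card Q = 4" and "c \<in> Q" "c' \<in> Q" using assms by (auto simp: is_center_def)
  then have "finite Q" by (metis card.infinite zero_neq_numeral)
  then have "card (Q - {c, c'}) = 2" using card ne \<open>c \<in> Q\<close> \<open>c' \<in> Q\<close> by (simp add: card_Diff_subset)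
  then obtain y where "y \<in> Q - {c, c'}" by (metis card.empty equals0I zero_neq_numeral)
  then show False using assms ne \<open>c \<in> Q\<close> \<open>c' \<in> Q\<close> unfolding is_center_def by blast
qed

section \<open>Chords of a convex polygon in hull order\<close>

locale convex_polygon =
  fixes R B :: "point set" and qs :: "point list"
  assumes disj: "R \<inter> B = {}" and dist: "distinct qs" and set_qs: "set qs = R \<union> B"
    and ccw: "ccw_order qs"
begin

definition col :: "nat \<Rightarrow> nat" where
  "col i = (if i < length qs \<and> qs ! i \<in> B then 1 else 0)"

lemma orient_pos: "i < j \<Longrightarrow> j < k \<Longrightarrow> k < length qs \<Longrightarrow> orient (qs ! i) (qs ! j) (qs ! k) > 0"
  using ccw unfolding ccw_order_def by blast

lemma orient_nonzero:
  assumes "i < length qs" "j < length qs" "k < length qs" "i \<noteq> j" "j \<noteq> k" "i \<noteq> k"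
  shows "orient (qs ! i) (qs ! j) (qs ! k) \<noteq> 0"
proof -
  consider "i < j" "j < k" | "i < k" "k < j" | "j < i" "i < k" | "j < k" "k < i"
    | "k < i" "i < j" | "k < j" "j < i"
    using assms by linarith
  then show ?thesis
    using assms orient_pos[of i j k] orient_pos[of i k j] orient_pos[of j i k] orient_pos[of j k i]
      orient_pos[of k i j] orient_pos[of k j i]
    by cases (auto simp: orient_def algebra_simps)
qed

lemma inj_nth: "inj_on ((!) qs) {..<length qs}"
  using dist by (simp add: inj_on_nth)

lemma nth_mem_B_iff: "i < length qs \<Longrightarrow> qs ! i \<in> B \<longleftrightarrow> col i = 1"
  by (simp add: col_def)

lemma nth_mem_R_iff: "i < length qs \<Longrightarrow> qs ! i \<in> R \<longleftrightarrow> col i = 0"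
  using disj set_qs nth_mem[of i qs] by (auto simp: col_def)

text \<open>With both pairs sorted, the second one lies after, around, before or inside the first.
  In each case its endpoints are on the same side of the first chord.\<close>

lemma chords_disjoint:
  assumes "a < length qs" "b < length qs" "c < length qs" "d < length qs"
    "a \<noteq> b" "c \<noteq> d" "{a, b} \<inter> {c, d} = {}" "crossfree {a, b} {c, d}"
  shows "closed_segment (qs ! a) (qs ! b) \<inter> closed_segment (qs ! c) (qs ! d) = {}"
proof -
  have *: "closed_segment (qs ! a) (qs ! b) \<inter> closed_segment (qs ! c) (qs ! d) = {}"
    if H: "a < b" "c < d" "a < length qs" "b < length qs" "c < length qs" "d < length qs"
      "{a, b} \<inter> {c, d} = {}" "crossfree {a, b} {c, d}" for a b c d
  proof -
    consider "b < c" | "c < a" "b < d" | "d < a" | "a < c" "d < b"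
      using H(1,2,7,8) unfolding crossfree_def by simp (metis linorder_neqE_nat order_less_trans)
    then have "orient (qs ! a) (qs ! b) (qs ! c) * orient (qs ! a) (qs ! b) (qs ! d) > 0"
    proof cases
      case 1
      then show ?thesis using that by (intro mult_pos_pos orient_pos) auto
    next
      case 2
      then show ?thesis using that orient_pos[of c a b] orient_pos[of a b d]
        by (simp add: orient_cycle)
    next
      case 3
      then show ?thesis using that orient_pos[of c a b] orient_pos[of d a b]
        by (simp add: orient_cycle)
    next
      case 4
      then show ?thesis using that orient_pos[of a c b] orient_pos[of a d b]
          orient_swap[of "qs ! a" "qs ! b" "qs ! c"] orient_swap[of "qs ! a" "qs ! b" "qs ! d"]
        by (simp add: mult_neg_neg)
    qed
    then show ?thesis by (rule segments_disjoint_same_side)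
  qed
  have sw: "{b, a} = {a, b}" "{d, c} = {c, d}" by auto
  show ?thesis
    using assms *[of a b c d] *[of b a c d] *[of a b d c] *[of b a d c]
    by (cases "a < b"; cases "c < d") (auto simp: sw closed_segment_commute)
qed

lemma chords_cross:
  assumes "a < b" "b < c" "c < d" "d < length qs"
  shows "closed_segment (qs ! a) (qs ! c) \<inter> closed_segment (qs ! b) (qs ! d) \<noteq> {}"
  using assms by (intro segments_intersect orient_pos) auto

lemma is_center_imp_good:
  assumes "X \<subseteq> {..<length qs}" "is_center R B ((!) qs ` X) p"
  shows "good col X"
proof -
  have inj: "inj_on ((!) qs) X" using inj_nth assms(1) inj_on_subset by blast
  have card: "card X = 4" using assms(2) card_image[OF inj] by (simp add: is_center_def)
  then have fin: "finite X" by (metis card.infinite zero_neq_numeral)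
  obtain c where c: "c \<in> X" "p = qs ! c" using assms(2) by (auto simp: is_center_def)
  have rest: "card (X - {c}) = 3" using c(1) card fin by simp
  have ne: "qs ! x \<noteq> p" if "x \<in> X - {c}" for x
    using that c inj by (auto dest: inj_onD)
  have eq: "sum col X = col c + sum col (X - {c})" using c(1) fin by (simp add: sum.remove)
  have "(col c = 0 \<and> (\<forall>x\<in>X - {c}. col x = 1)) \<or> (col c = 1 \<and> (\<forall>x\<in>X - {c}. col x = 0))"
  proof (cases "p \<in> R")
    case True
    then have "\<forall>x\<in>X - {c}. qs ! x \<in> B"
      using assms(2) ne disj by (auto simp: is_center_def)
    then show ?thesis using True c assms(1) nth_mem_B_iff nth_mem_R_iff by blast
  next
    case False
    then have "p \<in> B" "\<forall>x\<in>X - {c}. qs ! x \<in> R"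
      using assms(2) ne by (auto simp: is_center_def)
    then show ?thesis using c assms(1) nth_mem_B_iff nth_mem_R_iff by blast
  qed
  then have "sum col X = 3 \<or> sum col X = 1"
    using eq rest by (auto simp: sum.cong[of "X - {c}" "X - {c}" col "\<lambda>_. 1"])
  then show ?thesis using card by (auto simp: good_def)
qed

lemma is_center_image:
  assumes X: "X \<subseteq> {..<length qs}" "card X = 4" "c \<in> X" "\<And>x. x \<in> X - {c} \<Longrightarrow> col x \<noteq> col c"
  shows "is_center R B ((!) qs ` X) (qs ! c)"
proof -
  have inj: "inj_on ((!) qs) X" using inj_nth X(1) inj_on_subset by blast
  have img: "(!) qs ` X - {qs ! c} = (!) qs ` (X - {c})"
    using inj X(3) by (auto dest: inj_onD)
  have cc: "col x = 0 \<or> col x = 1" for x by (simp add: col_def)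
  have "qs ! c \<in> R \<and> (!) qs ` (X - {c}) \<subseteq> B \<or> qs ! c \<in> B \<and> (!) qs ` (X - {c}) \<subseteq> R"
  proof (cases "col c = 0")
    case True
    then have "col x = 1" if "x \<in> X - {c}" for x using X(4)[OF that] cc[of x] by simp
    then show ?thesis using True X nth_mem_B_iff nth_mem_R_iff by blast
  next
    case False
    then have "col x = 0" if "x \<in> X - {c}" for x using X(4)[OF that] cc[of x] cc[of c] by simp
    moreover have "col c = 1" using False cc[of c] by simp
    ultimately show ?thesis using X(1,3) nth_mem_B_iff nth_mem_R_iff by blast
  qed
  then show ?thesis using X card_image[OF inj] by (auto simp: is_center_def img)
qed

lemma good_has_center:
  assumes "good col X"
  obtains c where "c \<in> X" "\<And>x. x \<in> X - {c} \<Longrightarrow> col x \<noteq> col c"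
proof -
  have card: "card X = 4" and odd: "odd (sum col X)" using assms by (auto simp: good_def)
  then have fin: "finite X" by (metis card.infinite zero_neq_numeral)
  define Y where "Y = {x\<in>X. col x = 1}"
  have Y: "Y \<subseteq> X" "finite Y" using fin by (auto simp: Y_def)
  have cc: "col x = 0 \<or> col x = 1" for x by (simp add: col_def)
  have "sum col X = sum col Y"
  proof (rule sum.mono_neutral_right)
    show "\<forall>i\<in>X - Y. col i = 0" using cc unfolding Y_def by blast
  qed (use fin Y in auto)
  also have "\<dots> = card Y" by (simp add: Y_def)
  finally have "odd (card Y)" using odd by simp
  moreover have "card Y \<le> 4" using card_mono[OF fin Y(1)] card by simp
  ultimately have "card Y = 1 \<or> card Y = 3" by (auto elim!: oddE)
  then show ?thesis
  proof
    assume "card Y = 1"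
    then obtain c where c: "Y = {c}" by (meson card_1_singletonE)
    then have "c \<in> X" "col c = 1" by (auto simp: Y_def)
    moreover have "col x \<noteq> 1" if "x \<in> X - {c}" for x using that c by (auto simp: Y_def)
    ultimately show ?thesis by (intro that) auto
  next
    assume "card Y = 3"
    then have "card (X - Y) = 1" using card Y by (simp add: card_Diff_subset)
    then obtain c where c: "X - Y = {c}" by (meson card_1_singletonE)
    then have "c \<in> X" "col c = 0" using cc[of c] by (auto simp: Y_def)
    moreover have "col x = 1" if "x \<in> X - {c}" for x using that c by (auto simp: Y_def)
    ultimately show ?thesis by (intro that) auto
  qed
qed

text \<open>Edges of one star meet only in the center because no three points are collinear; edges
  of different stars are disjoint chords.\<close>

lemma K13_covering_image:
  assumes sub: "\<And>X. X \<in> F \<Longrightarrow> X \<subseteq> {..<length qs} \<and> good col X"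
    and disjF: "pairwise disjnt F" and cf: "pairwise crossfree F"
  shows "K13_covering R B ((!) qs ` \<Union>F) ((`) ((!) qs) ` F)"
proof -
  let ?f = "(`) ((!) qs)"
  have ne: "X \<noteq> {}" if "X \<in> F" for X using sub[OF that] by (auto simp: good_def)
  have disj_img: "?f X \<inter> ?f Y = {}" if "X \<in> F" "Y \<in> F" "X \<noteq> Y" for X Y
    using that sub[OF that(1)] sub[OF that(2)] disjF inj_on_image_Int[OF inj_nth, of X Y]
    by (auto simp: pairwise_def disjnt_def)
  have center: "\<exists>c\<in>X. is_center R B (?f X) (qs ! c) \<and> (\<forall>p. is_center R B (?f X) p \<longrightarrow> p = qs ! c)"
    if X: "X \<in> F" for X
  proof -
    obtain c where "c \<in> X" "\<And>x. x \<in> X - {c} \<Longrightarrow> col x \<noteq> col c"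
      using good_has_center sub[OF X] by blast
    then have "c \<in> X" "is_center R B (?f X) (qs ! c)"
      using is_center_image sub[OF X] by (auto simp: good_def)
    then show ?thesis using is_center_unique[OF disj] by blast
  qed
  have part: "partition_on ((!) qs ` \<Union>F) (?f ` F)"
  proof (rule partition_onI)
    fix p q assume "p \<in> ?f ` F" "q \<in> ?f ` F" "p \<noteq> q"
    then show "disjnt p q" using disj_img by (auto simp: disjnt_def)
  qed (use ne in auto)
  have cross: "noncrossing (p, x) (q, y)"
    if px: "(p, x) \<in> star_edges R B (?f ` F)" and qy: "(q, y) \<in> star_edges R B (?f ` F)"
      and neq: "(p, x) \<noteq> (q, y)" for p x q y
  proof -
    have *: "\<exists>X\<in>F. \<exists>c\<in>X. \<exists>u\<in>X. p = qs ! c \<and> x = qs ! u \<and> u \<noteq> c \<and> (\<forall>r. is_center R B (?f X) r \<longrightarrow> r = p)"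
      if "(p, x) \<in> star_edges R B (?f ` F)" for p x
      using that center unfolding star_edges_def by blast
    from *[OF px] obtain X c u where X: "X \<in> F" "c \<in> X" "u \<in> X" "p = qs ! c" "x = qs ! u" "u \<noteq> c"
      "\<And>r. is_center R B (?f X) r \<Longrightarrow> r = p" by blast
    from *[OF qy] obtain Y d v where Y: "Y \<in> F" "d \<in> Y" "v \<in> Y" "q = qs ! d" "y = qs ! v" "v \<noteq> d"
      "\<And>r. is_center R B (?f Y) r \<Longrightarrow> r = q" by blast
    have lt: "c < length qs" "u < length qs" "d < length qs" "v < length qs"
      using sub[OF X(1)] sub[OF Y(1)] X Y by auto
    show ?thesis
    proof (cases "X = Y")
      case True
      then have "p = q" using center[OF X(1)] X(7) Y(7) by blast
      then have "c = d" using X(4) Y(4) dist lt nth_eq_iff_index_eq by blast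
      have "u \<noteq> v" using neq \<open>p = q\<close> X(5) Y(5) by auto
      then have "orient p x y \<noteq> 0"
        using orient_nonzero lt X Y \<open>c = d\<close> by simp
      then show ?thesis using segments_common_endpoint[of p x y] \<open>p = q\<close> by auto
    next
      case False
      then have "X \<inter> Y = {}" "crossfree X Y"
        using disjF cf X(1) Y(1) by (auto simp: pairwise_def disjnt_def)
      then have "{c, u} \<inter> {d, v} = {}" "crossfree {c, u} {d, v}"
        using X Y by (auto elim!: crossfree_mono)
      then have "closed_segment p x \<inter> closed_segment q y = {}"
        unfolding X(4,5) Y(4,5) using X(6) Y(6) lt by (intro chords_disjoint) auto
      then show ?thesis by simp
    qed
  qed
  show ?thesis
    unfolding K13_covering_def
  proof (intro conjI)
    show "pairwise noncrossing (star_edges R B (?f ` F))"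
      using cross unfolding pairwise_def by (metis surj_pair)
  qed (use part center in blast)+
qed

text \<open>Disjoint index pairs share no endpoint, so non-crossing means disjoint segments, whereas
  an alternation would make them diagonals of a convex quadrilateral.\<close>

lemma chords_noncrossing_imp_crossfree:
  assumes "a < length qs" "b < length qs" "c < length qs" "d < length qs"
    "{a, b} \<inter> {c, d} = {}" "noncrossing (qs ! a, qs ! b) (qs ! c, qs ! d)"
  shows "crossfree {a, b} {c, d}"
proof -
  have "{qs ! a, qs ! b} \<inter> {qs ! c, qs ! d} = {}"
    using assms(1-5) dist by (auto simp: nth_eq_iff_index_eq)
  then have e: "closed_segment (qs ! a) (qs ! b) \<inter> closed_segment (qs ! c) (qs ! d) = {}"
    using assms(6) by auto
  then have e': "closed_segment (qs ! b) (qs ! a) \<inter> closed_segment (qs ! c) (qs ! d) = {}"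
    "closed_segment (qs ! a) (qs ! b) \<inter> closed_segment (qs ! d) (qs ! c) = {}"
    "closed_segment (qs ! b) (qs ! a) \<inter> closed_segment (qs ! d) (qs ! c) = {}"
    by (simp_all add: closed_segment_commute)
  show ?thesis
    unfolding crossfree_def
    using chords_cross[of a c b d] chords_cross[of a d b c] chords_cross[of b c a d] 
      chords_cross[of b d a c] chords_cross[of c a d b] chords_cross[of d a c b]
      chords_cross[of c b d a] chords_cross[of d b c a] e e' assms(1-4)
    by (auto simp: Int_commute)
qed

end

text \<open>A chord from inside the span of another to its outside would cross it.\<close>

lemma crossfree_pair_same_side:
  assumes "crossfree {c, x} {d, y}" "{c, x} \<inter> {d, y} = {}"
  shows "(min c x < d \<and> d < max c x) \<longleftrightarrow> (min c x < y \<and> y < max c x)"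
proof -
  have *: "(u < d \<and> d < v) \<longleftrightarrow> (u < y \<and> y < v)" if "{u, v} = {c, x}" for u v
  proof -
    have "\<not> (u < d \<and> d < v \<and> v < y)" "\<not> (u < y \<and> y < v \<and> v < d)"
      "\<not> (d < u \<and> u < y \<and> y < v)" "\<not> (y < u \<and> u < d \<and> d < v)"
      using assms(1) unfolding that[symmetric] crossfree_def by simp_all
    moreover have "u \<noteq> d" "u \<noteq> y" "v \<noteq> d" "v \<noteq> y" using assms(2) unfolding that[symmetric] by auto
    ultimately show ?thesis by linarith
  qed
  have "{min c x, max c x} = {c, x}" by (auto simp: min_def max_def)
  then show ?thesis by (rule *)
qed

text \<open>If no edge of either star separates two points of the other star, then no pair of points of
  a star does: a chord between two leaves cuts off an arc that is also cut off by an edge.\<close>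

lemma stars_crossfree:
  assumes "c \<in> X" "d \<in> Y" "X \<inter> Y = {}"
    and "\<And>x y. x \<in> X \<Longrightarrow> y \<in> Y \<Longrightarrow> crossfree {c, x} {d, y}"
  shows "crossfree X Y"
proof -
  have *: "\<not> (a < b \<and> b < e \<and> e < f)" if H: "a \<in> X" "e \<in> X" "b \<in> Y" "f \<in> Y"
    "c \<in> X" "d \<in> Y" "X \<inter> Y = {}" 
    "\<And>x y. x \<in> X \<Longrightarrow> y \<in> Y \<Longrightarrow> crossfree {c, x} {d, y}" for a b e f X Y c d
  proof
    assume o: "a < b \<and> b < e \<and> e < f"
    have side: "(min c x < d \<and> d < max c x) \<longleftrightarrow> (min c x < y \<and> y < max c x)"
      if "x \<in> X" "y \<in> Y" for x y
    proof -
      have "c \<noteq> y" "d \<noteq> x" "x \<noteq> y" "c \<noteq> d" using H that by auto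
      then show ?thesis using H(8)[OF that] by (intro crossfree_pair_same_side) auto
    qed
    have same: "(min c x < b \<and> b < max c x) \<longleftrightarrow> (min c x < f \<and> f < max c x)" if "x \<in> X" for x
      using side[OF that H(3)] side[OF that H(4)] by blast
    have "c \<noteq> b" "c \<noteq> f" using H by auto
    \<comment> \<open>If c lies between b and f, the edge to a separates b from f; otherwise the
      edge to e does.\<close>
    then consider "c < b" | "b < c" "c < f" | "f < c" by linarith
    then show False using o same[OF H(1)] same[OF H(2)] by cases auto
  qed
  show ?thesis
    unfolding crossfree_def
  proof (intro ballI conjI)
    fix a e b f assume "a \<in> X" "e \<in> X" "b \<in> Y" "f \<in> Y"
    then show "\<not> (a < b \<and> b < e \<and> e < f)"
      using assms by (intro *[where X = X and Y = Y and c = c and d = d])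
    show "\<not> (b < a \<and> a < f \<and> f < e)"
      by (rule *[where X = Y and Y = X and c = d and d = c])
        (use \<open>a \<in> X\<close> \<open>e \<in> X\<close> \<open>b \<in> Y\<close> \<open>f \<in> Y\<close> assms crossfree_sym in auto)
  qed
qed

context convex_polygon
begin

text \<open>All that survives of the points is the sequence of their colours along the hull.\<close>

theorem ex_covering_iff:
  "(\<exists>P. K13_covering R B (R \<union> B) P) \<longleftrightarrow>
   (\<exists>F. partition_on {..<length qs} F \<and> (\<forall>X\<in>F. good col X) \<and> pairwise crossfree F)"
proof
  assume "\<exists>F. partition_on {..<length qs} F \<and> (\<forall>X\<in>F. good col X) \<and> pairwise crossfree F"
  then obtain F where F: "partition_on {..<length qs} F" "\<forall>X\<in>F. good col X" "pairwise crossfree F"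
    by blast
  have "K13_covering R B ((!) qs ` \<Union>F) ((`) ((!) qs) ` F)"
    using F by (intro K13_covering_image) (auto simp: partition_on_def disjoint_def disjnt_def pairwise_def)
  moreover have "(!) qs ` \<Union>F = R \<union> B"
    using F(1) set_qs by (auto simp: partition_on_def set_conv_nth)
  ultimately show "\<exists>P. K13_covering R B (R \<union> B) P" by auto
next
  assume "\<exists>P. K13_covering R B (R \<union> B) P"
  then obtain P where P: "partition_on (R \<union> B) P" "\<And>Q. Q \<in> P \<Longrightarrow> \<exists>c. is_center R B Q c"
    "pairwise noncrossing (star_edges R B P)"
    unfolding K13_covering_def by blast
  define idx where "idx Q = {i. i < length qs \<and> qs ! i \<in> Q}" for Q
  have idx_img: "(!) qs ` idx Q = Q" if "Q \<in> P" for Q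
  proof -
    have "Q \<subseteq> set qs" using P(1) that set_qs by (auto simp: partition_on_def)
    then show ?thesis by (auto simp: idx_def in_set_conv_nth subset_eq image_iff) metis
  qed
  have disj_idx: "idx Q \<inter> idx Q' = {}" if "Q \<in> P" "Q' \<in> P" "Q \<noteq> Q'" for Q Q'
    using P(1) that by (auto simp: partition_on_def disjoint_def idx_def)
  have part: "partition_on {..<length qs} (idx ` P)"
  proof (rule partition_onI)
    have "\<Union>P = set qs" using P(1) set_qs by (simp add: partition_on_def)
    then have "\<forall>i<length qs. \<exists>Q\<in>P. qs ! i \<in> Q" using nth_mem by blast
    then show "\<Union>(idx ` P) = {..<length qs}" by (auto simp: idx_def)
    show "{} \<notin> idx ` P"
      using idx_img P(1) by (metis imageE image_empty partition_on_def)
    show "disjnt p q" if "p \<in> idx ` P" "q \<in> idx ` P" "p \<noteq> q" for p q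
      using that disj_idx by (auto simp: disjnt_def)
  qed
  have good: "good col X" if "X \<in> idx ` P" for X
    using that is_center_imp_good[of X] P(2) idx_img by (fastforce simp: idx_def)
  have "crossfree (idx Q) (idx Q')" if Q: "Q \<in> P" "Q' \<in> P" "Q \<noteq> Q'" for Q Q'
  proof -
    obtain p p' where p: "is_center R B Q p" "is_center R B Q' p'" using P(2) Q by blast
    then have "p \<in> Q" "p' \<in> Q'" by (auto simp: is_center_def)
    then obtain c c' where c: "c \<in> idx Q" "p = qs ! c" "c' \<in> idx Q'" "p' = qs ! c'"
      using idx_img[OF Q(1)] idx_img[OF Q(2)] by blast
    have dj: "idx Q \<inter> idx Q' = {}" by (rule disj_idx[OF Q])
    have four: "\<exists>y\<in>idx Q. y \<noteq> c" if "Q \<in> P" "is_center R B Q p" for Q c p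
    proof (rule ccontr)
      assume "\<not> ?thesis"
      then have "idx Q \<subseteq> {c}" by blast
      then have "card Q \<le> 1" using idx_img[OF that(1)] surj_card_le[of "{c}" Q "(!) qs"] by auto
      then show False using that(2) by (simp add: is_center_def)
    qed
    have e: "crossfree {c, x} {c', y}" if "x \<in> idx Q" "y \<in> idx Q'" "x \<noteq> c" "y \<noteq> c'" for x y
    proof (rule chords_noncrossing_imp_crossfree)
      show "{c, x} \<inter> {c', y} = {}" using dj c that by auto
      have lt: "c < length qs" "c' < length qs" "x < length qs" "y < length qs"
        using c that by (auto simp: idx_def)
      then show "c < length qs" "c' < length qs" "x < length qs" "y < length qs" by auto
      have "qs ! x \<in> Q" "qs ! y \<in> Q'" "qs ! x \<noteq> p" "qs ! y \<noteq> p'"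
        using that c lt dist by (auto simp: idx_def nth_eq_iff_index_eq)
      then have "(p, qs ! x) \<in> star_edges R B P" "(p', qs ! y) \<in> star_edges R B P"
        using p Q unfolding star_edges_def by blast+
      moreover have "p \<noteq> p'" using c dj lt dist by (auto simp: nth_eq_iff_index_eq)
      ultimately show "noncrossing (qs ! c, qs ! x) (qs ! c', qs ! y)"
        using P(3) unfolding c pairwise_def by blast
    qed
    obtain x0 y0 where x0: "x0 \<in> idx Q" "x0 \<noteq> c" and y0: "y0 \<in> idx Q'" "y0 \<noteq> c'"
      using four p Q by blast
    have "crossfree {c, x} {c', y}" if "x \<in> idx Q" "y \<in> idx Q'" for x y
    proof -
      \<comment> \<open>Only proper edges are known not to cross. A degenerate pair
        \<open>{c, c}\<close> is contained in the pair of some edge, so monotonicity of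
        \<open>crossfree\<close> covers it.\<close>
      define x' where "x' = (if x = c then x0 else x)"
      define y' where "y' = (if y = c' then y0 else y)"
      have "crossfree {c, x'} {c', y'}"
        using e[of x' y'] that x0 y0 by (auto simp: x'_def y'_def)
      then show ?thesis by (rule crossfree_mono) (auto simp: x'_def y'_def)
    qed
    then show ?thesis by (rule stars_crossfree[OF c(1) c(3) dj])
  qed
  then have "pairwise crossfree (idx ` P)" by (auto simp: pairwise_def)
  then show "\<exists>F. partition_on {..<length qs} F \<and> (\<forall>X\<in>F. good col X) \<and> pairwise crossfree F"
    using part good by blast
qed

end

section \<open>Deciding the existence of a covering\<close>

definition noncrossing_stars :: "(nat \<Rightarrow> nat) \<Rightarrow> nat set \<Rightarrow> nat set set \<Rightarrow> bool" where
  "noncrossing_stars col A F \<longleftrightarrow>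
     partition_on A F \<and> (\<forall>X\<in>F. good col X) \<and> pairwise crossfree F"

text \<open>The recursion follows the star of the least point i. No other star can straddle a vertex
  of it, so the four gaps are independent subproblems.\<close>

inductive coverable :: "(nat \<Rightarrow> nat) \<Rightarrow> nat \<Rightarrow> nat \<Rightarrow> bool" for col :: "nat \<Rightarrow> nat" where
  empty: "coverable col i i"
| star: "i < a \<Longrightarrow> a < b \<Longrightarrow> b < c \<Longrightarrow> c < j \<Longrightarrow> odd (col i + col a + col b + col c) \<Longrightarrow>
    coverable col (Suc i) a \<Longrightarrow> coverable col (Suc a) b \<Longrightarrow> coverable col (Suc b) c \<Longrightarrow>
    coverable col (Suc c) j \<Longrightarrow> coverable col i j"

lemma noncrossing_stars_Un:
  assumes "noncrossing_stars col A F" "noncrossing_stars col A' G" "A \<inter> A' = {}"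
    and "\<And>X Y. X \<in> F \<Longrightarrow> Y \<in> G \<Longrightarrow> crossfree X Y"
  shows "noncrossing_stars col (A \<union> A') (F \<union> G)"
proof -
  have P: "partition_on A F" "partition_on A' G" "pairwise crossfree F" "pairwise crossfree G"
    using assms(1,2) by (auto simp: noncrossing_stars_def)
  have "partition_on (A \<union> A') (F \<union> G)"
  proof (rule partition_onI)
    show "disjnt p q" if pq: "p \<in> F \<union> G" "q \<in> F \<union> G" "p \<noteq> q" for p q
    proof -
      consider "p \<in> F" "q \<in> F" | "p \<in> G" "q \<in> G" | "p \<subseteq> A" "q \<subseteq> A'" | "p \<subseteq> A'" "q \<subseteq> A"
        using pq(1,2) partition_onD1[OF P(1)] partition_onD1[OF P(2)] by blast
      then show ?thesis
        using pairwiseD[OF partition_onD2[OF P(1)] _ _ pq(3)]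
          pairwiseD[OF partition_onD2[OF P(2)] _ _ pq(3)] assms(3)
        by cases (simp_all, auto simp: disjnt_def)
    qed
  qed (use P(1,2) in \<open>auto simp: partition_on_def\<close>)
  moreover have "pairwise crossfree (F \<union> G)"
  proof (rule pairwiseI)
    fix X Y assume "X \<in> F \<union> G" "Y \<in> F \<union> G" "X \<noteq> Y"
    then show "crossfree X Y"
      using pairwiseD[OF P(3)] pairwiseD[OF P(4)] assms(4)[of X Y] crossfree_sym[OF assms(4)[of Y X]]
      by (elim UnE) simp_all
  qed
  ultimately show ?thesis using assms(1,2) by (auto simp: noncrossing_stars_def)
qed

lemma noncrossing_stars_subset: "noncrossing_stars col A F \<Longrightarrow> X \<in> F \<Longrightarrow> X \<subseteq> A"
  by (auto simp: noncrossing_stars_def partition_on_def)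

lemma noncrossing_stars_Un_less:
  assumes "noncrossing_stars col A F" "noncrossing_stars col A' G" "\<forall>x\<in>A. \<forall>y\<in>A'. x < y"
  shows "noncrossing_stars col (A \<union> A') (F \<union> G)"
proof (rule noncrossing_stars_Un[OF assms(1,2)])
  show "A \<inter> A' = {}" using assms(3) by fastforce
  show "crossfree X Y" if "X \<in> F" "Y \<in> G" for X Y
    using that assms noncrossing_stars_subset by (intro crossfree_arcI) blast
qed

lemma coverable_imp_stars:
  "coverable col i j \<Longrightarrow> \<exists>F. noncrossing_stars col {i..<j} F"
proof (induction rule: coverable.induct)
  case (empty i)
  then show ?case by (intro exI[of _ "{}"]) (simp add: noncrossing_stars_def partition_on_def)
next
  case (star i a b c j)
  then obtain F1 F2 F3 F4 where F: "noncrossing_stars col {Suc i..<a} F1"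
    "noncrossing_stars col {Suc a..<b} F2" "noncrossing_stars col {Suc b..<c} F3"
    "noncrossing_stars col {Suc c..<j} F4"
    by blast
  let ?Q = "{i, a, b, c}"
  let ?A = "{Suc i..<a} \<union> {Suc a..<b} \<union> {Suc b..<c} \<union> {Suc c..<j}"
  note o = \<open>i < a\<close> \<open>a < b\<close> \<open>b < c\<close> \<open>c < j\<close>
  have stars: "noncrossing_stars col ?A (F1 \<union> F2 \<union> F3 \<union> F4)"
    using F o by (intro noncrossing_stars_Un_less) auto
  have "good col ?Q"
    using star o by (simp add: good_def add.assoc)
  then have Q: "noncrossing_stars col ?Q {?Q}"
    by (simp add: noncrossing_stars_def partition_on_def)
  \<comment> \<open>Every vertex of the outer star is entirely on one side of a star inside a
    gap.\<close>
  have gap: "crossfree X ?Q" if "noncrossing_stars col {k..<l} G" "X \<in> G" "\<forall>q\<in>?Q. q < k \<or> l \<le> q"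
    for X G k l
  proof (rule crossfree_sym, rule crossfree_arcI)
    fix q assume "q \<in> ?Q"
    then have "q < k \<or> l \<le> q" using that(3) by blast
    moreover have "X \<subseteq> {k..<l}" using that noncrossing_stars_subset by blast
    ultimately show "(\<forall>y\<in>X. q < y) \<or> (\<forall>y\<in>X. y < q)" by fastforce
  qed
  have "noncrossing_stars col (?A \<union> ?Q) (F1 \<union> F2 \<union> F3 \<union> F4 \<union> {?Q})"
  proof (rule noncrossing_stars_Un[OF stars Q])
    show "?A \<inter> ?Q = {}" using o by auto
    show "crossfree X Y" if "X \<in> F1 \<union> F2 \<union> F3 \<union> F4" "Y \<in> {?Q}" for X Y
      using that gap[OF F(1), of X] gap[OF F(2), of X] gap[OF F(3), of X] gap[OF F(4), of X] o
      by auto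
  qed
  moreover have "?A \<union> ?Q = {i..<j}" using o by auto
  ultimately show ?case by metis
qed

lemma card_4_obtain_sorted:
  fixes Q :: "nat set"
  assumes "card Q = 4"
  obtains i a b c where "Q = {i, a, b, c}" "i < a" "a < b" "b < c"
proof -
  define l where "l = sorted_list_of_set Q"
  have fin: "finite Q" using assms by (metis card.infinite zero_neq_numeral)
  then have l: "length l = 4" "set l = Q" "sorted_wrt (<) l"
    using assms by (simp_all add: l_def strict_sorted_list_of_set)
  then obtain i a b c where "l = [i, a, b, c]"
    by (auto simp: numeral_eq_Suc length_Suc_conv)
  then show ?thesis using l by (intro that[of i a b c]) auto
qed

lemma stars_imp_coverable:
  assumes "noncrossing_stars col {i..<j} F" "i \<le> j"
  shows "coverable col i j"
  using assms
proof (induction "j - i" arbitrary: i j F rule: less_induct)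
  case less
  show ?case
  proof (cases "i = j")
    case True
    then show ?thesis by (simp add: coverable.empty)
  next
    case False
    have P: "partition_on {i..<j} F" "\<And>X. X \<in> F \<Longrightarrow> good col X" "pairwise crossfree F"
      using less.prems by (auto simp: noncrossing_stars_def)
    have UF: "\<Union>F = {i..<j}" using P(1) by (simp add: partition_on_def)
    then obtain Q where Q: "Q \<in> F" "i \<in> Q" using False less.prems(2) by (metis UnionE atLeastLessThan_iff le_neq_implies_less order_refl)
    have Qsub: "Q \<subseteq> {i..<j}" using UF Q by blast
    obtain i' a b c where Qeq: "Q = {i', a, b, c}" and o': "i' < a" "a < b" "b < c"
      using card_4_obtain_sorted P(2)[OF Q(1)] by (metis good_def)
    have "i' = i" using Q(2) Qsub o' unfolding Qeq by auto
    then have Qeq: "Q = {i, a, b, c}" and o: "i < a" "a < b" "b < c" "c < j"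
      using Qeq o' Qsub by auto
    have gap: "coverable col k l"
      if kl: "k \<le> l" "i < k" "l \<le> j" "{k..<l} \<inter> Q = {}"
        and q: "k - 1 \<in> Q" "l \<in> Q \<or> l = j" for k l
    proof (rule less.hyps)
      show "l - k < j - i" using kl less.prems(2) False by linarith
      show "k \<le> l" by fact
      let ?G = "{X\<in>F. X \<subseteq> {k..<l}}"
      \<comment> \<open>A star that meets the gap stays in it: a vertex further left would alternate
        with i and k - 1, a vertex further right with k - 1 and l.\<close>
      have inside: "X \<subseteq> {k..<l}" if X: "X \<in> F" "x \<in> X" "x \<in> {k..<l}" for X x
      proof
        fix y assume y: "y \<in> X"
        have "X \<noteq> Q" using X kl(4) by blast
        then have cf: "crossfree X Q" and "disjnt X Q"
          using pairwiseD[OF P(3) X(1) Q(1)] pairwiseD[OF partition_onD2[OF P(1)] X(1) Q(1)] by auto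
        then have dj: "X \<inter> Q = {}" by (simp add: disjnt_def)
        have yb: "i \<le> y" "y < j" using UF X(1) y by auto
        have "y \<noteq> i" "y \<noteq> k - 1" "y \<noteq> l \<or> l = j" using dj y Q(2) q by auto
        moreover have "\<not> (y < k - 1)"
        proof
          assume "y < k - 1"
          then have "i < y" "y < k - 1" "k - 1 < x" using yb \<open>y \<noteq> i\<close> X(3) kl(2) by auto
          then show False using cf Q(2) q(1) y X(2) unfolding crossfree_def by blast
        qed
        moreover have "\<not> l < y"
        proof
          assume "l < y"
          then have "k - 1 < x" "x < l" "l < y" "l \<in> Q" using yb X(3) kl(2) q by auto
          then show False using cf Q(2) q(1) y X(2) unfolding crossfree_def by blast
        qed
        ultimately show "y \<in> {k..<l}" using yb by auto
      qed
      have "\<Union>?G = {k..<l}"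
      proof
        show "{k..<l} \<subseteq> \<Union>?G"
        proof
          fix x assume x: "x \<in> {k..<l}"
          then have "x \<in> \<Union>F" using UF kl by auto
          then show "x \<in> \<Union>?G" using inside x by blast
        qed
      qed blast
      then show "noncrossing_stars col {k..<l} ?G"
        using P(2) pairwise_subset[OF P(3), of ?G] pairwise_subset[OF partition_onD2[OF P(1)], of ?G]
          partition_onD3[OF P(1)]
        by (auto simp: noncrossing_stars_def partition_on_def)
    qed
    have "odd (col i + col a + col b + col c)"
      using P(2)[OF Q(1)] o unfolding good_def Qeq by (simp add: add.assoc)
    then show ?thesis
      using o by (intro coverable.star[of i a b c j] gap) (auto simp: Qeq)
  qed
qed

lemma coverable_iff: "i \<le> j \<Longrightarrow> coverable col i j \<longleftrightarrow> (\<exists>F. noncrossing_stars col {i..<j} F)"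
  using coverable_imp_stars stars_imp_coverable by blast

section \<open>Ranking the points around the first one\<close>

lemma ccw_order_rotate1:
  assumes "ccw_order qs"
  shows "ccw_order (rotate1 qs)"
proof (cases qs)
  case (Cons p xs)
  show ?thesis
    unfolding ccw_order_def
  proof (intro allI impI)
    fix i j k assume ijk: "i < j" "j < k" "k < length (rotate1 qs)"
    then have k: "k < length xs \<or> k = length xs" and ij: "i < length xs" "j < length xs"
      using Cons by auto
    have "orient (xs ! i) (xs ! j) (xs ! k) > 0" if "k < length xs"
      using assms ijk that unfolding Cons ccw_order_def
      by (elim allE[of _ "Suc i"] allE[of _ "Suc j"] allE[of _ "Suc k"]) auto
    moreover have "orient p (xs ! i) (xs ! j) > 0"
      using assms ijk ij unfolding Cons ccw_order_def
      by (elim allE[of _ 0] allE[of _ "Suc i"] allE[of _ "Suc j"]) auto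
    then have "orient (xs ! i) (xs ! j) p > 0" by (simp add: orient_cycle)
    ultimately show "orient (rotate1 qs ! i) (rotate1 qs ! j) (rotate1 qs ! k) > 0"
      using k ij Cons by (auto simp: nth_append)
  qed
qed (simp add: ccw_order_def)

text \<open>The hull order has to start at the point around which angles are compared. Rotating a
  listing is harmless because \<open>orient\<close> is invariant under cyclic shifts.\<close>

lemma exists_ccw_order_from:
  assumes "finite S" "convex_position S" "p \<in> S"
  shows "\<exists>qs. distinct qs \<and> set qs = S \<and> ccw_order qs \<and> qs ! 0 = p"
proof -
  obtain qs where qs: "distinct qs" "set qs = S" "ccw_order qs"
    using exists_ccw_order[OF assms(1,2)] by blast
  then obtain m where m: "m < length qs" "qs ! m = p" using assms(3) by (metis in_set_conv_nth)
  have "ccw_order (rotate m qs)"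
    by (induction m) (use qs ccw_order_rotate1 in auto)
  moreover have "rotate m qs ! 0 = p" using m by (subst nth_rotate) auto
  ultimately show ?thesis using qs by (intro exI[of _ "rotate m qs"]) simp
qed

text \<open>"Not positive" rather than "negative": for j = 0 the orientation is 0, and this makes
  the first point precede all others. The condition \<open>0 < i\<close> gives the first point
  itself rank 0.\<close>

definition before :: "point list \<Rightarrow> nat \<Rightarrow> nat \<Rightarrow> bool" where
  "before ps i j \<longleftrightarrow> 0 < i \<and> j \<noteq> i \<and> \<not> 0 < orient (ps ! 0) (ps ! i) (ps ! j)"

definition rank :: "point list \<Rightarrow> nat \<Rightarrow> nat" where
  "rank ps i = card {j. j < length ps \<and> before ps i j}"

lemma card_nth_cong:
  assumes "distinct xs" "distinct ys" "set xs = set ys"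
  shows "card {j. j < length xs \<and> P (xs ! j)} = card {j. j < length ys \<and> P (ys ! j)}"
  using distinct_length_filter[OF assms(1), of P] distinct_length_filter[OF assms(2), of P] assms(3)
  by (simp add: length_filter_conv_card)

text \<open>Seen from the first point, the points clockwise of point i are those of smaller hull
  index. Counting them together with the first point gives the hull index of i.\<close>

lemma nth_rank:
  assumes ps: "distinct ps" and qs: "distinct qs" "set qs = set ps" "ccw_order qs" "qs ! 0 = ps ! 0"
    and i: "i < length ps"
  shows "rank ps i < length ps" "qs ! rank ps i = ps ! i"
proof -
  have len: "length qs = length ps" using ps qs by (metis distinct_card)
  obtain m where m: "m < length qs" "qs ! m = ps ! i" using i qs(2) by (metis in_set_conv_nth nth_mem)
  have "rank ps i = m"
  proof (cases "i = 0")
    case True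
    then have "m = 0" using m qs i len by (metis nth_eq_iff_index_eq)
    then show ?thesis using True by (simp add: rank_def before_def)
  next
    case False
    then have m0: "0 < m" using m qs ps i len by (metis gr0I length_pos_if_in_set nth_eq_iff_index_eq nth_mem)
    define P where "P x \<longleftrightarrow> x \<noteq> ps ! i \<and> \<not> 0 < orient (ps ! 0) (ps ! i) x" for x
    have "{j. j < length ps \<and> before ps i j} = {j. j < length ps \<and> P (ps ! j)}"
      using False i ps by (auto simp: before_def P_def nth_eq_iff_index_eq)
    then have "rank ps i = card {j. j < length qs \<and> P (qs ! j)}"
      using card_nth_cong[OF ps qs(1) qs(2)[symmetric], of P] by (simp add: rank_def)
    also have "{j. j < length qs \<and> P (qs ! j)} = {..<m}"
    proof -
      have "P (qs ! j) \<longleftrightarrow> j < m" if j: "j < length qs" for j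
      proof -
        consider "j = 0" | "0 < j" "j < m" | "j = m" | "m < j" by linarith
        then show ?thesis
        proof cases
          case 1
          have "qs ! 0 \<noteq> qs ! m" using m0 m(1) qs(1) j 1 by (simp add: nth_eq_iff_index_eq)
          then show ?thesis using 1 m0 m qs(4) by (auto simp: P_def orient_def)
        next
          case 2
          then have "0 < orient (qs ! 0) (qs ! j) (qs ! m)"
            using qs(3) m(1) unfolding ccw_order_def by blast
          moreover have "qs ! j \<noteq> qs ! m" using 2 m(1) qs(1) j by (simp add: nth_eq_iff_index_eq)
          ultimately show ?thesis using 2 m qs(4) orient_swap[of "ps ! 0" "ps ! i" "qs ! j"]
            by (auto simp: P_def)
        next
          case 3
          then show ?thesis using m by (simp add: P_def)
        next
          case 4
          then have "0 < orient (qs ! 0) (qs ! m) (qs ! j)"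
            using qs(3) m0 j unfolding ccw_order_def by blast
          then show ?thesis using 4 m qs(4) by (simp add: P_def)
        qed
      qed
      then show ?thesis using m(1) by auto
    qed
    finally show ?thesis by simp
  qed
  then show "rank ps i < length ps" "qs ! rank ps i = ps ! i" using m len by auto
qed

definition X_at :: "wexp \<Rightarrow> rexp" where "X_at i = RLoad (WMul (WConst 2) i)"
definition Y_at :: "wexp \<Rightarrow> rexp" where "Y_at i = RLoad (WAdd (WMul (WConst 2) i) (WConst 1))"

definition Orient :: "wexp \<Rightarrow> wexp \<Rightarrow> wexp \<Rightarrow> rexp" where
  "Orient a b c = RSub (RMul (RSub (X_at b) (X_at a)) (RSub (Y_at c) (Y_at a)))
                       (RMul (RSub (Y_at b) (Y_at a)) (RSub (X_at c) (X_at a)))"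

lemma rval_Orient:
  assumes "rmem s = rmem (input B ps)" "wval a s < length ps" "wval b s < length ps" "wval c s < length ps"
  shows "rval (Orient a b c) s = orient (ps ! wval a s) (ps ! wval b s) (ps ! wval c s)"
  using assms by (simp add: Orient_def X_at_def Y_at_def orient_def input_def)

definition rank_test :: bexp where
  "rank_test = (let i = WDiv (Reg 1) (Reg 0); j = WMod (Reg 1) (Reg 0) in
     BAnd (WLess (WConst 0) i)
       (BAnd (BNot (WEq j i)) (BNot (RLess (RConst 0) (Orient (WConst 0) i j)))))"

definition rank_body :: com where
  "rank_body = (let cell = WAdd (Reg 0) (WDiv (Reg 1) (Reg 0)) in
     Seq (Cond rank_test (WStore cell (WAdd (WLoad cell) (WConst 1))) Skip)
         (Assign 1 (WAdd (Reg 1) (WConst 1))))"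

definition rank_loop :: com where
  "rank_loop = While (WLess (Reg 1) (WMul (Reg 0) (Reg 0))) rank_body"

text \<open>One counter enumerates all pairs as quotient and remainder by n; cell
  \<open>n + x\<close> counts the points found before x so far. The zero cells are reserved for the
  later tables.\<close>

definition rank_inv :: "point set \<Rightarrow> point list \<Rightarrow> nat \<Rightarrow> mstate \<Rightarrow> bool" where
  "rank_inv B ps k s \<longleftrightarrow> (let n = length ps in
     regs s 0 = n \<and> regs s 1 = k \<and> rmem s = rmem (input B ps) \<and>
     (\<forall>x<n. wmem s x = wmem (input B ps) x) \<and>
     (\<forall>x<n. wmem s (n + x) = card {t. t < k \<and> t div n = x \<and> before ps x (t mod n)}) \<and>
     (\<forall>x\<ge>2 * n. wmem s x = 0))"

lemma card_less_Suc_Collect: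
  "card {t. t < Suc k \<and> P t} = card {t::nat. t < k \<and> P t} + (if P k then 1 else 0)"
proof -
  have "{t. t < Suc k \<and> P t} = (if P k then insert k {t. t < k \<and> P t} else {t. t < k \<and> P t})"
    by (auto simp: less_Suc_eq)
  then show ?thesis by simp
qed

lemma rank_loop_correct:
  assumes s: "s = input B ps" and n: "n = length ps" and M: "2 * n \<le> M" and W: "n * n < W"
  shows "halts_within (Suc (n * n * 5)) M W rank_loop s (rank_inv B ps (n * n))"
proof -
  have "halts_within (Suc (n * n * Suc 4)) M W rank_loop s (rank_inv B ps (n * n))"
    unfolding rank_loop_def
  proof (rule halts_within_While)
    show "rank_inv B ps 0 s"
      by (auto simp: rank_inv_def Let_def s input_def n)
  next
    fix s assume "rank_inv B ps (n * n) s"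
    then show "\<not> bval (WLess (Reg 1) (WMul (Reg 0) (Reg 0))) s" by (simp add: rank_inv_def Let_def n)
  next
    fix k s assume I: "rank_inv B ps k s" and k: "k < n * n"
    have n0: "0 < n" using k by (cases n) auto
    define i j where "i = k div n" "j = k mod n"
    have ij: "i < n" "j < n" using k n0 by (auto simp: i_j_def less_mult_imp_div_less)
    have r: "regs s 0 = n" "regs s 1 = k" "regs s (Suc 0) = k" "rmem s = rmem (input B ps)"
      using I by (auto simp: rank_inv_def Let_def n)
    have cells: "wmem s (n + i) = card {t. t < k \<and> t div n = i \<and> before ps i (t mod n)}"
      using I ij by (auto simp: rank_inv_def Let_def n)
    \<comment> \<open>A partial rank never exceeds the round counter, which keeps the stored word
      below W.\<close>
    have "card {t. t < k \<and> t div n = i \<and> before ps i (t mod n)} \<le> card {..<k}"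
      by (intro card_mono) auto
    then have bound: "wmem s (n + i) \<le> k" using cells by simp
    have test: "bval rank_test s \<longleftrightarrow> before ps i j"
      using rval_Orient[OF r(4), of "WConst 0" "WDiv (Reg 1) (Reg 0)" "WMod (Reg 1) (Reg 0)"] r ij n0
      by (simp add: rank_test_def Let_def before_def i_j_def n)
    have old: "rank_inv B ps (Suc k) (s\<lparr>regs := (regs s)(1 := Suc k)\<rparr>)" if "\<not> before ps i j"
      using I that by (auto simp: rank_inv_def Let_def n[symmetric] card_less_Suc_Collect i_j_def)
    have new: "rank_inv B ps (Suc k) (s\<lparr>wmem := (wmem s)(n + i := Suc (wmem s (n + i))),
        regs := (regs s)(1 := Suc k)\<rparr>)" if "before ps i j"
      using I that ij by (auto simp: rank_inv_def Let_def n[symmetric] card_less_Suc_Collect i_j_def)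
    have "wp M W rank_body (rank_inv B ps (Suc k)) s"
      using old new test r ij bound k M W by (auto simp: rank_body_def Let_def i_j_def)
    then show "bval (WLess (Reg 1) (WMul (Reg 0) (Reg 0))) s \<and>
        halts_within 4 M W rank_body s (rank_inv B ps (Suc k))"
      using r k by (auto intro!: halts_within_wp simp: rank_body_def Let_def)
  qed
  then show ?thesis by simp
qed

lemma rank_inv_final:
  assumes "rank_inv B ps (length ps * length ps) s" "x < length ps"
  shows "wmem s (length ps + x) = rank ps x"
proof -
  let ?n = "length ps"
  have n0: "0 < ?n" using assms(2) by linarith
  have "{t. t < ?n * ?n \<and> t div ?n = x \<and> before ps x (t mod ?n)}
      = (\<lambda>j. x * ?n + j) ` {j. j < ?n \<and> before ps x j}" (is "?A = ?f ` ?B")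
  proof
    show "?A \<subseteq> ?f ` ?B"
    proof
      fix t assume t: "t \<in> ?A"
      then have "t = x * ?n + t mod ?n" by (metis (mono_tags, lifting) div_mult_mod_eq mem_Collect_eq)
      moreover have "t mod ?n \<in> ?B" using t n0 by auto
      ultimately show "t \<in> ?f ` ?B" by blast
    qed
    show "?f ` ?B \<subseteq> ?A"
    proof
      fix t assume "t \<in> ?f ` ?B"
      then obtain j where j: "t = x * ?n + j" "j < ?n" "before ps x j" by blast
      have "x * ?n + j < Suc x * ?n" using j by simp
      also have "\<dots> \<le> ?n * ?n" using assms(2) by (intro mult_right_mono) auto
      finally have "t < ?n * ?n" using j by simp
      moreover have "t div ?n = x" using j n0 by simp
      ultimately show "t \<in> ?A" using j by simp
    qed
  qed
  then have "card ?A = card ?B" by (simp add: card_image)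
  then show ?thesis using assms by (simp add: rank_inv_def Let_def rank_def)
qed

section \<open>Colours in hull order\<close>

definition perm_body :: com where
  "perm_body =
     Seq (WStore (WAdd (WMul (WConst 2) (Reg 0)) (WLoad (WAdd (Reg 0) (Reg 1)))) (WLoad (Reg 1)))
         (Assign 1 (WAdd (Reg 1) (WConst 1)))"

definition perm_loop :: com where
  "perm_loop = While (WLess (Reg 1) (Reg 0)) perm_body"

definition perm_inv :: "(nat \<Rightarrow> nat) \<Rightarrow> (nat \<Rightarrow> nat) \<Rightarrow> nat \<Rightarrow> nat \<Rightarrow> mstate \<Rightarrow> bool" where
  "perm_inv col pos n k s \<longleftrightarrow>
     regs s 0 = n \<and> regs s 1 = k \<and> (\<forall>x<n. wmem s x = col x) \<and> (\<forall>x<n. wmem s (n + x) = pos x) \<and>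
     (\<forall>x<k. wmem s (2 * n + pos x) = col x) \<and> (\<forall>x\<ge>3 * n. wmem s x = 0)"

lemma perm_loop_correct:
  assumes init: "perm_inv col pos n 0 s" and M: "3 * n \<le> M" and W: "n < W"
    and col: "\<And>x. x < n \<Longrightarrow> col x < W" and pos: "\<And>x. x < n \<Longrightarrow> pos x < n" "inj_on pos {..<n}"
  shows "halts_within (Suc (n * 3)) M W perm_loop s (perm_inv col pos n n)"
proof -
  have "halts_within (Suc (n * Suc 2)) M W perm_loop s (perm_inv col pos n n)"
    unfolding perm_loop_def
  proof (rule halts_within_While[where I = "perm_inv col pos n"])
    fix s assume "perm_inv col pos n n s"
    then show "\<not> bval (WLess (Reg 1) (Reg 0)) s" by (simp add: perm_inv_def)
  next
    fix k s assume I: "perm_inv col pos n k s" and k: "k < n"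
    have r: "regs s 0 = n" "regs s 1 = k" "regs s (Suc 0) = k" "wmem s (n + k) = pos k" "wmem s k = col k"
      using I k by (auto simp: perm_inv_def)
    have "pos x \<noteq> pos k" if "x < k" for x
      using pos(2) that k by (auto dest: inj_onD)
    then have "perm_inv col pos n (Suc k)
        (s\<lparr>wmem := (wmem s)(2 * n + pos k := col k), regs := (regs s)(1 := Suc k)\<rparr>)"
      using I pos(1)[OF k] by (auto simp: perm_inv_def less_Suc_eq)
    then have "wp M W perm_body (perm_inv col pos n (Suc k)) s"
      using r pos(1)[OF k] col[OF k] M W k by (simp add: perm_body_def)
    then show "bval (WLess (Reg 1) (Reg 0)) s \<and>
        halts_within 2 M W perm_body s (perm_inv col pos n (Suc k))"
      using r k by (auto intro!: halts_within_wp simp: perm_body_def)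
  qed (rule init)
  then show ?thesis by simp
qed

subsection \<open>Interval table\<close>

text \<open>Iterated division instead of a power of N, because this is the form in which the
  expression \<open>Digit\<close> computes it.\<close>

definition digit :: "nat \<Rightarrow> nat \<Rightarrow> nat \<Rightarrow> nat" where
  "digit N d t = ((\<lambda>x. x div N) ^^ d) t mod N"

text \<open>Step \<open>t\<close> of the table computation tries the star on the points \<open>i < a < b < c\<close> of the
  interval \<open>{i..<j}\<close>, where \<open>n - i, j, a, b, c\<close> are the digits of \<open>t\<close> in base \<open>N = n + 1\<close>; hence all
  intervals with a larger left end are complete when they are needed.\<close>

definition hit :: "(nat \<Rightarrow> nat) \<Rightarrow> nat \<Rightarrow> nat \<Rightarrow> nat \<Rightarrow> nat \<Rightarrow> bool" where
  "hit col n t i j \<longleftrightarrow> (let N = Suc n; a = digit N 2 t; b = digit N 1 t; c = digit N 0 t in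
     i = n - digit N 4 t \<and> j = digit N 3 t \<and>
     (i = j \<or> i < a \<and> a < b \<and> b < c \<and> c < j \<and> odd (col i + col a + col b + col c) \<and>
       coverable col (Suc i) a \<and> coverable col (Suc a) b \<and>
       coverable col (Suc b) c \<and> coverable col (Suc c) j))"

lemma digit_less: "digit (Suc n) d t \<le> n"
  by (simp add: digit_def less_Suc_eq_le[symmetric])

lemma hit_imp_coverable: "hit col n t i j \<Longrightarrow> coverable col i j"
  unfolding hit_def Let_def by (metis coverable.simps)

lemma ex_digits:
  assumes "e \<le> n" "j \<le> n" "a \<le> n" "b \<le> n" "c \<le> n"
  obtains t where "t < Suc n ^ 5" "digit (Suc n) 4 t = e" "digit (Suc n) 3 t = j"
    "digit (Suc n) 2 t = a" "digit (Suc n) 1 t = b" "digit (Suc n) 0 t = c"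
proof -
  define N where "N = Suc n"
  have lt: "e < N" "j < N" "a < N" "b < N" "c < N" using assms by (auto simp: N_def)
  have step: "x * N + y < N ^ Suc m" if "x < N ^ m" "y < N" for x y m
  proof -
    have "x * N + y < Suc x * N" using that by simp
    also have "\<dots> \<le> N ^ m * N" using that by (intro mult_right_mono) auto
    finally show ?thesis by (simp add: mult.commute)
  qed
  have dm: "(x * N + y) div N = x" "(x * N + y) mod N = y" if "y < N" for x y
    using that by auto
  define t where "t = (((e * N + j) * N + a) * N + b) * N + c"
  have "t < N ^ Suc (Suc (Suc (Suc (Suc 0))))"
    unfolding t_def using lt by (intro step) auto
  then have "t < N ^ 5" by (simp add: numeral_eq_Suc)
  moreover have "digit N 4 t = e" "digit N 3 t = j" "digit N 2 t = a" "digit N 1 t = b" "digit N 0 t = c"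
    using lt by (simp_all add: digit_def t_def dm numeral_eq_Suc)
  ultimately show ?thesis using that unfolding N_def by blast
qed

lemma coverable_imp_hit:
  assumes "coverable col i j" "j \<le> n" "i \<le> n"
  shows "\<exists>t<Suc n ^ 5. hit col n t i j"
  using assms(1)
proof cases
  case empty
  obtain t where "t < Suc n ^ 5" "digit (Suc n) 4 t = n - i" "digit (Suc n) 3 t = j"
    using ex_digits[of "n - i" n j 0 0 0] assms(2) by auto
  then show ?thesis using empty assms(3) by (intro exI[of _ t]) (simp add: hit_def)
next
  case (star a b c)
  obtain t where "t < Suc n ^ 5" "digit (Suc n) 4 t = n - i" "digit (Suc n) 3 t = j"
    "digit (Suc n) 2 t = a" "digit (Suc n) 1 t = b" "digit (Suc n) 0 t = c"
    using ex_digits[of "n - i" n j a b c] assms(2) star by auto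
  then show ?thesis using star assms(3) by (intro exI[of _ t]) (simp add: hit_def Let_def)
qed

lemma iterated_div: "((\<lambda>x. x div N) ^^ d) x = x div N ^ d" for N :: nat
  by (induction d) (simp_all add: mult.commute flip: div_mult2_eq)

text \<open>Below \<open>Suc n ^ 5\<close> the leading digit is the plain quotient by
  \<open>Suc n ^ 4\<close>. It equals n minus the left end, so a larger left end belongs to a
  smaller quotient.\<close>

lemma hit_before:
  assumes "hit col n t' i' j'" "n - digit (Suc n) 4 t < i'" "t' < Suc n ^ 5" "t < Suc n ^ 5"
  shows "t' < t"
proof -
  let ?d = "(\<lambda>x. x div Suc n) ^^ 4"
  note d = iterated_div[of 4 "Suc n"]
  have "?d x < Suc n" if "x < Suc n ^ 5" for x
    unfolding d using that by (intro less_mult_imp_div_less) (simp add: numeral_eq_Suc ac_simps)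
  then have "digit (Suc n) 4 t = t div Suc n ^ 4" "digit (Suc n) 4 t' = t' div Suc n ^ 4"
    using assms(3,4) by (simp_all add: digit_def d)
  moreover have "i' = n - digit (Suc n) 4 t'" using assms(1) by (simp add: hit_def Let_def)
  ultimately have "t' div Suc n ^ 4 < t div Suc n ^ 4" using assms(2) by linarith
  then show ?thesis by (meson div_le_mono leD leI)
qed

definition Digit :: "nat \<Rightarrow> wexp" where
  "Digit d = WMod (((\<lambda>e. WDiv e (WAdd (Reg 0) (WConst 1))) ^^ d) (Reg 1)) (WAdd (Reg 0) (WConst 1))"

lemma wval_Digit: "wval (Digit d) s = digit (Suc (regs s 0)) d (regs s 1)"
proof -
  have "wval (((\<lambda>e. WDiv e (WAdd (Reg 0) (WConst 1))) ^^ d) (Reg 1)) s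
      = ((\<lambda>x. x div Suc (regs s 0)) ^^ d) (regs s 1)"
    by (induction d) simp_all
  then show ?thesis by (simp add: Digit_def digit_def)
qed

definition Cell :: "wexp \<Rightarrow> wexp \<Rightarrow> wexp" where
  "Cell i j = WAdd (WAdd (WMul (WConst 3) (Reg 0)) (WMul i (WAdd (Reg 0) (WConst 1)))) j"

definition Colour :: "wexp \<Rightarrow> wexp" where
  "Colour i = WLoad (WAdd (WMul (WConst 2) (Reg 0)) i)"

definition Next :: "wexp \<Rightarrow> wexp" where "Next e = WAdd e (WConst 1)"

definition Left :: wexp where "Left = WSub (Reg 0) (Digit 4)"

text \<open>The disjunction in \<open>hit\<close> is written as a negated conjunction. Where
  \<open>hit\<close> refers to \<open>coverable\<close>, the program reads table entries.\<close>

definition table_test :: bexp where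
  "table_test = (let i = Left; j = Digit 3; a = Digit 2; b = Digit 1; c = Digit 0;
       T = \<lambda>x y. WEq (WLoad (Cell (Next x) y)) (WConst 1)
     in BNot (BAnd (BNot (WEq i j)) (BNot
       (BAnd (BAnd (WLess i a) (BAnd (WLess a b) (BAnd (WLess b c) (WLess c j))))
       (BAnd (WEq (WMod (WAdd (WAdd (WAdd (Colour i) (Colour a)) (Colour b)) (Colour c)) (WConst 2))
                (WConst 1))
        (BAnd (T i a) (BAnd (T a b) (BAnd (T b c) (T c j)))))))))"

definition table_body :: com where
  "table_body = Seq (Cond table_test (WStore (Cell Left (Digit 3)) (WConst 1)) Skip)
     (Assign 1 (WAdd (Reg 1) (WConst 1)))"

definition table_loop :: com where
  "table_loop = While
     (let N = WAdd (Reg 0) (WConst 1) in WLess (Reg 1) (WMul N (WMul N (WMul N (WMul N N)))))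
     table_body"

definition table_inv :: "(nat \<Rightarrow> nat) \<Rightarrow> nat \<Rightarrow> nat \<Rightarrow> mstate \<Rightarrow> bool" where
  "table_inv col n k s \<longleftrightarrow> regs s 0 = n \<and> regs s 1 = k \<and> (\<forall>x<n. wmem s (2 * n + x) = col x) \<and>
     (\<forall>i\<le>n. \<forall>j\<le>n. wmem s (3 * n + i * Suc n + j) = (if \<exists>t<k. hit col n t i j then 1 else 0))"

lemma pair_code_inj:
  assumes "i * Suc n + j = i' * Suc n + j'" "j \<le> n" "j' \<le> n"
  shows "i = i' \<and> j = j'"
proof -
  have "(x * N + y) div N = x" if "y < N" for x y N :: nat using that by simp
  from this[of j "Suc n" i] this[of j' "Suc n" i'] show ?thesis using assms by auto
qed

lemma table_loop_correct:
  assumes init: "table_inv col n 0 s" and M: "3 * n + Suc n * Suc n \<le> M" and W: "Suc n ^ 5 < W"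
  shows "halts_within (Suc (Suc n ^ 5 * 5)) M W table_loop s (table_inv col n (Suc n ^ 5))"
proof -
  let ?N = "WAdd (Reg 0) (WConst 1)"
  have guard: "bval (WLess (Reg 1) (WMul ?N (WMul ?N (WMul ?N (WMul ?N ?N))))) s \<longleftrightarrow> k < Suc n ^ 5"
    if "table_inv col n k s" for k s
    using that by (simp add: table_inv_def numeral_eq_Suc)
  have "halts_within (Suc (Suc n ^ 5 * Suc 4)) M W table_loop s (table_inv col n (Suc n ^ 5))"
    unfolding table_loop_def Let_def
  proof (rule halts_within_While[where I = "table_inv col n"])
    fix k s assume I: "table_inv col n k s" and k: "k < Suc n ^ 5"
    define i j a b c where "i = n - digit (Suc n) 4 k" "j = digit (Suc n) 3 k"
      "a = digit (Suc n) 2 k" "b = digit (Suc n) 1 k" "c = digit (Suc n) 0 k"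
    note d = this
    have le: "i \<le> n" "j \<le> n" "a \<le> n" "b \<le> n" "c \<le> n" by (auto simp: d digit_less)
    have r: "regs s 0 = n" "regs s 1 = k" "regs s (Suc 0) = k" using I by (auto simp: table_inv_def)
    have v: "wval Left s = i" "wval (Digit 3) s = j" "wval (Digit 2) s = a" "wval (Digit 1) s = b"
      "wval (Digit 0) s = c"
      by (simp_all add: Left_def wval_Digit r d)
    have v': "wval (Digit (Suc 0)) s = b" using v(4) by simp
    have col: "wmem s (2 * n + x) = col x" if "x < n" for x
      using I that by (simp add: table_inv_def)
    \<comment> \<open>All gaps have left ends above i, so every step that can hit them precedes k
      and their entries are already final.\<close>
    have tab: "wmem s (3 * n + Suc x * Suc n + y) = 1 \<longleftrightarrow> coverable col (Suc x) y"
      if xy: "i \<le> x" "x < n" "y \<le> n" for x y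
    proof -
      have "(\<exists>t<k. hit col n t (Suc x) y) \<longleftrightarrow> coverable col (Suc x) y"
      proof
        assume "coverable col (Suc x) y"
        then obtain t where t: "t < Suc n ^ 5" "hit col n t (Suc x) y"
          using coverable_imp_hit[of col "Suc x" y n] xy by auto
        then have "t < k" using hit_before[OF t(2) _ t(1) k] xy(1) by (simp add: d)
        then show "\<exists>t<k. hit col n t (Suc x) y" using t by blast
      qed (use hit_imp_coverable in blast)
      moreover have "wmem s (3 * n + Suc x * Suc n + y) = (if \<exists>t<k. hit col n t (Suc x) y then 1 else 0)"
        using I xy unfolding table_inv_def by (metis Suc_leI)
      ultimately show ?thesis by simp
    qed
    have test: "bval table_test s \<longleftrightarrow> hit col n k i j"
    proof (cases "i < a \<and> a < b \<and> b < c \<and> c < j")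
      case True
      then have lt: "i < n" "a < n" "b < n" "c < n" "i \<le> a" "i \<le> b" "i \<le> c" using le by auto
      have "hit col n k i j \<longleftrightarrow> (col i + col a + col b + col c) mod 2 = 1 \<and>
         coverable col (Suc i) a \<and> coverable col (Suc a) b \<and>
         coverable col (Suc b) c \<and> coverable col (Suc c) j"
        using True unfolding hit_def Let_def d[symmetric] odd_iff_mod_2_eq_one by auto
      moreover have "bval table_test s \<longleftrightarrow>
         (wmem s (2 * n + i) + wmem s (2 * n + a) + wmem s (2 * n + b) + wmem s (2 * n + c)) mod 2 = 1 \<and>
         wmem s (3 * n + Suc i * Suc n + a) = 1 \<and> wmem s (3 * n + Suc a * Suc n + b) = 1 \<and>
         wmem s (3 * n + Suc b * Suc n + c) = 1 \<and> wmem s (3 * n + Suc c * Suc n + j) = 1"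
        using True by (auto simp: table_test_def Let_def v v' Cell_def Colour_def Next_def r)
      ultimately show ?thesis using le lt by (simp only: col tab order_refl)
    next
      case False
      then show ?thesis
        unfolding hit_def Let_def d[symmetric] by (auto simp: table_test_def Let_def v v')
    qed
    have addr: "3 * n + i * Suc n + j < M"
    proof -
      have "i * Suc n \<le> n * Suc n" using le by (intro mult_right_mono) auto
      then show ?thesis using M le by simp
    qed
    \<comment> \<open>Step k can hit only the interval given by its own digits.\<close>
    have ex: "(\<exists>t<Suc k. hit col n t x y) \<longleftrightarrow> (\<exists>t<k. hit col n t x y) \<or> (hit col n k i j \<and> x = i \<and> y = j)" for x y
    proof -
      have "hit col n k x y \<longleftrightarrow> hit col n k i j \<and> x = i \<and> y = j"
        by (auto simp: hit_def Let_def d)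
      then show ?thesis by (auto simp: less_Suc_eq)
    qed
    have old: "table_inv col n (Suc k) (s\<lparr>regs := (regs s)(1 := Suc k)\<rparr>)" if "\<not> hit col n k i j"
      using I that by (simp add: table_inv_def ex)
    have new: "table_inv col n (Suc k) (s\<lparr>wmem := (wmem s)(3 * n + i * Suc n + j := 1),
        regs := (regs s)(1 := Suc k)\<rparr>)" if h: "hit col n k i j"
    proof -
      have "3 * n + x * Suc n + y = 3 * n + i * Suc n + j \<longleftrightarrow> x = i \<and> y = j" if "x \<le> n" "y \<le> n" for x y
        using pair_code_inj[of x n y i j] that le by auto
      then show ?thesis using I h by (auto simp add: table_inv_def ex simp del: mult_Suc_right)
    qed
    have "wp M W table_body (table_inv col n (Suc k)) s"
      using old new test r addr k W
      by (auto simp: table_body_def Cell_def v simp del: mult_Suc_right)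
    then show "bval (WLess (Reg 1) (WMul ?N (WMul ?N (WMul ?N (WMul ?N ?N))))) s \<and>
        halts_within 4 M W table_body s (table_inv col n (Suc k))"
      using guard[OF I] k by (auto intro!: halts_within_wp simp: table_body_def simp del: bval.simps)
  qed (use guard init in auto)
  then show ?thesis by simp
qed

definition decide :: com where
  "decide = Seq rank_loop (Seq (Assign 1 (WConst 0)) (Seq perm_loop (Seq (Assign 1 (WConst 0))
     (Seq table_loop (Assign 0 (WLoad (Cell (WConst 0) (Reg 0))))))))"

lemma decide_correct:
  assumes fin: "finite R" "finite B" and disj: "R \<inter> B = {}" and cp: "convex_position (R \<union> B)"
    and ps: "distinct ps" "set ps = R \<union> B" and n: "n = card (R \<union> B)"
  shows "halts_within (20 * (n + 1) ^ 5) (4 * (n + 1) ^ 2) (2 * (n + 1) ^ 5) decide (input B ps)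
    (\<lambda>s. regs s 0 = (if \<exists>P. K13_covering R B (R \<union> B) P then 1 else 0))"
proof -
  have len: "length ps = n" using ps n by (metis distinct_card)
  \<comment> \<open>The listing \<open>ps\<close> is arbitrary; \<open>qs\<close> is the hull order
    from the same first point, whose positions the ranks compute.\<close>
  obtain qs where qs: "distinct qs" "set qs = R \<union> B" "ccw_order qs" "qs ! 0 = ps ! 0"
  proof (cases "R \<union> B = {}")
    case True
    then show ?thesis using that[of ps] ps by (simp add: ccw_order_def)
  next
    case False
    then have "ps ! 0 \<in> R \<union> B" using ps(2) by (metis length_greater_0_conv nth_mem set_empty)
    then show ?thesis using exists_ccw_order_from[OF _ cp, of "ps ! 0"] fin that by blast
  qed
  interpret convex_polygon R B qs by unfold_locales (use disj qs in auto)
  have lenq: "length qs = n" using qs n by (metis distinct_card)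
  define pcol where "pcol = wmem (input B ps)"
  note nr = nth_rank[OF ps(1) qs(1) _ qs(3,4)]
  have rk: "rank ps x < n" "qs ! rank ps x = ps ! x" if "x < n" for x
    using nr[of x] that qs(2) ps(2) len by auto
  have inj: "inj_on (rank ps) {..<n}"
    by (rule inj_onI) (metis lessThan_iff len nth_eq_iff_index_eq ps(1) rk(2))
  have surj: "rank ps ` {..<n} = {..<n}"
    using inj rk(1) by (intro endo_inj_surj) auto
  have col: "col (rank ps x) = pcol x" if "x < n" for x
    using rk[OF that] that by (simp add: col_def pcol_def input_def len lenq)
  let ?M = "4 * (n + 1) ^ 2" and ?W = "2 * (n + 1) ^ 5"
  have p5: "n * n < (n + 1) ^ 5" "1 \<le> (n + 1) ^ 5" "n < (n + 1) ^ 5"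
  proof -
    have "n * n < (n + 1) ^ 2" by (simp add: power2_eq_square)
    also have "\<dots> \<le> (n + 1) ^ 5" by (intro power_increasing) auto
    finally show "n * n < (n + 1) ^ 5" .
    have "n < (n + 1) ^ 1" by simp
    also have "\<dots> \<le> (n + 1) ^ 5" by (intro power_increasing) auto
    finally show "n < (n + 1) ^ 5" .
  qed simp
  have "halts_within (Suc (n * n * 5) + (1 + (Suc (n * 3) + (1 + (Suc (Suc n ^ 5 * 5) + 1))))) ?M ?W decide (input B ps)
    (\<lambda>s. regs s 0 = (if \<exists>P. K13_covering R B (R \<union> B) P then 1 else 0))"
    unfolding decide_def
  proof (rule halts_within_Seq)
    show "halts_within (Suc (n * n * 5)) ?M ?W rank_loop (input B ps) (rank_inv B ps (n * n))"
      using p5 by (intro rank_loop_correct) (auto simp: len power2_eq_square)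
  next
    fix s assume I: "rank_inv B ps (n * n) s"
    let ?s = "s\<lparr>regs := (regs s)(1 := 0)\<rparr>"
    show "halts_within (1 + (Suc (n * 3) + (1 + (Suc (Suc n ^ 5 * 5) + 1)))) ?M ?W
      (Seq (Assign 1 (WConst 0)) (Seq perm_loop (Seq (Assign 1 (WConst 0))
        (Seq table_loop (Assign 0 (WLoad (Cell (WConst 0) (Reg 0)))))))) s
      (\<lambda>s. regs s 0 = (if \<exists>P. K13_covering R B (R \<union> B) P then 1 else 0))"
    proof (rule halts_within_Seq)
      show "halts_within 1 ?M ?W (Assign 1 (WConst 0)) s (perm_inv pcol (rank ps) n 0)"
        using I rank_inv_final[of B ps s] p5
        by (intro halts_within_wp) (auto simp: rank_inv_def perm_inv_def Let_def len pcol_def)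
    next
      fix s assume I: "perm_inv pcol (rank ps) n 0 s"
      show "halts_within (Suc (n * 3) + (1 + (Suc (Suc n ^ 5 * 5) + 1))) ?M ?W
        (Seq perm_loop (Seq (Assign 1 (WConst 0))
          (Seq table_loop (Assign 0 (WLoad (Cell (WConst 0) (Reg 0))))))) s
        (\<lambda>s. regs s 0 = (if \<exists>P. K13_covering R B (R \<union> B) P then 1 else 0))"
      proof (rule halts_within_Seq)
        show "halts_within (Suc (n * 3)) ?M ?W perm_loop s (perm_inv pcol (rank ps) n n)"
          using I p5 rk(1) inj
          by (intro perm_loop_correct) (auto simp: power2_eq_square pcol_def input_def)
      next
        fix s assume I: "perm_inv pcol (rank ps) n n s"
        have c: "wmem s (2 * n + x) = col x" if x: "x < n" for x
        proof -
          obtain y where "y < n" "x = rank ps y" using surj x by (metis imageE lessThan_iff)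
          then show ?thesis using I col by (simp add: perm_inv_def)
        qed
        show "halts_within (1 + (Suc (Suc n ^ 5 * 5) + 1)) ?M ?W
          (Seq (Assign 1 (WConst 0)) (Seq table_loop (Assign 0 (WLoad (Cell (WConst 0) (Reg 0)))))) s
          (\<lambda>s. regs s 0 = (if \<exists>P. K13_covering R B (R \<union> B) P then 1 else 0))"
        proof (rule halts_within_Seq)
          show "halts_within 1 ?M ?W (Assign 1 (WConst 0)) s (table_inv col n 0)"
            using I c p5 by (intro halts_within_wp) (auto simp: perm_inv_def table_inv_def)
        next
          fix s assume I: "table_inv col n 0 s"
          show "halts_within (Suc (Suc n ^ 5 * 5) + 1) ?M ?W
            (Seq table_loop (Assign 0 (WLoad (Cell (WConst 0) (Reg 0))))) s
            (\<lambda>s. regs s 0 = (if \<exists>P. K13_covering R B (R \<union> B) P then 1 else 0))"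
          proof (rule halts_within_Seq)
            show "halts_within (Suc (Suc n ^ 5 * 5)) ?M ?W table_loop s (table_inv col n (Suc n ^ 5))"
              using I p5 by (intro table_loop_correct) (auto simp: power2_eq_square)
          next
            fix s assume I: "table_inv col n (Suc n ^ 5) s"
            have "(\<exists>t<Suc n ^ 5. hit col n t 0 n) \<longleftrightarrow> coverable col 0 n"
              using coverable_imp_hit hit_imp_coverable by blast
            also have "\<dots> \<longleftrightarrow> (\<exists>P. K13_covering R B (R \<union> B) P)"
              using coverable_iff[of 0 n col] ex_covering_iff
              by (simp add: noncrossing_stars_def lenq atLeast0LessThan)
            finally have "wmem s (3 * n + 0 * Suc n + n) = (if \<exists>P. K13_covering R B (R \<union> B) P then 1 else 0)"
              using I unfolding table_inv_def by (metis le_refl zero_le)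
            moreover have "regs s 0 = n" using I by (simp add: table_inv_def)
            ultimately show "halts_within 1 ?M ?W (Assign 0 (WLoad (Cell (WConst 0) (Reg 0)))) s
              (\<lambda>s. regs s 0 = (if \<exists>P. K13_covering R B (R \<union> B) P then 1 else 0))"
              using p5 by (intro halts_within_wp) (auto simp: Cell_def)
          qed
        qed
      qed
    qed
  qed
  then show ?thesis
    by (rule halts_within_mono) (use p5 in auto)
qed

section \<open>Covering all but four points in linear time\<close>

lemma sum_lessThan_mult4: "sum f {..<4 * m} = (\<Sum>q<m. f (4 * q) + f (4 * q + 1) + f (4 * q + 2) + f (4 * q + 3))"
  for f :: "nat \<Rightarrow> nat"
proof (induction m)
  case (Suc m)
  have eq: "4 * Suc m = Suc (Suc (Suc (Suc (4 * m))))" by simp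
  have "sum f {..<4 * Suc m} = sum f {..<4 * m} + (f (4 * m) + f (4 * m + 1) + f (4 * m + 2) + f (4 * m + 3))"
    unfolding eq sum.lessThan_Suc by (simp add: eval_nat_numeral)
  then show ?case using Suc by simp
qed simp

text \<open>A sequence of naturals moving by at most 1 per step cannot jump over a value that it
  avoids.\<close>

lemma discrete_ivt:
  fixes s :: "nat \<Rightarrow> nat"
  assumes step: "\<And>p. Suc p \<le> l \<Longrightarrow> s (Suc p) \<le> Suc (s p) \<and> s p \<le> Suc (s (Suc p))"
    and avoid: "\<And>p. p \<le> l \<Longrightarrow> s p \<noteq> v"
  shows "(\<forall>p\<le>l. s p < v) \<or> (\<forall>p\<le>l. v < s p)"
proof -
  have "(s p < v) = (s 0 < v)" if "p \<le> l" for p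
    using that
  proof (induction p)
    case (Suc p)
    then show ?case using step[of p] avoid[of p] avoid[of "Suc p"] by auto
  qed simp
  then show ?thesis using avoid by (metis linorder_neqE_nat)
qed

definition window :: "(nat \<Rightarrow> nat) \<Rightarrow> nat \<Rightarrow> nat" where
  "window f p = f p + f (p + 1) + f (p + 2) + f (p + 3)"

text \<open>A word of length \<open>4 * (g + h)\<close> is cut into \<open>g + h\<close> windows, whose average content lies between
  1 and 3; contents of neighbouring windows differ by at most 1.\<close>

lemma irreducible_word:
  fixes f :: "nat \<Rightarrow> nat"
  assumes f: "\<And>p. f p \<le> 1" and sum: "sum f {..<4 * (g + h)} = 3 * h + g"
    and irr: "\<And>p. p + 4 \<le> 4 * (g + h) \<Longrightarrow> (window f p = 1 \<longrightarrow> g = 0) \<and> (window f p = 3 \<longrightarrow> h = 0)"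
    and pos: "0 < g + h"
  shows "g = h \<and> (\<forall>p. p + 4 \<le> 4 * (g + h) \<longrightarrow> window f p = 2)"
proof -
  define l where "l = 4 * (g + h) - 4"
  have step: "window f (Suc p) \<le> Suc (window f p) \<and> window f p \<le> Suc (window f (Suc p))" for p
    using f[of p] f[of "p + 4"] by (simp add: window_def eval_nat_numeral)
  \<comment> \<open>The windows at multiples of 4 tile the word, so a bound on all windows bounds
    its total content.\<close>
  have tot: "(\<Sum>q<g + h. window f (4 * q)) = 3 * h + g"
    using sum by (simp only: sum_lessThan_mult4 window_def)
  have ub: "3 * h + g \<le> (g + h) * v" if "\<forall>p\<le>l. window f p \<le> v" for v
    using sum_bounded_above[of "{..<g + h}" "\<lambda>q. window f (4 * q)" v] that tot
    by (auto simp: l_def)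
  have lb: "(g + h) * v \<le> 3 * h + g" if "\<forall>p\<le>l. v \<le> window f p" for v
    using sum_bounded_below[of "{..<g + h}" v "\<lambda>q. window f (4 * q)"] that tot
    by (auto simp: l_def)
  have avoid1: "(\<forall>p\<le>l. window f p < 1) \<or> (\<forall>p\<le>l. 1 < window f p)" if "g \<noteq> 0"
    using that irr pos by (intro discrete_ivt step) (fastforce simp: l_def)
  have avoid3: "(\<forall>p\<le>l. window f p < 3) \<or> (\<forall>p\<le>l. 3 < window f p)" if "h \<noteq> 0"
    using that irr pos by (intro discrete_ivt step) (fastforce simp: l_def)
  have no0: "\<not> (\<forall>p\<le>l. window f p < 1)"
  proof
    assume "\<forall>p\<le>l. window f p < 1"
    then have "3 * h + g \<le> (g + h) * 0" by (intro ub) auto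
    then show False using pos by simp
  qed
  have no4: "\<not> (\<forall>p\<le>l. 3 < window f p)"
  proof
    assume "\<forall>p\<le>l. 3 < window f p"
    then have "(g + h) * 4 \<le> 3 * h + g" by (intro lb) (auto simp: Suc_le_eq eval_nat_numeral)
    then show False using pos by simp
  qed
  \<comment> \<open>With g = 0 the average is 3, which is out of reach for windows that all stay
    below 3; that all exceed 3 is excluded by \<open>no4\<close>.\<close>
  have g0: "g \<noteq> 0"
  proof
    assume "g = 0"
    then have "\<forall>p\<le>l. window f p < 3" using avoid3 no4 pos by auto
    then have "3 * h + g \<le> (g + h) * 2" by (intro ub) (auto simp: less_Suc_eq_le eval_nat_numeral)
    then show False using \<open>g = 0\<close> pos by simp
  qed
  have h0: "h \<noteq> 0"
  proof
    assume "h = 0"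
    then have "\<forall>p\<le>l. 1 < window f p" using avoid1 no0 pos by auto
    then have "(g + h) * 2 \<le> 3 * h + g" by (intro lb) auto
    then show False using \<open>h = 0\<close> pos by simp
  qed
  have "window f p = 2" if "p \<le> l" for p
    using avoid1[OF g0] avoid3[OF h0] no0 no4 that by fastforce
  then have two: "\<forall>p\<le>l. window f p = 2" by blast
  have "3 * h + g \<le> (g + h) * 2" using two by (intro ub) simp
  moreover have "(g + h) * 2 \<le> 3 * h + g" using two by (intro lb) simp
  ultimately show ?thesis using two by (auto simp: l_def)
qed

section \<open>The table of stars\<close>

definition block :: "nat \<Rightarrow> (nat \<Rightarrow> nat) \<Rightarrow> nat \<Rightarrow> nat set" where
  "block n w j = (\<lambda>i. w (2 * n + 4 * j + i)) ` {..<4}"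

definition centered :: "nat \<Rightarrow> (nat \<Rightarrow> nat) \<Rightarrow> (nat \<Rightarrow> nat) \<Rightarrow> nat \<Rightarrow> bool" where
  "centered n col w j \<longleftrightarrow>
     (\<forall>x\<in>block n w j - {w (2 * n + 4 * j)}. col x \<noteq> col (w (2 * n + 4 * j)))"

text \<open>\<open>Y\<close> is the set of the points that are still available for further stars.\<close>

definition stars_inv :: "nat \<Rightarrow> (nat \<Rightarrow> nat) \<Rightarrow> (nat \<Rightarrow> nat) \<Rightarrow> nat \<Rightarrow> nat set \<Rightarrow> bool" where
  "stars_inv n col w m Y \<longleftrightarrow>
     (\<forall>j<m. block n w j \<subseteq> {..<n} \<and> card (block n w j) = 4 \<and> centered n col w j \<and>
        disjnt (block n w j) Y \<and> crossfree (block n w j) Y) \<and>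
     (\<forall>j<m. \<forall>j'<m. j \<noteq> j' \<longrightarrow>
        disjnt (block n w j) (block n w j') \<and> crossfree (block n w j) (block n w j'))"

lemma stars_inv_mono:
  assumes "stars_inv n col w m Y" "Y' \<subseteq> Y" "\<And>a. 2 * n \<le> a \<Longrightarrow> a < 2 * n + 4 * m \<Longrightarrow> w' a = w a"
  shows "stars_inv n col w' m Y'"
proof -
  have eq: "block n w' j = block n w j" "w' (2 * n + 4 * j) = w (2 * n + 4 * j)" if "j < m" for j
    using that assms(3) by (auto simp: block_def intro!: image_cong)
  show ?thesis
    using assms(1,2) unfolding stars_inv_def centered_def
    by (auto simp: eq intro: crossfree_mono disjnt_subset2)
qed

text \<open>Earlier stars cross nothing that is still available; hence they do not cross a new star
  taken from the available points.\<close>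

lemma stars_inv_extend:
  assumes inv: "stars_inv n col w m Y" and Y: "Y \<subseteq> {..<n}" and Q: "Q \<subseteq> Y" "card Q = 4"
    and Y': "Y' \<subseteq> Y - Q" and cf: "crossfree Q Y'"
    and w': "\<And>a. 2 * n \<le> a \<Longrightarrow> a < 2 * n + 4 * m \<Longrightarrow> w' a = w a"
    and new: "block n w' m = Q" "centered n col w' m"
  shows "stars_inv n col w' (Suc m) Y'"
proof -
  have 1: "stars_inv n col w' m Y" using inv w' by (intro stars_inv_mono[OF inv]) auto
  have 2: "disjnt (block n w' j) Y' \<and> crossfree (block n w' j) Y' \<and>
      disjnt (block n w' j) Q \<and> crossfree (block n w' j) Q" if "j < m" for j
    using 1 that Y' Q unfolding stars_inv_def
    by (meson Diff_subset crossfree_mono disjnt_subset2 order.trans order_refl)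
  have 3: "disjnt Q Y'" using Y' by (auto simp: disjnt_def)
  show ?thesis
    unfolding stars_inv_def less_Suc_eq
    using 1 2 3 new Q Y cf unfolding stars_inv_def
    by (auto simp: crossfree_sym disjnt_sym)
qed

definition Cell_colour :: "nat \<Rightarrow> wexp" where "Cell_colour r = WLoad (Reg r)"

text \<open>Word memory of the linear-time program: colours in the first \<open>n\<close> cells, the stack of unmatched
  points in the next \<open>n\<close> cells, and the stars from cell \<open>2 * n\<close> on. Register 2 holds the height of the
  stack, register 3 the number of stars, and registers 4 and 5 the numbers \<open>g\<close> and \<open>h\<close> of stars with
  red and blue majority that the unmatched points still have room for.\<close>

definition Base :: "nat \<Rightarrow> wexp" where
  "Base i = WAdd (WAdd (WMul (WConst 2) (Reg 0)) (WMul (WConst 4) (Reg 3))) (WConst i)"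

definition Blue_pos :: wexp where
  "Blue_pos = WAdd (Cell_colour 7)
     (WAdd (WMul (WConst 2) (Cell_colour 8)) (WMul (WConst 3) (Cell_colour 9)))"

text \<open>Register 10 holds the number of blue points among the registers 6, 7, 8, 9, and register 11
  receives the position of the center among them: the unique blue position, or 0 + 1 + 2 + 3 minus the sum
  of the three blue positions.\<close>

definition emit :: com where
  "emit =
     Seq (Cond (WEq (Reg 10) (WConst 1)) (Assign 11 Blue_pos) (Assign 11 (WSub (WConst 6) Blue_pos)))
     (Seq (WStore (Base 0) (Reg 6)) (Seq (WStore (Base 1) (Reg 7))
     (Seq (WStore (Base 2) (Reg 8)) (Seq (WStore (Base 3) (Reg 9))
     (Seq (WStore (Base 0) (WLoad (WAdd (Base 0) (Reg 11))))
     (Seq (WStore (WAdd (Base 0) (Reg 11)) (Reg 6))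
          (Assign 3 (WAdd (Reg 3) (WConst 1)))))))))"

lemma lessThan_4: "{..<4::nat} = {0, 1, 2, 3}" by auto

text \<open>A caller learns only that the cells below the new block are kept and that the block
  consists of the four points with a center first. The exact memory and the value in register 11
  stay abstract.\<close>

lemma wp_emit:
  assumes r: "regs s 0 = n" "regs s 3 = m" "regs s 6 = q0" "regs s 7 = q1" "regs s 8 = q2" "regs s 9 = q3"
      "regs s 10 = col q0 + col q1 + col q2 + col q3"
    and col: "\<And>x. x < n \<Longrightarrow> wmem s x = col x" "\<And>x. col x \<le> 1"
    and q: "q0 < n" "q1 < n" "q2 < n" "q3 < n" "card {q0, q1, q2, q3} = 4"
    and odd: "odd (col q0 + col q1 + col q2 + col q3)"
    and M: "2 * n + 4 * m + 4 \<le> M" and W: "n < W" "m + 1 < W" "6 < W"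
    and Q: "\<And>w v. (\<And>a. a < 2 * n + 4 * m \<Longrightarrow> w a = wmem s a) \<Longrightarrow> block n w m = {q0, q1, q2, q3} \<Longrightarrow>
      centered n col w m \<Longrightarrow> P (s\<lparr>wmem := w, regs := (regs s)(11 := v, 3 := Suc m)\<rparr>)"
  shows "wp M W emit P s"
proof -
  have c: "wmem s q0 = col q0" "wmem s q1 = col q1" "wmem s q2 = col q2" "wmem s q3 = col q3"
    using col q by auto
  have z: "col x = 0 \<or> col x = 1" for x using col(2)[of x] by linarith
  define b where "b = 2 * n + 4 * m"
  let ?w = "(wmem s)(b := q0, b + 1 := q1, b + 2 := q2, b + 3 := q3)"
  define S where "S = col q0 + col q1 + col q2 + col q3"
  define p where "p = col q1 + (2 * col q2 + 3 * col q3)"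
  define v where "v = (if S = 1 then p else 6 - p)"
  \<comment> \<open>Case analysis over the odd colourings: v is the position of the point that is
    alone in its colour.\<close>
  have "\<exists>z0. (v, z0) \<in> {(0, q0), (1, q1), (2, q2), (3, q3)} \<and>
      (\<forall>x\<in>{q0, q1, q2, q3} - {z0}. col x \<noteq> col z0)"
    using z[of q0] z[of q1] z[of q2] z[of q3] odd
    by (elim disjE) (auto simp: v_def S_def p_def)
  then obtain z0 where z0: "(v, z0) \<in> {(0, q0), (1, q1), (2, q2), (3, q3)}"
    "\<And>x. x \<in> {q0, q1, q2, q3} - {z0} \<Longrightarrow> col x \<noteq> col z0" by blast
  \<comment> \<open>The last two writes swap the center to the front; for v = 0 they both rewrite
    \<open>q0\<close>.\<close>
  let ?w' = "?w(b := z0, b + v := q0)"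
  have vz: "v = 0 \<and> z0 = q0 \<or> v = 1 \<and> z0 = q1 \<or> v = 2 \<and> z0 = q2 \<or> v = 3 \<and> z0 = q3"
    using z0(1) by auto
  have P: "P (s\<lparr>wmem := ?w', regs := (regs s)(11 := v, 3 := Suc m)\<rparr>)"
  proof (rule Q)
    have "(\<lambda>i. ?w' (b + i)) ` {..<4} = {q0, q1, q2, q3}"
      using vz unfolding lessThan_4 by (elim disjE) (simp_all, blast+)
    then show blk: "block n ?w' m = {q0, q1, q2, q3}" unfolding block_def b_def .
    have "?w' b = z0" using vz by auto
    then show "centered n col ?w' m" unfolding centered_def blk b_def[symmetric] using z0(2) by metis
    show "?w' a = wmem s a" if "a < 2 * n + 4 * m" for a
      using that by (simp add: b_def)
  qed
  have w: "?w (b + v) = z0" "v < 4" "z0 < n" using vz q by auto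
  have lt: "b < M" "b + 1 < M" "b + 2 < M" "b + 3 < M" "b + v < M" using M w(2) by (auto simp: b_def)
  define t where "t = s\<lparr>regs := (regs s)(11 := v)\<rparr>"
  have t: "regs t 0 = n" "regs t 3 = m" "regs t 6 = q0" "regs t 7 = q1" "regs t 8 = q2" "regs t 9 = q3"
    "regs t 11 = v"
    using r by (simp_all add: t_def)
  have regs_upd: "regs (t\<lparr>wmem := x\<rparr>) = regs t" and wmem_upd: "wmem (t\<lparr>wmem := x\<rparr>) = x" for x
    by simp_all
  have Base: "wval (Base i) (t\<lparr>wmem := x\<rparr>) = b + i" for i x
    using t by (simp add: Base_def b_def)
  have qW: "q0 < W" "q1 < W" "q2 < W" "q3 < W" "z0 < W" using q w(3) W(1) by auto
  have store: "wp M W (Seq (WStore a e) c) P (t\<lparr>wmem := x\<rparr>)"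
    if "wval a (t\<lparr>wmem := x\<rparr>) = k" "wval e (t\<lparr>wmem := x\<rparr>) = y" "k < M" "y < W"
      "wp M W c P (t\<lparr>wmem := x(k := y)\<rparr>)" for a e c x k y
    using that by simp
  let ?c7 = "Assign 3 (WAdd (Reg 3) (WConst 1))"
  let ?c6 = "Seq (WStore (WAdd (Base 0) (Reg 11)) (Reg 6)) ?c7"
  let ?c5 = "Seq (WStore (Base 0) (WLoad (WAdd (Base 0) (Reg 11)))) ?c6"
  let ?c4 = "Seq (WStore (Base 3) (Reg 9)) ?c5"
  let ?c3 = "Seq (WStore (Base 2) (Reg 8)) ?c4"
  let ?c2 = "Seq (WStore (Base 1) (Reg 7)) ?c3"
  let ?c1 = "Seq (WStore (Base 0) (Reg 6)) ?c2"
  have "wp M W ?c7 P (t\<lparr>wmem := ?w'\<rparr>)"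
    using P W(2) r(2) by (simp add: t_def)
  then have "wp M W ?c6 P (t\<lparr>wmem := ?w(b := z0)\<rparr>)"
    by - (rule store[OF _ _ lt(5) qW(1)], simp_all only: wval.simps Base t regs_upd)
  then have "wp M W ?c5 P (t\<lparr>wmem := ?w\<rparr>)"
    by - (rule store[OF _ _ lt(1) qW(5)], simp_all only: wval.simps Base t regs_upd wmem_upd add_0_right w(1))
  then have "wp M W ?c4 P (t\<lparr>wmem := (wmem s)(b := q0, b + 1 := q1, b + 2 := q2)\<rparr>)"
    by - (rule store[OF _ _ lt(4) qW(4)], simp_all only: wval.simps Base t regs_upd)
  then have "wp M W ?c3 P (t\<lparr>wmem := (wmem s)(b := q0, b + 1 := q1)\<rparr>)"
    by - (rule store[OF _ _ lt(3) qW(3)], simp_all only: wval.simps Base t regs_upd)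
  then have "wp M W ?c2 P (t\<lparr>wmem := (wmem s)(b := q0)\<rparr>)"
    by - (rule store[OF _ _ lt(2) qW(2)], simp_all only: wval.simps Base t regs_upd)
  then have "wp M W ?c1 P (t\<lparr>wmem := wmem s\<rparr>)"
    by - (rule store[OF _ _ lt(1) qW(1)], simp_all only: wval.simps Base t regs_upd add_0_right)
  moreover have "t\<lparr>wmem := wmem s\<rparr> = t" by (simp add: t_def)
  ultimately have c1: "wp M W ?c1 P t" by (simp only:)
  have S: "regs s 10 = S" using r(7) by (simp add: S_def)
  have pos: "wval Blue_pos s = p" using r c by (simp add: Blue_pos_def Cell_colour_def p_def)
  have "p \<le> 6" using col(2)[of q1] col(2)[of q2] col(2)[of q3] by (simp add: p_def)
  then have "p < W" "6 - p < W" using W by auto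
  then have "wp M W (Cond (WEq (Reg 10) (WConst 1)) (Assign 11 Blue_pos)
      (Assign 11 (WSub (WConst 6) Blue_pos))) P' s" if "P' t" for P'
    using that S pos by (simp add: t_def v_def split: if_splits)
  from this[of "wp M W ?c1 P", OF c1] show ?thesis unfolding emit_def wp.simps(5)[of M W "Cond _ _ _"] .
qed

section \<open>Scanning with a stack\<close>

definition irreducible_stack :: "(nat \<Rightarrow> nat) \<Rightarrow> nat list \<Rightarrow> nat \<Rightarrow> nat \<Rightarrow> bool" where
  "irreducible_stack col st g h \<longleftrightarrow> (\<forall>p. p + 4 \<le> length st \<longrightarrow>
     (window (\<lambda>i. col (st ! i)) p = 1 \<longrightarrow> g = 0) \<and> (window (\<lambda>i. col (st ! i)) p = 3 \<longrightarrow> h = 0))"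

text \<open>The available points are those on the stack and those not yet read. Registers 4 and 5
  always fit their number and their blue count, so the final stack is a word to which
  \<open>irreducible_word\<close> applies.\<close>

definition stack_inv :: "nat \<Rightarrow> (nat \<Rightarrow> nat) \<Rightarrow> nat list \<Rightarrow> nat \<Rightarrow> mstate \<Rightarrow> bool" where
  "stack_inv n col st k s \<longleftrightarrow>
     k \<le> n \<and> regs s 0 = n \<and> regs s 2 = length st \<and>
     (\<forall>x<n. wmem s x = col x) \<and> (\<forall>p<length st. wmem s (n + p) = st ! p) \<and>
     sorted_wrt (<) st \<and> set st \<subseteq> {..<k} \<and> 4 * regs s 3 + length st = k \<and>
     sum col (set st \<union> {k..<n}) = 3 * regs s 5 + regs s 4 \<and>
     length st + (n - k) = 4 * (regs s 4 + regs s 5) \<and>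
     stars_inv n col (wmem s) (regs s 3) (set st \<union> {k..<n})"

definition push :: com where
  "push = Seq (WStore (WAdd (Reg 0) (Reg 2)) (Reg 1)) (Assign 2 (WAdd (Reg 2) (WConst 1)))"

lemma stack_inv_push:
  assumes I: "stack_inv n col st k s" and k: "k < n" and r: "regs s 1 = k"
    and M: "2 * n \<le> M" and W: "n < W"
  shows "wp M W push (\<lambda>s'. stack_inv n col (st @ [k]) (Suc k) s' \<and> regs s' 1 = k \<and>
     regs s' 4 = regs s 4 \<and> regs s' 5 = regs s 5) s"
proof -
  let ?w = "(wmem s)(n + length st := k)"
  have J: "regs s 0 = n" "regs s 2 = length st" "\<forall>x<n. wmem s x = col x"
    "\<forall>p<length st. wmem s (n + p) = st ! p" "sorted_wrt (<) st" "set st \<subseteq> {..<k}"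
    "4 * regs s 3 + length st = k" "sum col (set st \<union> {k..<n}) = 3 * regs s 5 + regs s 4"
    "length st + (n - k) = 4 * (regs s 4 + regs s 5)"
    "stars_inv n col (wmem s) (regs s 3) (set st \<union> {k..<n})"
    using I unfolding stack_inv_def by blast+
  have len: "length st \<le> k" using J(7) by simp
  have Y: "set (st @ [k]) \<union> {Suc k..<n} = set st \<union> {k..<n}" using k by auto
  have "stars_inv n col ?w (regs s 3) (set st \<union> {k..<n})"
    using len k by (intro stars_inv_mono[OF J(10)]) auto
  moreover have "sorted_wrt (<) (st @ [k])"
    using J(5,6) by (auto simp: sorted_wrt_append)
  moreover have "\<forall>p<length (st @ [k]). ?w (n + p) = (st @ [k]) ! p"
    using J(4) by (simp add: nth_append less_Suc_eq)
  moreover have "set (st @ [k]) \<subseteq> {..<Suc k}" using J(6) by (auto simp: less_Suc_eq)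
  ultimately have "stack_inv n col (st @ [k]) (Suc k) (s\<lparr>wmem := ?w, regs := (regs s)(2 := Suc (length st))\<rparr>)"
    using J(1-3,7-9) k unfolding stack_inv_def Y by simp
  then show ?thesis
    using J(1,2) r k len M W by (simp add: push_def)
qed

definition Top :: "nat \<Rightarrow> wexp" where
  "Top i = WLoad (WSub (WAdd (Reg 0) (Reg 2)) (WConst i))"

definition Count_blue :: wexp where
  "Count_blue = WAdd (WAdd (WAdd (Cell_colour 6) (Cell_colour 7)) (Cell_colour 8)) (Cell_colour 9)"

definition pop :: com where
  "pop = Cond (WLess (WConst 3) (Reg 2))
     (Seq (Assign 6 (Top 4)) (Seq (Assign 7 (Top 3)) (Seq (Assign 8 (Top 2)) (Seq (Assign 9 (Top 1))
     (Seq (Assign 10 Count_blue)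
       (Cond (BNot (BAnd (BNot (BAnd (WEq (Reg 10) (WConst 1)) (WLess (WConst 0) (Reg 4))))
                   (BNot (BAnd (WEq (Reg 10) (WConst 3)) (WLess (WConst 0) (Reg 5))))))
         (Seq emit
         (Seq (Assign 2 (WSub (Reg 2) (WConst 4)))
              (Cond (WEq (Reg 10) (WConst 1))
                 (Assign 4 (WSub (Reg 4) (WConst 1)))
                 (Assign 5 (WSub (Reg 5) (WConst 1))))))
         Skip))))))
     Skip"

lemma irreducible_stack_butlast:
  assumes "irreducible_stack col (butlast st) g h"
    and "4 \<le> length st \<Longrightarrow> (window (\<lambda>i. col (st ! i)) (length st - 4) = 1 \<longrightarrow> g = 0) \<and>
           (window (\<lambda>i. col (st ! i)) (length st - 4) = 3 \<longrightarrow> h = 0)"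
  shows "irreducible_stack col st g h"
  unfolding irreducible_stack_def
proof (intro allI impI)
  fix p assume p: "p + 4 \<le> length st"
  show "(window (\<lambda>i. col (st ! i)) p = 1 \<longrightarrow> g = 0) \<and> (window (\<lambda>i. col (st ! i)) p = 3 \<longrightarrow> h = 0)"
  proof (cases "p = length st - 4")
    case True
    then show ?thesis using assms(2) p by simp
  next
    case False
    then have "p + 4 \<le> length (butlast st)" using p by simp
    moreover have "window (\<lambda>i. col (butlast st ! i)) p = window (\<lambda>i. col (st ! i)) p"
      using False p by (simp add: window_def nth_butlast)
    ultimately show ?thesis using assms(1) unfolding irreducible_stack_def by metis
  qed
qed

lemma irreducible_stack_prefix:
  assumes "irreducible_stack col (u @ v) g h" "g' \<le> g" "h' \<le> h"
  shows "irreducible_stack col u g' h'"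
  unfolding irreducible_stack_def
proof (intro allI impI)
  fix p assume p: "p + 4 \<le> length u"
  then have "window (\<lambda>i. col (u ! i)) p = window (\<lambda>i. col ((u @ v) ! i)) p"
    by (simp add: window_def nth_append)
  moreover have "p + 4 \<le> length (u @ v)" using p by simp
  ultimately show "(window (\<lambda>i. col (u ! i)) p = 1 \<longrightarrow> g' = 0) \<and> (window (\<lambda>i. col (u ! i)) p = 3 \<longrightarrow> h' = 0)"
    using assms unfolding irreducible_stack_def by (metis le_zero_eq)
qed

text \<open>After a push only the topmost window is new. If it is popped, the rest is a prefix of a
  stack that was irreducible for counters at least as large, so nothing else becomes reducible.
  Hence one pop per push suffices, which gives linear time.\<close>

lemma stack_inv_pop:
  assumes I: "stack_inv n col st k s" and irr: "irreducible_stack col (butlast st) (regs s 4) (regs s 5)"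
    and col: "\<And>x. col x \<le> 1" and M: "3 * n \<le> M" and W: "2 * n + 6 < W"
  shows "wp M W pop (\<lambda>s'. (\<exists>st'. stack_inv n col st' k s' \<and> irreducible_stack col st' (regs s' 4) (regs s' 5)) \<and>
     regs s' 1 = regs s 1) s"
proof -
  have r: "regs s 0 = n" "regs s 2 = length st" "k \<le> n" using I by (auto simp: stack_inv_def)
  show ?thesis
  proof (cases "4 \<le> length st")
    case False
    then have "irreducible_stack col st (regs s 4) (regs s 5)"
      by (intro irreducible_stack_butlast[OF irr]) auto
    then show ?thesis using False I r by (auto simp: pop_def)
  next
    case True
    define u where "u = take (length st - 4) st"
    have "\<exists>q0 q1 q2 q3. xs = [q0, q1, q2, q3]" if "length xs = 4" for xs :: "nat list"
      using that by (auto simp: numeral_eq_Suc length_Suc_conv)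
    from this[of "drop (length st - 4) st"]
    obtain q0 q1 q2 q3 where "drop (length st - 4) st = [q0, q1, q2, q3]" using True by auto
    then have st: "st = u @ [q0, q1, q2, q3]" unfolding u_def by (metis append_take_drop_id)
    let ?Q = "{q0, q1, q2, q3}" and ?m = "regs s 3"
    have sorted: "sorted_wrt (<) st" "set st \<subseteq> {..<k}" "4 * ?m + length st = k"
      and cells: "\<And>p. p < length st \<Longrightarrow> wmem s (n + p) = st ! p"
      and cc: "\<And>x. x < n \<Longrightarrow> wmem s x = col x"
      and cnt: "sum col (set st \<union> {k..<n}) = 3 * regs s 5 + regs s 4" 
         "length st + (n - k) = 4 * (regs s 4 + regs s 5)"
      and SI: "stars_inv n col (wmem s) ?m (set st \<union> {k..<n})"
      using I by (auto simp: stack_inv_def)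
    have o: "q0 < q1" "q1 < q2" "q2 < q3" "q3 < k" "\<And>x. x \<in> set u \<Longrightarrow> x < q0"
      using sorted(1,2) by (auto simp: st sorted_wrt_append)
    have lt: "q0 < n" "q1 < n" "q2 < n" "q3 < n" using o r by auto
    have top: "wmem s (n + length st - 4) = q0" "wmem s (n + length st - 3) = q1"
      "wmem s (n + length st - 2) = q2" "wmem s (n + length st - 1) = q3"
      using cells[of "length u"] cells[of "length u + 1"] cells[of "length u + 2"] cells[of "length u + 3"]
      by (simp_all add: st nth_append eval_nat_numeral)
    have win: "window (\<lambda>i. col (st ! i)) (length st - 4) = col q0 + col q1 + col q2 + col q3"
      by (simp add: window_def st nth_append eval_nat_numeral)
    define B where "B = col q0 + col q1 + col q2 + col q3"
    define s1 where "s1 = s\<lparr>regs := (regs s)(6 := q0, 7 := q1, 8 := q2, 9 := q3, 10 := B)\<rparr>"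
    have B4: "B \<le> 4" using col[of q0] col[of q1] col[of q2] col[of q3] by (simp add: B_def)
    show ?thesis
    proof (cases "B = 1 \<and> 0 < regs s 4 \<or> B = 3 \<and> 0 < regs s 5")
      case False
      then have "irreducible_stack col st (regs s 4) (regs s 5)"
        by (intro irreducible_stack_butlast[OF irr]) (auto simp: win B_def[symmetric])
      moreover have "stack_inv n col st k s1" using I unfolding stack_inv_def s1_def by simp
      ultimately show ?thesis
        using False True r top cc lt W B4
        by (auto simp: pop_def Top_def Count_blue_def Cell_colour_def s1_def B_def intro!: exI[of _ st])
    next
      case True': True
      let ?Y = "set u \<union> {k..<n}"
      define P where "P s' \<longleftrightarrow> (\<exists>st'. stack_inv n col st' k s' \<and>
         irreducible_stack col st' (regs s' 4) (regs s' 5)) \<and> regs s' 1 = regs s 1" for s'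
      have cardQ: "card ?Q = 4" using o by auto
      have sumQ: "sum col ?Q = B" using o by (simp add: B_def add.assoc)
      have Yn: "set st \<union> {k..<n} \<subseteq> {..<n}" using sorted(2) r by auto
      have "x \<notin> set u" if "q0 \<le> x" for x using o(5)[of x] that by auto
      then have split: "set st \<union> {k..<n} = ?Q \<union> ?Y" "?Q \<inter> ?Y = {}" using o(1-4) by (auto simp: st)
      have "sum col (?Q \<union> ?Y) = sum col ?Q + sum col ?Y" using split(2) by (intro sum.union_disjoint) auto
      then have sumY: "sum col ?Y + B = 3 * regs s 5 + regs s 4" using cnt(1) sumQ by (simp only: split)
      \<comment> \<open>The four topmost entries are consecutive among the available points: the
        rest of the stack lies below them, the unread points above.\<close>
      have cf: "crossfree ?Q ?Y"
      proof (rule crossfree_sym, rule crossfree_arcI)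
        fix y assume "y \<in> ?Y"
        then show "(\<forall>q\<in>?Q. y < q) \<or> (\<forall>q\<in>?Q. q < y)" using o by fastforce
      qed
      have irr_u: "irreducible_stack col u g' h'" if "g' \<le> regs s 4" "h' \<le> regs s 5" for g' h'
        using irreducible_stack_prefix[OF _ that, of col u "[q0, q1, q2]"] irr by (simp add: st butlast_append)
      let ?rest = "Seq (Assign 2 (WSub (Reg 2) (WConst 4)))
              (Cond (WEq (Reg 10) (WConst 1)) (Assign 4 (WSub (Reg 4) (WConst 1)))
                 (Assign 5 (WSub (Reg 5) (WConst 1))))"
      have post: "wp M W ?rest P
              (s1\<lparr>wmem := w, regs := (regs s1)(11 := v, 3 := Suc ?m)\<rparr>)"
        if w: "\<And>a. a < 2 * n + 4 * ?m \<Longrightarrow> w a = wmem s1 a" "block n w ?m = ?Q" "centered n col w ?m"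
        for w v
      proof -
        have SI': "stars_inv n col w (Suc ?m) ?Y"
        proof (rule stars_inv_extend[OF SI Yn])
          show "?Q \<subseteq> set st \<union> {k..<n}" using split by blast
          show "?Y \<subseteq> set st \<union> {k..<n} - ?Q" using split by blast
        qed (use cardQ cf w in \<open>auto simp: s1_def\<close>)
        \<comment> \<open>Content 1 means red majority and uses up one unit of g; content 3 uses up
          one unit of h.\<close>
        define g' h' where "g' = (if B = 1 then regs s 4 - 1 else regs s 4)"
          "h' = (if B = 1 then regs s 5 else regs s 5 - 1)"
        note gh = this
        have n': "sum col ?Y = 3 * h' + g'" "length u + (n - k) = 4 * (g' + h')"
          using sumY cnt(2) True' by (auto simp: gh st)
        define s2 where "s2 = s\<lparr>regs := (regs s)(6 := q0, 7 := q1, 8 := q2, 9 := q3, 10 := B, 11 := v,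
            3 := Suc ?m, 2 := length u, 4 := g', 5 := h'), wmem := w\<rparr>"
        have "stack_inv n col u k s2"
          using SI' n' sorted r cc cells w(1) unfolding stack_inv_def s2_def
          by (auto simp: st s1_def sorted_wrt_append nth_append)
        moreover have "irreducible_stack col u (regs s2 4) (regs s2 5)"
          by (rule irr_u) (auto simp: s2_def gh)
        moreover have "regs s2 1 = regs s 1" by (simp add: s2_def)
        ultimately have P2: "P s2" unfolding P_def by blast
        have bnd: "regs s 4 < W" "regs s 5 < W" "length st < W" using cnt(2) sorted(3) r W by auto
        have P_cong: "P s'" if "P s2" "s2 = s'" for s' using that by simp
        have 1: "P (s\<lparr>wmem := w, regs := (regs s)(6 := q0, 7 := q1, 8 := q2, 9 := q3, 10 := B, 11 := v,
            3 := Suc ?m, 2 := length st - 4, 4 := regs s 4 - 1)\<rparr>)" if "B = 1"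
          by (rule P_cong[OF P2]) (use that in \<open>auto simp: s2_def gh st fun_eq_iff\<close>)
        have 2: "P (s\<lparr>wmem := w, regs := (regs s)(6 := q0, 7 := q1, 8 := q2, 9 := q3, 10 := B, 11 := v,
            3 := Suc ?m, 2 := length st - 4, 5 := regs s 5 - 1)\<rparr>)" if "B \<noteq> 1"
          by (rule P_cong[OF P2]) (use that in \<open>auto simp: s2_def gh st fun_eq_iff\<close>)
        show ?thesis
          using 1 2 bnd r by (cases "B = 1") (simp_all add: s1_def less_imp_diff_less)
      qed
      have "wp M W emit (wp M W ?rest P) s1"
      proof (rule wp_emit[where ?q0.0 = q0 and ?q1.0 = q1 and ?q2.0 = q2 and ?q3.0 = q3 and n = n and m = ?m and col = col])
        show "2 * n + 4 * ?m + 4 \<le> M" "?m + 1 < W" using sorted(3) True r(3) M W by linarith+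
        show "odd (col q0 + col q1 + col q2 + col q3)"
          using True' unfolding B_def[symmetric] by (elim disjE conjE) simp_all
        show "wp M W ?rest P (s1\<lparr>wmem := w, regs := (regs s1)(11 := v, 3 := Suc ?m)\<rparr>)"
          if "\<And>a. a < 2 * n + 4 * ?m \<Longrightarrow> w a = wmem s1 a" "block n w ?m = ?Q" "centered n col w ?m"
          for w v
          using that by (rule post)
        show "n < W" "6 < W" using W by auto
        show "wmem s1 x = col x" if "x < n" for x using cc that by (simp add: s1_def)
        show "col x \<le> 1" for x by (rule col)
        show "q0 < n" "q1 < n" "q2 < n" "q3 < n" by (rule lt)+
        show "card ?Q = 4" by (rule cardQ)
      qed (use r(1) in \<open>simp_all add: s1_def B_def\<close>)
      moreover have "wval Count_blue (s\<lparr>regs := (regs s)(6 := q0, 7 := q1, 8 := q2, 9 := q3)\<rparr>) = B"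
        using cc lt by (simp add: Count_blue_def Cell_colour_def B_def)
      ultimately have "wp M W pop P s"
        using True True' r(1,2) top lt W B4 unfolding s1_def
        by (auto simp: pop_def Top_def)
      then show ?thesis unfolding P_def .
    qed
  qed
qed

definition count_body :: com where
  "count_body = Seq (Assign 5 (WAdd (Reg 5) (WLoad (Reg 1)))) (Assign 1 (WAdd (Reg 1) (WConst 1)))"

definition count_loop :: com where
  "count_loop = While (WLess (Reg 1) (Reg 0)) count_body"

definition count_inv :: "nat \<Rightarrow> (nat \<Rightarrow> nat) \<Rightarrow> nat \<Rightarrow> mstate \<Rightarrow> bool" where
  "count_inv n col k s \<longleftrightarrow> regs s 0 = n \<and> regs s 1 = k \<and> regs s 2 = 0 \<and> regs s 3 = 0 \<and>
     regs s 5 = sum col {..<k} \<and> (\<forall>x<n. wmem s x = col x)"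

lemma count_loop_correct:
  assumes init: "count_inv n col 0 s" and col: "\<And>x. col x \<le> 1" and W: "n < W"
  shows "halts_within (Suc (n * 3)) M W count_loop s (count_inv n col n)"
proof -
  have "halts_within (Suc (n * Suc 2)) M W count_loop s (count_inv n col n)"
    unfolding count_loop_def
  proof (rule halts_within_While[where I = "count_inv n col"])
    fix s assume "count_inv n col n s"
    then show "\<not> bval (WLess (Reg 1) (Reg 0)) s" by (simp add: count_inv_def)
  next
    fix k s assume I: "count_inv n col k s" and k: "k < n"
    have "sum col {..<Suc k} \<le> Suc k" using sum_bounded_above[of "{..<Suc k}" col 1] col by simp
    then have "wp M W count_body (count_inv n col (Suc k)) s"
      using I k W by (simp add: count_inv_def count_body_def)
    then show "bval (WLess (Reg 1) (Reg 0)) s \<and> halts_within 2 M W count_body s (count_inv n col (Suc k))"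
      using I k by (auto intro!: halts_within_wp simp: count_body_def count_inv_def)
  qed (rule init)
  then show ?thesis by simp
qed

text \<open>Solves \<open>3 * h + g = b\<close> and \<open>4 * (g + h) = n\<close> for \<open>g\<close> and \<open>h\<close>.\<close>

definition set_counters :: com where
  "set_counters = Seq (Assign 5 (WDiv (WSub (Reg 5) (WDiv (Reg 0) (WConst 4))) (WConst 2)))
     (Seq (Assign 4 (WSub (WDiv (Reg 0) (WConst 4)) (Reg 5))) (Assign 1 (WConst 0)))"

definition scan_body :: com where
  "scan_body = Seq push (Seq pop (Assign 1 (WAdd (Reg 1) (WConst 1))))"

definition scan_loop :: com where
  "scan_loop = While (WLess (Reg 1) (Reg 0)) scan_body"

definition scan_inv :: "nat \<Rightarrow> (nat \<Rightarrow> nat) \<Rightarrow> nat \<Rightarrow> mstate \<Rightarrow> bool" where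
  "scan_inv n col k s \<longleftrightarrow> regs s 1 = k \<and>
     (\<exists>st. stack_inv n col st k s \<and> irreducible_stack col st (regs s 4) (regs s 5))"

lemma set_counters_correct:
  assumes "count_inv n col n s" "n = 4 * (g + h)" "sum col {..<n} = 3 * h + g" "n < W"
  shows "wp M W set_counters (scan_inv n col 0) s"
proof -
  have r: "regs s 0 = n" "regs s 2 = 0" "regs s 3 = 0" "regs s 5 = 3 * h + g" "\<forall>x<n. wmem s x = col x"
    using assms(1,3) by (auto simp: count_inv_def)
  have "n div 4 = g + h" using assms(2) by simp
  moreover have "stars_inv n col (wmem s) 0 Y" for Y by (simp add: stars_inv_def)
  ultimately show ?thesis
    using r assms(2-4)
    by (auto simp: set_counters_def scan_inv_def stack_inv_def irreducible_stack_def
      lessThan_atLeast0 intro!: exI[of _ "[]"])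
qed

lemma wp_mono: "wp M W c Q s \<Longrightarrow> (\<And>s'. Q s' \<Longrightarrow> Q' s') \<Longrightarrow> wp M W c Q' s"
proof (induction c arbitrary: s Q Q')
  case (Seq c1 c2)
  show ?case using Seq.IH(1)[of "wp M W c2 Q" s "wp M W c2 Q'"] Seq.IH(2) Seq.prems by auto
next
  case (Cond b c1 c2)
  then show ?case by (auto split: if_splits)
qed auto

lemma stack_inv_reg_1: "stack_inv n col st k (s\<lparr>regs := (regs s)(1 := v)\<rparr>) \<longleftrightarrow> stack_inv n col st k s"
  by (simp add: stack_inv_def)

lemma scan_body_correct:
  assumes I: "scan_inv n col k s" and k: "k < n" and col: "\<And>x. col x \<le> 1"
    and M: "3 * n \<le> M" and W: "2 * n + 6 < W"
  shows "wp M W scan_body (scan_inv n col (Suc k)) s"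
proof -
  obtain st where st: "stack_inv n col st k s" "irreducible_stack col st (regs s 4) (regs s 5)"
    "regs s 1 = k"
    using I by (auto simp: scan_inv_def)
  have "wp M W push (\<lambda>s'. stack_inv n col (st @ [k]) (Suc k) s' \<and> regs s' 1 = k \<and>
     regs s' 4 = regs s 4 \<and> regs s' 5 = regs s 5) s"
    using stack_inv_push[OF st(1) k st(3)] M W by simp
  then have "wp M W push (wp M W (Seq pop (Assign 1 (WAdd (Reg 1) (WConst 1)))) (scan_inv n col (Suc k))) s"
  proof (rule wp_mono)
    fix s' assume s': "stack_inv n col (st @ [k]) (Suc k) s' \<and> regs s' 1 = k \<and>
     regs s' 4 = regs s 4 \<and> regs s' 5 = regs s 5"
    have "wp M W pop (\<lambda>s''. (\<exists>st'. stack_inv n col st' (Suc k) s'' \<and>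
        irreducible_stack col st' (regs s'' 4) (regs s'' 5)) \<and> regs s'' 1 = regs s' 1) s'"
      using s' st(2) by (intro stack_inv_pop[where st = "st @ [k]"] col M W) auto
    then have "wp M W pop (wp M W (Assign 1 (WAdd (Reg 1) (WConst 1))) (scan_inv n col (Suc k))) s'"
    proof (rule wp_mono)
      fix t assume t: "(\<exists>st'. stack_inv n col st' (Suc k) t \<and>
        irreducible_stack col st' (regs t 4) (regs t 5)) \<and> regs t 1 = regs s' 1"
      then have "regs t 1 = k" using s' by simp
      moreover have "scan_inv n col (Suc k) (t\<lparr>regs := (regs t)(1 := Suc k)\<rparr>)"
        using t unfolding scan_inv_def stack_inv_reg_1 by simp
      ultimately show "wp M W (Assign 1 (WAdd (Reg 1) (WConst 1))) (scan_inv n col (Suc k)) t"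
        using k W by simp
    qed
    then show "wp M W (Seq pop (Assign 1 (WAdd (Reg 1) (WConst 1)))) (scan_inv n col (Suc k)) s'"
      unfolding wp.simps(5) .
  qed
  then show ?thesis unfolding scan_body_def wp.simps(5) .
qed

lemma scan_loop_correct:
  assumes init: "scan_inv n col 0 s" and col: "\<And>x. col x \<le> 1" and M: "3 * n \<le> M" and W: "2 * n + 6 < W"
  shows "halts_within (Suc (n * 31)) M W scan_loop s (scan_inv n col n)"
proof -
  have "halts_within (Suc (n * Suc 30)) M W scan_loop s (scan_inv n col n)"
    unfolding scan_loop_def
  proof (rule halts_within_While[where I = "scan_inv n col"])
    fix s assume "scan_inv n col n s"
    then show "\<not> bval (WLess (Reg 1) (Reg 0)) s" by (auto simp: scan_inv_def stack_inv_def)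
  next
    fix k s assume I: "scan_inv n col k s" and k: "k < n"
    have "cost scan_body \<le> 30" by (simp add: scan_body_def push_def pop_def emit_def)
    then have "halts_within 30 M W scan_body s (scan_inv n col (Suc k))"
      using scan_body_correct[OF I k col M W] by (intro halts_within_wp)
    then show "bval (WLess (Reg 1) (Reg 0)) s \<and> halts_within 30 M W scan_body s (scan_inv n col (Suc k))"
      using I k by (auto simp: scan_inv_def stack_inv_def)
  qed (rule init)
  then show ?thesis by simp
qed

section \<open>Nested stars on a balanced residue\<close>

definition Stack :: "wexp \<Rightarrow> wexp" where "Stack e = WLoad (WAdd (Reg 0) e)"

text \<open>On an empty stack the cells compared are stale, but register 12 still becomes 0 or 1 and
  the loop that would use it does not run.\<close>

definition tail_init :: com where
  "tail_init = Seq (Cond (WEq (WLoad (Stack (WConst 0))) (WLoad (Stack (WConst 3))))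
       (Assign 12 (WConst 0)) (Assign 12 (WConst 1)))
     (Assign 1 (WConst 0))"

text \<open>A residue all of whose windows are balanced has period 4. After one point is dropped from its
  front (\<open>d = 1\<close>) or back (\<open>d = 0\<close>), stars with three front points and one back point alternate with
  stars with one front point and three back points; \<open>d\<close> is chosen such that all of them have three points
  of one colour.\<close>

definition Front :: wexp where "Front = WAdd (Reg 12) (WMul (WConst 2) (Reg 1))"

definition Back :: wexp where
  "Back = WSub (WAdd (Reg 2) (Reg 12)) (WAdd (WConst 2) (WMul (WConst 2) (Reg 1)))"

definition tail_pick :: com where
  "tail_pick = Cond (WEq (WMod (Reg 1) (WConst 2)) (WConst 0))
     (Seq (Assign 6 (Stack Front)) (Seq (Assign 7 (Stack (WAdd Front (WConst 1))))
       (Seq (Assign 8 (Stack (WAdd Front (WConst 2)))) (Assign 9 (Stack Back)))))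
     (Seq (Assign 6 (Stack (WAdd Front (WConst 1)))) (Seq (Assign 7 (Stack (WSub Back (WConst 1))))
       (Seq (Assign 8 (Stack Back)) (Assign 9 (Stack (WAdd Back (WConst 1)))))))"

definition tail_body :: com where
  "tail_body = Seq tail_pick (Seq (Assign 10 Count_blue)
     (Seq emit (Assign 1 (WAdd (Reg 1) (WConst 1)))))"

definition tail_loop :: com where
  "tail_loop = While (WLess (WAdd (Reg 1) (WConst 1)) (WDiv (Reg 2) (WConst 4))) tail_body"

text \<open>Each end loses two points per star on average; \<open>t mod 2\<close> corrects for the
  alternation between three and one. At t = 0 exactly one position is missing: the first for d = 1,
  the last for d = 0.\<close>

definition remaining :: "nat list \<Rightarrow> nat \<Rightarrow> nat \<Rightarrow> nat set" where
  "remaining w d t = (!) w ` {d + 2 * t + t mod 2..<length w + d + t mod 2 - 1 - 2 * t}"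

definition tail_inv :: "nat \<Rightarrow> (nat \<Rightarrow> nat) \<Rightarrow> nat list \<Rightarrow> nat \<Rightarrow> nat \<Rightarrow> nat \<Rightarrow> mstate \<Rightarrow> bool" where
  "tail_inv n col w c d t s \<longleftrightarrow>
     regs s 0 = n \<and> regs s 1 = t \<and> regs s 2 = length w \<and> regs s 3 = c + t \<and> regs s 12 = d \<and>
     (\<forall>x<n. wmem s x = col x) \<and> (\<forall>p<length w. wmem s (n + p) = w ! p) \<and>
     stars_inv n col (wmem s) (c + t) (remaining w d t)"

text \<open>Neighbouring windows share three points, so equal contents force the leaving and the
  entering point to have the same colour.\<close>

lemma window_2_periodic:
  fixes f :: "nat \<Rightarrow> nat"
  assumes win: "\<And>p. p + 4 \<le> m \<Longrightarrow> window f p = 2"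
  shows "p < m \<Longrightarrow> f p = f (p mod 4)"
proof (induction p rule: less_induct)
  case (less p)
  show ?case
  proof (cases "p < 4")
    case False
    then obtain q where q: "p = q + 4" by (metis add.commute le_Suc_ex not_less)
    have "window f q = 2" "window f (Suc q) = 2" using win[of q] win[of "Suc q"] less.prems q by auto
    then have "f q = f (q + 4)" by (simp add: window_def eval_nat_numeral)
    then show ?thesis using less.IH[of q] less.prems q by simp
  qed simp
qed

text \<open>Modulo 4 the vertices of each star are d, d + 1 and one further class taken twice, so
  the parity is that of \<open>f d + f (d + 1)\<close>.\<close>

lemma tail_star_odd:
  fixes f :: "nat \<Rightarrow> nat"
  assumes win: "\<And>p. p + 4 \<le> 8 * k \<Longrightarrow> window f p = 2" and f: "\<And>p. f p \<le> 1"
    and d: "d = (if f 0 = f 3 then 0 else 1)" and t: "Suc t < 2 * k"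
    and x: "x = d + 2 * t" and y: "y = 8 * k + d - (2 + 2 * t)"
  shows "even t \<Longrightarrow> odd (f x + f (x + 1) + f (x + 2) + f y)"
    and "odd t \<Longrightarrow> odd (f (x + 1) + f (y - 1) + f y + f (y + 1))"
proof -
  have per: "f p = f (p mod 4)" if "p < 8 * k" for p
    by (rule window_2_periodic[OF win]) (use that in auto)
  have "window f 0 = 2" using t by (intro win) auto
  then have sum: "f 0 + f 1 + f 2 + f 3 = 2" by (simp add: window_def numeral_2_eq_2)
  have z: "f p = 0 \<or> f p = 1" for p using f[of p] by linarith
  have d1: "d \<le> 1" using d by simp
  \<comment> \<open>In a balanced period, equal ends force the middle entries to have the other
    colour, and different ends force different middle entries. The choice of d selects an unequal
    pair of neighbours.\<close>
  have base: "odd (f d + f (d + 1))"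
    using sum z[of 0] z[of 1] z[of 2] z[of 3] unfolding d by (elim disjE) (auto simp: numeral_2_eq_2)
  show "odd (f x + f (x + 1) + f (x + 2) + f y)" if "even t"
  proof -
    obtain u where u: "t = 2 * u" using \<open>even t\<close> by blast
    have lt: "x + 2 < 8 * k" "y < 8 * k" using t d1 x y by auto
    have "x = 4 * u + d" "x + 1 = 4 * u + (d + 1)" "x + 2 = 4 * u + (d + 2)"
      by (simp_all add: x u)
    then have xm: "x mod 4 = d" "(x + 1) mod 4 = d + 1" "(x + 2) mod 4 = d + 2"
      using d1 by (simp_all only: mod_mult_self4) auto
    \<comment> \<open>The length is a multiple of 4, so positions counted from the back have a fixed
      class as well.\<close>
    have "y = 4 * (2 * k - u - 1) + (d + 2)" using t unfolding y u by simp
    then have ym: "y mod 4 = d + 2" using d1 by (simp only: mod_mult_self4) auto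
    have "f x = f d" "f (x + 1) = f (d + 1)" "f (x + 2) = f (d + 2)" "f y = f (d + 2)"
      using per[of x] per[of "x + 1"] per[of "x + 2"] per[of y] lt xm ym by auto
    then show ?thesis using base by simp
  qed
  show "odd (f (x + 1) + f (y - 1) + f y + f (y + 1))" if "odd t"
  proof -
    obtain u where u: "t = 2 * u + 1" using \<open>odd t\<close> by (metis oddE)
    have lt: "x + 1 < 8 * k" "y + 1 < 8 * k" using t d1 x y u by auto
    have "x + 1 = 4 * u + (d + 3)" by (simp add: x u)
    then have xm: "(x + 1) mod 4 = (d + 3) mod 4" by (simp only: mod_mult_self4)
    have "y = 4 * (2 * k - u - 1) + d" "y + 1 = 4 * (2 * k - u - 1) + (d + 1)"
      "y - 1 = 4 * (2 * k - u - 2) + (d + 3)"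
      using t unfolding y u by simp_all
    then have ym: "y mod 4 = d" "(y + 1) mod 4 = d + 1" "(y - 1) mod 4 = (d + 3) mod 4"
      using d1 by (simp_all only: mod_mult_self4) auto
    have "f (x + 1) = f ((d + 3) mod 4)" "f (y - 1) = f ((d + 3) mod 4)" "f y = f d" "f (y + 1) = f (d + 1)"
      using per[of "x + 1"] per[of "y - 1"] per[of y] per[of "y + 1"] lt xm ym by auto
    then show ?thesis using base by simp
  qed
qed

text \<open>Serves both star shapes: positions \<open>{L..<H}\<close> are available before the star
  and \<open>{L'..<H'}\<close> afterwards. All vertices lie beside the latter interval, so the star
  crosses nothing that remains.\<close>

lemma tail_emit_correct:
  fixes w :: "nat list"
  assumes I: "tail_inv n col w c d t s" and col: "\<And>x. col x \<le> 1"
    and w: "sorted_wrt (<) w" "set w \<subseteq> {..<n}" and n: "4 * c + length w = n" "4 * Suc t \<le> length w"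
    and M: "3 * n \<le> M" and W: "2 * n + 6 < W"
    and p: "distinct [p0, p1, p2, p3]"
    and rem: "remaining w d t = (!) w ` {L..<H}" "remaining w d (Suc t) = (!) w ` {L'..<H'}"
    and sub: "{p0, p1, p2, p3} \<subseteq> {L..<H}"
    and arc: "\<And>p. p \<in> {p0, p1, p2, p3} \<Longrightarrow> p < L' \<or> H' \<le> p"
    and LH: "L \<le> L'" "H' \<le> H" "H \<le> length w"
    and odd: "odd (col (w ! p0) + col (w ! p1) + col (w ! p2) + col (w ! p3))"
  shows "wp M W (Seq (Assign 10 Count_blue) (Seq emit (Assign 1 (WAdd (Reg 1) (WConst 1)))))
    (tail_inv n col w c d (Suc t))
    (s\<lparr>regs := (regs s)(6 := w ! p0, 7 := w ! p1, 8 := w ! p2, 9 := w ! p3)\<rparr>)"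
proof -
  let ?Q = "{w ! p0, w ! p1, w ! p2, w ! p3}" and ?P = "{p0, p1, p2, p3}"
  have J: "regs s 0 = n" "regs s 1 = t" "regs s 2 = length w" "regs s 3 = c + t" "regs s 12 = d"
     "\<And>x. x < n \<Longrightarrow> wmem s x = col x" "\<And>p. p < length w \<Longrightarrow> wmem s (n + p) = w ! p"
     "stars_inv n col (wmem s) (c + t) (remaining w d t)"
    using I unfolding tail_inv_def by blast+
  have pl: "p < length w" if "p \<in> ?P" for p using that sub LH(3) by fastforce
  have nl: "w ! p < n" if "p < length w" for p using w(2) that nth_mem by blast
  have less: "w ! p < w ! q" if "p < q" "q < length w" for p q
    using sorted_wrt_nth_less[OF w(1) that] .
  have inj: "inj_on ((!) w) {..<length w}"
    using w(1) by (intro inj_on_nth) (auto simp: strict_sorted_iff)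
  have Qimg: "?Q = (!) w ` ?P" by simp
  have "card ?P = 4" using p by simp
  then have cardQ: "card ?Q = 4"
    unfolding Qimg using inj_on_subset[OF inj, of ?P] pl by (subst card_image) auto
  let ?Y = "remaining w d (Suc t)"
  have QY: "?Q \<subseteq> remaining w d t" unfolding Qimg rem using sub by blast
  have Yn: "remaining w d t \<subseteq> {..<n}" unfolding rem using nl LH(3) by auto
  have arcY: "(\<forall>y\<in>?Y. q < y) \<or> (\<forall>y\<in>?Y. y < q)" if q: "q \<in> ?Q" for q
  proof -
    obtain p where pq: "p \<in> ?P" "q = w ! p" using q by blast
    consider "p < L'" | "H' \<le> p" using arc[OF pq(1)] by blast
    then show ?thesis
    proof cases
      case 1
      then have "\<forall>y\<in>?Y. q < y" unfolding rem pq(2) using less LH by auto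
      then show ?thesis ..
    next
      case 2
      then have "\<forall>y\<in>?Y. y < q" unfolding rem pq(2) using less pl[OF pq(1)] by auto
      then show ?thesis ..
    qed
  qed
  have Y': "?Y \<subseteq> remaining w d t - ?Q"
  proof
    fix y assume y: "y \<in> ?Y"
    then have "y \<notin> ?Q" using arcY[of y] by blast
    moreover have "y \<in> remaining w d t" using y LH unfolding rem by auto
    ultimately show "y \<in> remaining w d t - ?Q" by blast
  qed
  define B where "B = col (w ! p0) + col (w ! p1) + col (w ! p2) + col (w ! p3)"
  define s1 where "s1 = s\<lparr>regs := (regs s)(6 := w ! p0, 7 := w ! p1, 8 := w ! p2, 9 := w ! p3, 10 := B)\<rparr>"
  have lt: "w ! p0 < n" "w ! p1 < n" "w ! p2 < n" "w ! p3 < n" using nl pl by auto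
  have ct: "4 * (c + t) + 4 \<le> n" using n by simp
  have post: "wp M W (Assign 1 (WAdd (Reg 1) (WConst 1))) (tail_inv n col w c d (Suc t))
      (s1\<lparr>wmem := x, regs := (regs s1)(11 := v, 3 := Suc (c + t))\<rparr>)"
    if x: "\<And>a. a < 2 * n + 4 * (c + t) \<Longrightarrow> x a = wmem s1 a" "block n x (c + t) = ?Q" "centered n col x (c + t)"
    for x v
  proof -
    have "stars_inv n col x (Suc (c + t)) ?Y"
      by (rule stars_inv_extend[OF J(8) Yn QY cardQ Y']) 
        (use x arcY in \<open>auto simp: s1_def intro!: crossfree_arcI\<close>)
    moreover have "\<forall>y<n. x y = col y" using x(1) J(6) by (simp add: s1_def)
    moreover have "\<forall>p<length w. x (n + p) = w ! p" using x(1) J(7) n by (simp add: s1_def)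
    ultimately have "tail_inv n col w c d (Suc t)
      (s1\<lparr>wmem := x, regs := (regs s1)(11 := v, 3 := Suc (c + t), 1 := Suc t)\<rparr>)"
      using J(1-5) by (simp add: tail_inv_def s1_def)
    moreover have "Suc t < W" using ct W by simp
    ultimately show ?thesis using J(2) by (simp add: s1_def)
  qed
  have "wp M W emit (wp M W (Assign 1 (WAdd (Reg 1) (WConst 1))) (tail_inv n col w c d (Suc t))) s1"
  proof (rule wp_emit[where ?q0.0 = "w ! p0" and ?q1.0 = "w ! p1" and ?q2.0 = "w ! p2" and ?q3.0 = "w ! p3"
        and n = n and m = "c + t" and col = col])
    show "2 * n + 4 * (c + t) + 4 \<le> M" using ct M by linarith
    show "n < W" "6 < W" "c + t + 1 < W" using W ct by simp_all
    show "odd (col (w ! p0) + col (w ! p1) + col (w ! p2) + col (w ! p3))" by fact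
    show "wp M W (Assign 1 (WAdd (Reg 1) (WConst 1))) (tail_inv n col w c d (Suc t))
      (s1\<lparr>wmem := x, regs := (regs s1)(11 := v, 3 := Suc (c + t))\<rparr>)"
      if "\<And>a. a < 2 * n + 4 * (c + t) \<Longrightarrow> x a = wmem s1 a" "block n x (c + t) = ?Q" "centered n col x (c + t)"
      for x v
      using that by (rule post)
    show "wmem s1 x = col x" if "x < n" for x using J(6) that by (simp add: s1_def)
    show "col x \<le> 1" for x by (rule col)
    show "w ! p0 < n" "w ! p1 < n" "w ! p2 < n" "w ! p3 < n" by (rule lt)+
    show "card ?Q = 4" by (rule cardQ)
  qed (use J(1,4) in \<open>simp_all add: s1_def B_def\<close>)
  moreover have "wval Count_blue (s\<lparr>regs := (regs s)(6 := w ! p0, 7 := w ! p1, 8 := w ! p2, 9 := w ! p3)\<rparr>) = B"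
    using J(6) lt by (simp add: Count_blue_def Cell_colour_def B_def)
  moreover have "B < W" using col[of "w ! p0"] col[of "w ! p1"] col[of "w ! p2"] col[of "w ! p3"] W by (simp add: B_def)
  ultimately show ?thesis unfolding wp.simps(5) wp.simps(2)[of M W 10] s1_def by simp
qed

lemma tail_body_correct:
  assumes I: "tail_inv n col w c d t s" and col: "\<And>x. col x \<le> 1"
    and w: "sorted_wrt (<) w" "set w \<subseteq> {..<n}" "4 * c + length w = n" "length w = 8 * k"
    and win: "\<And>p. p + 4 \<le> 8 * k \<Longrightarrow> window (\<lambda>i. col (w ! i)) p = 2"
    and d: "d = (if col (w ! 0) = col (w ! 3) then 0 else 1)" and t: "Suc t < 2 * k"
    and M: "3 * n \<le> M" and W: "2 * n + 6 < W"
  shows "wp M W tail_body (tail_inv n col w c d (Suc t)) s"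
proof -
  define x y where "x = d + 2 * t" "y = 8 * k + d - (2 + 2 * t)"
  note xy = this
  have d1: "d \<le> 1" using d by simp
  have xy3: "x + 2 < y" "y \<le> 8 * k - 1" using t d1 by (auto simp: xy)
  have r: "regs s 0 = n" "regs s 1 = t" "regs s (Suc 0) = t" "regs s 2 = length w" "regs s 12 = d"
    and cells: "\<And>p. p < 8 * k \<Longrightarrow> wmem s (n + p) = w ! p"
    using I w(4) by (auto simp: tail_inv_def)
  have lt: "w ! p < W" if "p < 8 * k" for p
  proof -
    have "w ! p \<in> set w" using that w(4) by simp
    then show ?thesis using w(2) W by auto
  qed
  have pos: "wval Front (s\<lparr>regs := r\<rparr>) = x" "wval Back (s\<lparr>regs := r\<rparr>) = y" "wval Front s = x" "wval Back s = y"
    if "r (Suc 0) = t" "r 2 = length w" "r 12 = d" for r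
    using that r w(4) by (simp_all add: Front_def Back_def xy)
  note pos = pos(1,2) pos(3,4)[OF r(3-5)]
  let ?rest = "Seq (Assign 10 Count_blue) (Seq emit (Assign 1 (WAdd (Reg 1) (WConst 1))))"
  let ?Q = "wp M W ?rest (tail_inv n col w c d (Suc t))"
  have odd: "even t \<Longrightarrow> odd (col (w ! x) + col (w ! (x + 1)) + col (w ! (x + 2)) + col (w ! y))"
    "odd t \<Longrightarrow> odd (col (w ! (x + 1)) + col (w ! (y - 1)) + col (w ! y) + col (w ! (y + 1)))"
    using tail_star_odd[of k "\<lambda>i. col (w ! i)" d t x y] win col d t xy by blast+
  have t4: "4 * Suc t \<le> length w" using t w(4) by simp
  have "wp M W tail_pick P s" if "?Q = P" for P
  proof (cases "even t")
    case True
    have "?Q (s\<lparr>regs := (regs s)(6 := w ! x, 7 := w ! (x + 1), 8 := w ! (x + 2), 9 := w ! y)\<rparr>)"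
    proof (rule tail_emit_correct[OF I col w(1-3) t4 M W])
      show "remaining w d t = (!) w ` {x..<Suc y}" "remaining w d (Suc t) = (!) w ` {x + 3..<y}"
        using True t d1 unfolding remaining_def w(4) xy
        by (auto simp: odd_iff_mod_2_eq_one mod_Suc intro!: arg_cong[where f = "(`) ((!) w)"])
      show "odd (col (w ! x) + col (w ! (x + 1)) + col (w ! (x + 2)) + col (w ! y))"
        using odd(1)[OF True] .
    qed (use xy3 w(4) in auto)
    then have "P (s\<lparr>regs := (regs s)(6 := w ! x, 7 := w ! (x + 1), 8 := w ! (x + 2), 9 := w ! y)\<rparr>)"
      unfolding that .
    then show ?thesis
      using True r(1-3) xy3 cells[of x] cells[of "x + 1"] cells[of "x + 2"] cells[of y]
        lt[of x] lt[of "x + 1"] lt[of "x + 2"] lt[of y]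
      by (simp add: tail_pick_def Stack_def pos r)
  next
    case False
    have y1: "x + 1 < y - 1" "y + 1 < 8 * k" using t d1 False by (auto simp: xy elim!: oddE)
    have "?Q (s\<lparr>regs := (regs s)(6 := w ! (x + 1), 7 := w ! (y - 1), 8 := w ! y, 9 := w ! (y + 1))\<rparr>)"
    proof (rule tail_emit_correct[OF I col w(1-3) t4 M W])
      show "remaining w d t = (!) w ` {x + 1..<y + 2}" "remaining w d (Suc t) = (!) w ` {x + 2..<y - 1}"
        using False t d1 unfolding remaining_def w(4) xy
        by (auto simp: odd_iff_mod_2_eq_one mod_Suc intro!: arg_cong[where f = "(`) ((!) w)"])
      show "odd (col (w ! (x + 1)) + col (w ! (y - 1)) + col (w ! y) + col (w ! (y + 1)))"
        using odd(2) False .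
    qed (use y1 w(4) in auto)
    then have "P (s\<lparr>regs := (regs s)(6 := w ! (x + 1), 7 := w ! (y - 1), 8 := w ! y, 9 := w ! (y + 1))\<rparr>)"
      unfolding that .
    then show ?thesis
      using False r(1-3) y1 cells[of "x + 1"] cells[of "y - 1"] cells[of y] cells[of "y + 1"]
        lt[of "x + 1"] lt[of "y - 1"] lt[of y] lt[of "y + 1"]
      by (simp add: tail_pick_def Stack_def pos r odd_iff_mod_2_eq_one)
  qed
  then have "wp M W tail_pick ?Q s" by blast
  then show ?thesis unfolding tail_body_def wp.simps(5)[of M W tail_pick] .
qed

lemma tail_loop_correct:
  assumes init: "tail_inv n col w c d 0 s" and col: "\<And>x. col x \<le> 1"
    and w: "sorted_wrt (<) w" "set w \<subseteq> {..<n}" "4 * c + length w = n"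
    and k: "w \<noteq> [] \<Longrightarrow> length w = 8 * k"
    and win: "\<And>p. w \<noteq> [] \<Longrightarrow> p + 4 \<le> 8 * k \<Longrightarrow> window (\<lambda>i. col (w ! i)) p = 2"
    and d: "w \<noteq> [] \<Longrightarrow> d = (if col (w ! 0) = col (w ! 3) then 0 else 1)"
    and M: "3 * n \<le> M" and W: "2 * n + 6 < W"
  shows "halts_within (Suc (n * 31)) M W tail_loop s (tail_inv n col w c d (length w div 4 - 1))"
proof -
  \<comment> \<open>For an empty residue truncated subtraction makes this 0, and no star is
    added.\<close>
  let ?m = "length w div 4 - 1"
  have "halts_within (Suc (?m * Suc 30)) M W tail_loop s (tail_inv n col w c d ?m)"
    unfolding tail_loop_def
  proof (rule halts_within_While[where I = "tail_inv n col w c d"])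
    fix s assume "tail_inv n col w c d ?m s"
    then show "\<not> bval (WLess (WAdd (Reg 1) (WConst 1)) (WDiv (Reg 2) (WConst 4))) s"
      by (auto simp: tail_inv_def)
  next
    fix t s assume I: "tail_inv n col w c d t s" and t: "t < ?m"
    then have ne: "w \<noteq> []" by auto
    have t': "Suc t < 2 * k" using t k[OF ne] by simp
    have "cost tail_body \<le> 30"
      by (simp add: tail_body_def tail_pick_def emit_def)
    then have "halts_within 30 M W tail_body s (tail_inv n col w c d (Suc t))"
      using tail_body_correct[OF I col w k[OF ne] win[OF ne] d[OF ne] t' M W]
      by (intro halts_within_wp)
    moreover have "bval (WLess (WAdd (Reg 1) (WConst 1)) (WDiv (Reg 2) (WConst 4))) s"
      using I t by (simp add: tail_inv_def)
    ultimately show "bval (WLess (WAdd (Reg 1) (WConst 1)) (WDiv (Reg 2) (WConst 4))) s \<and>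
        halts_within 30 M W tail_body s (tail_inv n col w c d (Suc t))" by blast
  qed (rule init)
  moreover have "?m \<le> n" using w(3) by linarith
  then have "Suc (?m * Suc 30) \<le> Suc (n * 31)" by simp
  ultimately show ?thesis using halts_within_mono by blast
qed

definition cover :: com where
  "cover = Seq count_loop (Seq set_counters (Seq scan_loop (Seq tail_init (Seq tail_loop
     (Seq (Assign 1 (WMul (WConst 2) (Reg 0))) (Assign 0 (Reg 3)))))))"

definition cover_post :: "nat \<Rightarrow> (nat \<Rightarrow> nat) \<Rightarrow> mstate \<Rightarrow> bool" where
  "cover_post n col s \<longleftrightarrow> regs s 1 = 2 * n \<and> n \<le> 4 * regs s 0 + 4 \<and>
     stars_inv n col (wmem s) (regs s 0) {}"

lemma scan_inv_final:
  assumes I: "scan_inv n col n s" and col: "\<And>x. col x \<le> 1"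
  obtains w k where "sorted_wrt (<) w" "set w \<subseteq> {..<n}" "4 * regs s 3 + length w = n"
    "w \<noteq> [] \<Longrightarrow> length w = 8 * k"
    "\<And>p. w \<noteq> [] \<Longrightarrow> p + 4 \<le> 8 * k \<Longrightarrow> window (\<lambda>i. col (w ! i)) p = 2"
    "regs s 0 = n" "regs s 2 = length w" "\<forall>x<n. wmem s x = col x" "\<forall>p<length w. wmem s (n + p) = w ! p"
    "stars_inv n col (wmem s) (regs s 3) (set w)"
proof -
  obtain w where I: "stack_inv n col w n s" and irr: "irreducible_stack col w (regs s 4) (regs s 5)"
    using I by (auto simp: scan_inv_def)
  have J: "regs s 0 = n" "regs s 2 = length w" "\<forall>x<n. wmem s x = col x"
    "\<forall>p<length w. wmem s (n + p) = w ! p" "sorted_wrt (<) w" "set w \<subseteq> {..<n}"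
    "4 * regs s 3 + length w = n" "sum col (set w) = 3 * regs s 5 + regs s 4"
    "length w = 4 * (regs s 4 + regs s 5)" "stars_inv n col (wmem s) (regs s 3) (set w)"
    using I by (simp_all add: stack_inv_def)
  let ?g = "regs s 4" and ?h = "regs s 5" and ?f = "\<lambda>i. col (w ! i)"
  have "distinct w" using J(5) by (simp add: strict_sorted_iff)
  \<comment> \<open>The invariant counts blue points in a set, \<open>irreducible_word\<close> along
    positions; distinctness identifies the two.\<close>
  then have "sum ?f {..<length w} = sum col (set w)"
    using sum.reindex_bij_betw[OF bij_betw_nth[of w "{..<length w}" "set w"], of col] by simp
  then have sum: "sum ?f {..<4 * (?g + ?h)} = 3 * ?h + ?g" using J(8,9) by simp
  have gh: "?g = ?h \<and> (\<forall>p. p + 4 \<le> 4 * (?g + ?h) \<longrightarrow> window ?f p = 2)" if "w \<noteq> []"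
  proof (rule irreducible_word[OF col sum])
    show "0 < ?g + ?h" using that J(9) by (cases w) auto
    show "(window ?f p = 1 \<longrightarrow> ?g = 0) \<and> (window ?f p = 3 \<longrightarrow> ?h = 0)" if "p + 4 \<le> 4 * (?g + ?h)" for p
      using irr that J(9) by (auto simp: irreducible_stack_def)
  qed
  show ?thesis
    using J gh by (intro that[of w ?g]) auto
qed

lemma cover_correct:
  assumes init: "count_inv n col 0 s" and col: "\<And>x. col x \<le> 1"
    and n: "n = 4 * (g + h)" and sum: "sum col {..<n} = 3 * h + g"
    and M: "3 * n \<le> M" and W: "2 * n + 6 < W"
  shows "halts_within (n * 65 + 12) M W cover s (cover_post n col)"
proof -
  have "halts_within (Suc (n * 3) + (3 + (Suc (n * 31) + (4 + (Suc (n * 31) + 2))))) M W cover s (cover_post n col)"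
    unfolding cover_def
  proof (rule halts_within_Seq)
    show "halts_within (Suc (n * 3)) M W count_loop s (count_inv n col n)"
      using count_loop_correct[OF init col] W by simp
  next
    fix s assume I: "count_inv n col n s"
    show "halts_within (3 + (Suc (n * 31) + (4 + (Suc (n * 31) + 2)))) M W (Seq set_counters (Seq scan_loop (Seq tail_init (Seq tail_loop
     (Seq (Assign 1 (WMul (WConst 2) (Reg 0))) (Assign 0 (Reg 3))))))) s (cover_post n col)"
    proof (rule halts_within_Seq)
      show "halts_within 3 M W set_counters s (scan_inv n col 0)"
        using set_counters_correct[OF I n sum, of W M] W
        by (intro halts_within_wp) (simp_all add: set_counters_def)
    next
      fix s assume I: "scan_inv n col 0 s"
      show "halts_within (Suc (n * 31) + (4 + (Suc (n * 31) + 2))) M W (Seq scan_loop (Seq tail_init (Seq tail_loop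
     (Seq (Assign 1 (WMul (WConst 2) (Reg 0))) (Assign 0 (Reg 3)))))) s (cover_post n col)"
      proof (rule halts_within_Seq)
        show "halts_within (Suc (n * 31)) M W scan_loop s (scan_inv n col n)"
          by (rule scan_loop_correct[OF I col M W])
      next
        fix s assume I: "scan_inv n col n s"
        obtain w k where
          w: "sorted_wrt (<) w" "set w \<subseteq> {..<n}" "4 * regs s 3 + length w = n"
          and k: "w \<noteq> [] \<Longrightarrow> length w = 8 * k"
            "\<And>p. w \<noteq> [] \<Longrightarrow> p + 4 \<le> 8 * k \<Longrightarrow> window (\<lambda>i. col (w ! i)) p = 2"
          and J: "regs s 0 = n" "regs s 2 = length w" "\<forall>x<n. wmem s x = col x"
            "\<forall>p<length w. wmem s (n + p) = w ! p"
            "stars_inv n col (wmem s) (regs s 3) (set w)"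
          by (rule scan_inv_final[OF I col]) (rule that)
        define c where "c = regs s 3"
        define d :: nat where "d = (if wmem s (wmem s n) = wmem s (wmem s (n + 3)) then 0 else 1)"
        have dw: "d = (if col (w ! 0) = col (w ! 3) then 0 else 1)" if "w \<noteq> []"
        proof -
          have l: "0 < length w" "3 < length w" using k(1)[OF that] that by (cases k; simp)+
          then have "wmem s (n + 0) = w ! 0" "wmem s (n + 3) = w ! 3" using J(4) by blast+
          moreover have "w ! 0 < n" "w ! 3 < n" using w(2) l nth_mem by blast+
          ultimately show ?thesis using J(3) by (simp add: d_def)
        qed
        have rem: "remaining w d 0 \<subseteq> set w"
        proof -
          have "length w + d - 1 \<le> length w" by (simp add: d_def)
          then show ?thesis by (auto simp: remaining_def)
        qed
        have "tail_inv n col w c d 0 (s\<lparr>regs := (regs s)(12 := d, 1 := 0)\<rparr>)"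
          using J rem stars_inv_mono[OF J(5) rem] by (simp add: tail_inv_def c_def)
        then have ti: "wp M W tail_init (tail_inv n col w c d 0) s"
          using J(1) W by (auto simp: tail_init_def Stack_def d_def split: if_splits)
        show "halts_within (4 + (Suc (n * 31) + 2)) M W (Seq tail_init (Seq tail_loop
          (Seq (Assign 1 (WMul (WConst 2) (Reg 0))) (Assign 0 (Reg 3))))) s (cover_post n col)"
        proof (rule halts_within_Seq)
          show "halts_within 4 M W tail_init s (tail_inv n col w c d 0)"
            using ti by (rule halts_within_wp) (simp add: tail_init_def)
        next
          fix s assume I: "tail_inv n col w c d 0 s"
          show "halts_within (Suc (n * 31) + 2) M W (Seq tail_loop
            (Seq (Assign 1 (WMul (WConst 2) (Reg 0))) (Assign 0 (Reg 3)))) s (cover_post n col)"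
          proof (rule halts_within_Seq)
            show "halts_within (Suc (n * 31)) M W tail_loop s (tail_inv n col w c d (length w div 4 - 1))"
              using tail_loop_correct[OF I col w(1,2) _ k dw M W] w(3) by (simp add: c_def)
          next
            fix s assume I: "tail_inv n col w c d (length w div 4 - 1) s"
            define m where "m = c + (length w div 4 - 1)"
            have r: "regs s 0 = n" "regs s 3 = m" "stars_inv n col (wmem s) m {}"
              using I by (auto simp: tail_inv_def m_def elim: stars_inv_mono)
            \<comment> \<open>Divisibility makes the number of uncovered points exactly 4 if the
              residue is nonempty, and 0 otherwise.\<close>
            have "4 dvd length w" using w(3) n by presburger
            then have "n \<le> 4 * m + 4" "m \<le> n" using w(3) by (auto simp: m_def c_def[symmetric])
            then show "halts_within 2 M W (Seq (Assign 1 (WMul (WConst 2) (Reg 0))) (Assign 0 (Reg 3))) s (cover_post n col)"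
              using r W by (intro halts_within_wp) (simp_all add: cover_post_def)
          qed
        qed
      qed
    qed
  qed
  then show ?thesis by (rule halts_within_mono) auto
qed

section \<open>From the table of stars to a covering\<close>

context convex_polygon
begin

text \<open>The blocks are disjoint and nonempty, so different table rows give different stars; this
  yields both the bijection required of the output and the count of covered points.\<close>

lemma cover_post_outputs:
  assumes post: "cover_post (length qs) col s"
  shows "\<exists>X P. X \<subseteq> R \<union> B \<and> length qs \<le> card X + 4 \<and> K13_covering R B X P \<and>
    outputs_covering R B qs s P"
proof -
  let ?n = "length qs" and ?m = "regs s 0"
  let ?b = "block ?n (wmem s)"
  let ?F = "?b ` {..<?m}"
  have r: "regs s 1 = 2 * ?n" "?n \<le> 4 * ?m + 4" and inv: "stars_inv ?n col (wmem s) ?m {}"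
    using post by (auto simp: cover_post_def)
  have sub: "?b j \<subseteq> {..<?n}" "card (?b j) = 4" "centered ?n col (wmem s) j" if "j < ?m" for j
    using inv that by (auto simp: stars_inv_def)
  have pair: "disjnt (?b j) (?b j')" "crossfree (?b j) (?b j')" if "j < ?m" "j' < ?m" "j \<noteq> j'" for j j'
    using inv that by (auto simp: stars_inv_def)
  have first: "wmem s (2 * ?n + 4 * j) \<in> ?b j" for j
    by (auto simp: block_def intro!: image_eqI[of _ _ 0])
  have cen: "is_center R B ((!) qs ` ?b j) (qs ! wmem s (2 * ?n + 4 * j))" if "j < ?m" for j
    using sub[OF that] first[of j] by (intro is_center_image) (auto simp: centered_def)
  have good: "X \<subseteq> {..<?n} \<and> good col X" if X: "X \<in> ?F" for X
  proof -
    obtain j where j: "j < ?m" "X = ?b j" using X by auto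
    then show ?thesis using sub[OF j(1)] is_center_imp_good[OF sub(1)[OF j(1)] cen[OF j(1)]] by simp
  qed
  have K: "K13_covering R B ((!) qs ` \<Union>?F) ((`) ((!) qs) ` ?F)"
  proof (rule K13_covering_image)
    have "disjnt X Y \<and> crossfree X Y" if XY: "X \<in> ?F" "Y \<in> ?F" "X \<noteq> Y" for X Y
    proof -
      obtain j j' where "j < ?m" "j' < ?m" "X = ?b j" "Y = ?b j'" using XY by auto
      then show ?thesis using pair[of j j'] XY(3) by auto
    qed
    then show "pairwise disjnt ?F" "pairwise crossfree ?F" by (simp_all add: pairwise_def)
  qed (rule good)
  have inj_b: "inj_on ?b {..<?m}"
  proof (rule inj_onI, rule ccontr)
    fix j j' assume "j \<in> {..<?m}" "j' \<in> {..<?m}" "?b j = ?b j'" "j \<noteq> j'"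
    then have "disjnt (?b j) (?b j)" "card (?b j) = 4" using pair(1)[of j j'] sub(2)[of j] by simp_all
    then show False by simp
  qed
  have Un: "\<Union>?F \<subseteq> {..<?n}" using sub(1) by blast
  have "finite (?b j)" for j by (simp add: block_def)
  then have "card (\<Union>?F) = (\<Sum>j<?m. card (?b j))"
    using pair(1) by (intro card_UN_disjoint) (auto simp: disjnt_def)
  then have "card (\<Union>?F) = 4 * ?m" using sub(2) by simp
  then have card: "card ((!) qs ` \<Union>?F) = 4 * ?m"
    using card_image[OF inj_on_subset[OF inj_nth Un]] by simp
  have cell: "output_cell qs s j ` {..<4} = (!) qs ` ?b j" for j
    unfolding output_cell_def block_def r(1) by (simp add: image_image)
  have cell0: "output_cell qs s j 0 = qs ! wmem s (2 * ?n + 4 * j)" for j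
    unfolding output_cell_def r(1) by simp
  have "inj_on ((`) ((!) qs)) (Pow {..<?n})" using inj_nth by (rule inj_on_image_Pow)
  then have "inj_on ((`) ((!) qs)) ?F" by (rule inj_on_subset) (use sub(1) in blast)
  then have "bij_betw (\<lambda>j. output_cell qs s j ` {..<4}) {..<?m} ((`) ((!) qs) ` ?F)"
    unfolding cell bij_betw_def using inj_b
    by (auto simp: image_image intro: comp_inj_on[of ?b _ "(`) ((!) qs)", unfolded comp_def])
  moreover have "wmem s (2 * ?n + 4 * j + i) < ?n" if "j < ?m" "i < 4" for j i
    using sub(1)[OF that(1)] that(2) by (auto simp: block_def)
  ultimately have "outputs_covering R B qs s ((`) ((!) qs) ` ?F)"
    unfolding outputs_covering_def cell cell0 r(1) using cen by simp
  moreover have "(!) qs ` \<Union>?F \<subseteq> R \<union> B" using Un set_qs by (auto simp: set_conv_nth)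
  ultimately show ?thesis using K card r(2) by (intro exI conjI) auto
qed

end

theorem theorem10:
  shows "(\<exists>c T M W.
            (\<lambda>n. real (T n)) \<in> O(\<lambda>n. real n ^ 5) \<and>
            (\<lambda>n. real (M n)) \<in> O(\<lambda>n. real n ^ 2) \<and>
            logarithmic_words W \<and>
            (\<forall>(g::nat) (h::nat) R B ps n.
               finite R \<and> finite B \<and> R \<inter> B = {} \<and>
               card R = 3 * g + h \<and> card B = 3 * h + g \<and>
               convex_position (R \<union> B) \<and> n = card (R \<union> B) \<and>
               distinct ps \<and> set ps = R \<union> B \<longrightarrow>
               halts_within (T n) (M n) (W n) c (input B ps)
                 (\<lambda>s. regs s 0 = (if \<exists>P. K13_covering R B (R \<union> B) P then 1 else 0))))
       \<and> (\<exists>c T M W.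
            (\<lambda>n. real (T n)) \<in> O(\<lambda>n. real n) \<and>
            logarithmic_words W \<and>
            (\<forall>(g::nat) (h::nat) R B ps n.
               finite R \<and> finite B \<and> R \<inter> B = {} \<and>
               card R = 3 * g + h \<and> card B = 3 * h + g \<and>
               convex_position (R \<union> B) \<and> n = card (R \<union> B) \<and>
               distinct ps \<and> set ps = R \<union> B \<and> ccw_order ps \<longrightarrow>
               halts_within (T n) (M n) (W n) c (input B ps)
                 (\<lambda>s. \<exists>X P. X \<subseteq> R \<union> B \<and> int (card X) \<ge> 4 * (int g + int h) - 4 \<and>
                            K13_covering R B X P \<and> outputs_covering R B ps s P)))"
proof (rule conjI)
  have log: "logarithmic_words (\<lambda>n. a * (n + 1) ^ k)" for a k
    unfolding logarithmic_words_def using poly_bigo by blast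
  show "\<exists>c T M W. (\<lambda>n. real (T n)) \<in> O(\<lambda>n. real n ^ 5) \<and> (\<lambda>n. real (M n)) \<in> O(\<lambda>n. real n ^ 2) \<and>
      logarithmic_words W \<and>
      (\<forall>(g::nat) (h::nat) R B ps n.
         finite R \<and> finite B \<and> R \<inter> B = {} \<and> card R = 3 * g + h \<and> card B = 3 * h + g \<and>
         convex_position (R \<union> B) \<and> n = card (R \<union> B) \<and> distinct ps \<and> set ps = R \<union> B \<longrightarrow>
         halts_within (T n) (M n) (W n) c (input B ps)
           (\<lambda>s. regs s 0 = (if \<exists>P. K13_covering R B (R \<union> B) P then 1 else 0)))"
    by (rule exI[of _ decide], rule exI[of _ "\<lambda>n. 20 * (n + 1) ^ 5"],
        rule exI[of _ "\<lambda>n. 4 * (n + 1) ^ 2"], rule exI[of _ "\<lambda>n. 2 * (n + 1) ^ 5"],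
        intro conjI allI impI poly_bigo log, elim conjE, rule decide_correct)
  \<comment> \<open>Colours, stack and stars take at most n cells each; the word bound only has to
    exceed \<open>2 * n + 6\<close>.\<close>
  have main: "halts_within (65 * (n + 1) ^ 1) (3 * n) (7 * (n + 1) ^ 1) cover (input B ps)
      (\<lambda>s. \<exists>X P. X \<subseteq> R \<union> B \<and> int (card X) \<ge> 4 * (int g + int h) - 4 \<and>
         K13_covering R B X P \<and> outputs_covering R B ps s P)"
    if A: "finite R" "finite B" "R \<inter> B = {}" "card R = 3 * g + h" "card B = 3 * h + g"
      "n = card (R \<union> B)" "distinct ps" "set ps = R \<union> B" "ccw_order ps" for g h R B ps n
  proof -
    interpret convex_polygon R B ps by unfold_locales (use A in auto)
    have n: "n = 4 * (g + h)" using A by (simp add: card_Un_disjoint)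
    have len: "length ps = n" using A by (metis distinct_card)
    have col1: "col x \<le> 1" for x by (simp add: col_def)
    have "sum col {..<n} = card {i \<in> {..<n}. ps ! i \<in> B}"
      by (simp add: col_def len sum.If_cases Int_def conj_commute)
    also have "\<dots> = card {v \<in> set ps. v \<in> B}"
      using distinct_length_filter[OF A(7), of "\<lambda>v. v \<in> B"]
      by (simp add: length_filter_conv_card len Int_def conj_commute)
    also have "{v \<in> set ps. v \<in> B} = B" using A(8) by auto
    finally have sum: "sum col {..<n} = 3 * h + g" using A(5) by simp
    have "count_inv n col 0 (input B ps)"
      by (simp add: count_inv_def input_def len col_def)
    then have "halts_within (n * 65 + 12) (3 * n) (7 * (n + 1) ^ 1) cover (input B ps) (cover_post n col)"
      using n sum by (intro cover_correct col1) auto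
    then show ?thesis
    proof (rule halts_within_mono)
      fix s assume "cover_post n col s"
      then obtain X P where XP: "X \<subseteq> R \<union> B" "n \<le> card X + 4" "K13_covering R B X P" "outputs_covering R B ps s P"
        using cover_post_outputs[of s] len by auto
      moreover have "int (card X) \<ge> 4 * (int g + int h) - 4" using XP(2) n by simp
      ultimately show "\<exists>X P. X \<subseteq> R \<union> B \<and> int (card X) \<ge> 4 * (int g + int h) - 4 \<and>
         K13_covering R B X P \<and> outputs_covering R B ps s P" by blast
    qed simp
  qed
  have lin: "(\<lambda>n. real (65 * (n + 1) ^ 1)) \<in> O(\<lambda>n. real n)"
    using poly_bigo[of 65 1] by simp
  show "\<exists>c T M W. (\<lambda>n. real (T n)) \<in> O(\<lambda>n. real n) \<and> logarithmic_words W \<and>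
      (\<forall>(g::nat) (h::nat) R B ps n.
         finite R \<and> finite B \<and> R \<inter> B = {} \<and> card R = 3 * g + h \<and> card B = 3 * h + g \<and>
         convex_position (R \<union> B) \<and> n = card (R \<union> B) \<and> distinct ps \<and> set ps = R \<union> B \<and> ccw_order ps \<longrightarrow>
         halts_within (T n) (M n) (W n) c (input B ps)
           (\<lambda>s. \<exists>X P. X \<subseteq> R \<union> B \<and> int (card X) \<ge> 4 * (int g + int h) - 4 \<and>
              K13_covering R B X P \<and> outputs_covering R B ps s P))"
    by (rule exI[of _ cover], rule exI[of _ "\<lambda>n. 65 * (n + 1) ^ 1"], rule exI[of _ "\<lambda>n. 3 * n"],
        rule exI[of _ "\<lambda>n. 7 * (n + 1) ^ 1"], intro conjI allI impI lin log, elim conjE, rule main)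
qed

end
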